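(* Let $\Gamma$ be a finitely generated Stuck-Zimmer group and let $(\Gamma_n)_n$ be a sequence of finite index subgroups of $\Gamma$ such that $[\Gamma:\Gamma_n]\to\infty$. 1. For every torsion free subgroup $\Lambda<\Gamma$, the induced actions $\Lambda\curvearrowright\Gamma/\Gamma_n$ define a sofic approximation of $\Lambda$. In particular, if $\Gamma$ is torsion free (or strongly Stuck-Zimmer), then $(\Gamma_n)_n$ is a Farber sequence. 2. If $\Gamma$ is torsion free and has fixed price $\mathscr C_*(\Gamma)$, then $$\lim_{n\to\infty}\frac{\mathrm{rank}(\Gamma_n)-1}{[\Gamma:\Gamma_n]}=\mathscr C_*(\Gamma)-1.$$ 3. If $\Gamma$ has fixed price equal to $1$ and admits a finite index torsion free subgroup, then $$\lim_{n\to\infty}\frac{\mathrm{rank}(\Gamma_n)-1}{[\Gamma:\Gamma_n]}=0.$$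
   Context: A countable group $\Gamma$ is a Stuck-Zimmer group (resp. strong Stuck-Zimmer group) if each p.m.p. action of $\Gamma$ on a standard probability space satisfies the dichotomy: either there is a non-null invariant set consisting of finite orbits, or almost every stabilizer is finite (resp. trivial). $\mathrm{rank}$ is the minimal number of generators. For a group $\Lambda$ acting on finite sets $Y_n$ (with uniform probability measures), the actions define a sofic approximation of $\Lambda$ if for every non-principal ultrafilter $\mathfrak u$ on $\mathbb N$ the ultraproduct action $\lambda[y_n]_{\mathfrak u}=[\lambda y_n]_{\mathfrak u}$ of $\Lambda$ on the Loeb probability space $\prod_nY_n/\mathfrak u$ is essentially free; equivalently, for every $\lambda\in\Lambda\setminus\{1\}$, $|\{y\in Y_n:\lambda y=y\}|/|Y_n|\to0$. A sequence $(\Gamma_n)_n$ of finite index subgroups of $\Gamma$ is a Farber sequence if for every $\gamma\in\Gamma\setminus\{1\}$, $\frac{|\{g\Gamma_n\in\Gamma/\Gamma_n:\gamma\in g\Gamma_ng^{-1}\}|}{[\Gamma:\Gamma_n]}\to0$. The cost of a p.m.p. equivalence relation $\mathcal R$ with countable classes on a standard probability space $(X,\mu)$ is the infimum of $\sum_i\mu(\mathrm{dom}(\varphi_i))$ over at most countable families of measure-preserving partial Borel isomorphisms generating $\mathcal R$ up to null sets. $\mathscr C_*(\Gamma)$ (resp. $\mathscr C^*(\Gamma)$) is the infimum (resp. supremum) of the costs of the orbit equivalence relations of essentially free p.m.p. actions of $\Gamma$ on standard probability spaces; $\Gamma$ has fixed price if $\mathscr C_*(\Gamma)=\mathscr C^*(\Gamma)$,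 and fixed price $1$ if this value is $1$. *)

theory Defs
  imports
    "HOL-Algebra.Group_Action"
    "HOL-Algebra.Left_Coset"
    "HOL-Algebra.Generated_Groups"
    "HOL-Probability.Probability_Measure"
begin

section \<open>Groups\<close>

definition finitely_generated :: "('a, 'b) monoid_scheme \<Rightarrow> bool" where
  "finitely_generated G \<longleftrightarrow>
     (\<exists>S. finite S \<and> S \<subseteq> carrier G \<and> generate G S = carrier G)"

text \<open>Only meaningful for finitely generated groups (e.g. finite index subgroups of a
  finitely generated group, by Schreier's lemma); the trivial group has rank \<open>0\<close>.\<close>

definition group_rank :: "('a, 'b) monoid_scheme \<Rightarrow> nat" where
  "group_rank G =
     (LEAST k. \<exists>S. finite S \<and> S \<subseteq> carrier G \<and> generate G S = carrier G \<and> card S = k)"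

definition torsion_free :: "('a, 'b) monoid_scheme \<Rightarrow> bool" where
  "torsion_free G \<longleftrightarrow>
     (\<forall>g\<in>carrier G. \<forall>k::nat. k > 0 \<longrightarrow> g [^]\<^bsub>G\<^esub> k = \<one>\<^bsub>G\<^esub> \<longrightarrow> g = \<one>\<^bsub>G\<^esub>)"

definition finite_index_subgroup :: "'a set \<Rightarrow> ('a, 'b) monoid_scheme \<Rightarrow> bool" where
  "finite_index_subgroup H G \<longleftrightarrow> subgroup H G \<and> finite (lcosets\<^bsub>G\<^esub> H)"

definition group_index :: "('a, 'b) monoid_scheme \<Rightarrow> 'a set \<Rightarrow> nat" where
  "group_index G H = card (lcosets\<^bsub>G\<^esub> H)"

text \<open>The action of \<open>G\<close> on \<open>G/H\<close> by left translation; like every action in the sense of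
  \<^locale>\<open>group_action\<close>, its values are extensional functions on the set acted upon.\<close>

definition coset_action :: "('a, 'b) monoid_scheme \<Rightarrow> 'a set \<Rightarrow> 'a \<Rightarrow> 'a set \<Rightarrow> 'a set" where
  "coset_action G H g = (\<lambda>C \<in> lcosets\<^bsub>G\<^esub> H. g <#\<^bsub>G\<^esub> C)"

definition Farber_sequence :: "('a, 'b) monoid_scheme \<Rightarrow> (nat \<Rightarrow> 'a set) \<Rightarrow> bool" where
  "Farber_sequence G H \<longleftrightarrow>
     (\<forall>n. finite_index_subgroup (H n) G) \<and>
     (\<forall>\<gamma>\<in>carrier G - {\<one>\<^bsub>G\<^esub>}.
        (\<lambda>n. real (card {g <#\<^bsub>G\<^esub> H n |g. g \<in> carrier G \<and> \<gamma> \<in> g <#\<^bsub>G\<^esub> H n #>\<^bsub>G\<^esub> inv\<^bsub>G\<^esub> g})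
             / real (group_index G (H n))) \<longlonglongrightarrow> 0)"


section \<open>Probability measure preserving actions\<close>

definition standard_probability_space :: "'x measure \<Rightarrow> bool" where
  "standard_probability_space M \<longleftrightarrow>
     prob_space M \<and>
     (\<exists>T. completely_metrizable_space T \<and> second_countable T \<and> topspace T = space M \<and>
          sets M = sigma_sets (space M) {U. openin T U})"

definition pmp_action ::
    "('g, 'b) monoid_scheme \<Rightarrow> 'x measure \<Rightarrow> ('g \<Rightarrow> 'x \<Rightarrow> 'x) \<Rightarrow> bool" where
  "pmp_action G M \<phi> \<longleftrightarrow>
     group_action G (space M) \<phi> \<and>
     (\<forall>g\<in>carrier G. \<phi> g \<in> measurable M M \<and> distr M M (\<phi> g) = M)"

definition essentially_free ::
    "('g, 'b) monoid_scheme \<Rightarrow> 'x measure \<Rightarrow> ('g \<Rightarrow> 'x \<Rightarrow> 'x) \<Rightarrow> bool" where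
  "essentially_free G M \<phi> \<longleftrightarrow> (AE x in M. stabilizer G \<phi> x = {\<one>\<^bsub>G\<^esub>})"

definition nonnull_finite_orbits ::
    "('g, 'b) monoid_scheme \<Rightarrow> 'x measure \<Rightarrow> ('g \<Rightarrow> 'x \<Rightarrow> 'x) \<Rightarrow> bool" where
  "nonnull_finite_orbits G M \<phi> \<longleftrightarrow>
     (\<exists>A\<in>sets M. emeasure M A > 0 \<and> (\<forall>g\<in>carrier G. \<phi> g ` A = A) \<and>
                 (\<forall>x\<in>A. finite (orbit G \<phi> x)))"

text \<open>HOL cannot quantify over all types inside a definition, so all standard probability
  spaces are taken with underlying set contained in \<^typ>\<open>real\<close>. As \<^const>\<open>standard_probability_space\<close>
  allows an arbitrary Polish topology on an arbitrary subset, and a standard Borel space has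
  at most continuum many points, every standard probability space has an isomorphic copy of
  this form.\<close>

definition Stuck_Zimmer :: "('g, 'b) monoid_scheme \<Rightarrow> bool" where
  "Stuck_Zimmer G \<longleftrightarrow>
     group G \<and> countable (carrier G) \<and>
     (\<forall>(M :: real measure) \<phi>. standard_probability_space M \<and> pmp_action G M \<phi> \<longrightarrow>
        nonnull_finite_orbits G M \<phi> \<or> (AE x in M. finite (stabilizer G \<phi> x)))"

definition strong_Stuck_Zimmer :: "('g, 'b) monoid_scheme \<Rightarrow> bool" where
  "strong_Stuck_Zimmer G \<longleftrightarrow>
     group G \<and> countable (carrier G) \<and>
     (\<forall>(M :: real measure) \<phi>. standard_probability_space M \<and> pmp_action G M \<phi> \<longrightarrow>
        nonnull_finite_orbits G M \<phi> \<or> (AE x in M. stabilizer G \<phi> x = {\<one>\<^bsub>G\<^esub>}))"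


section \<open>Cost\<close>

definition orbit_relation ::
    "('g, 'b) monoid_scheme \<Rightarrow> 'x measure \<Rightarrow> ('g \<Rightarrow> 'x \<Rightarrow> 'x) \<Rightarrow> ('x \<times> 'x) set" where
  "orbit_relation G M \<phi> = {(x, y). x \<in> space M \<and> y \<in> orbit G \<phi> x}"

definition mp_partial_iso :: "'x measure \<Rightarrow> 'x set \<Rightarrow> ('x \<Rightarrow> 'x) \<Rightarrow> bool" where
  "mp_partial_iso M A f \<longleftrightarrow>
     A \<in> sets M \<and> f ` A \<in> sets M \<and> inj_on f A \<and>
     f \<in> measurable (restrict_space M A) (restrict_space M (f ` A)) \<and>
     inv_into A f \<in> measurable (restrict_space M (f ` A)) (restrict_space M A) \<and>
     distr (restrict_space M A) (restrict_space M (f ` A)) f = restrict_space M (f ` A)"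

text \<open>A family of partial maps \<open>f i\<close> with domains \<open>A i\<close>. Empty domains are allowed, so
  families indexed by \<^typ>\<open>nat\<close> also account for the finite ones.\<close>

definition generated_relation :: "(nat \<Rightarrow> 'x set) \<Rightarrow> (nat \<Rightarrow> 'x \<Rightarrow> 'x) \<Rightarrow> ('x \<times> 'x) set" where
  "generated_relation A f =
     (let E = {(x, f i x) |i x. x \<in> A i} in (E \<union> E\<inverse>)\<^sup>*)"

definition generates_mod_null ::
    "'x measure \<Rightarrow> ('x \<times> 'x) set \<Rightarrow> (nat \<Rightarrow> 'x set) \<Rightarrow> (nat \<Rightarrow> 'x \<Rightarrow> 'x) \<Rightarrow> bool" where
  "generates_mod_null M R A f \<longleftrightarrow>
     (\<forall>i. mp_partial_iso M (A i) (f i)) \<and>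
     (AE x in M. generated_relation A f `` {x} = R `` {x})"

definition cost :: "'x measure \<Rightarrow> ('x \<times> 'x) set \<Rightarrow> ennreal" where
  "cost M R = Inf {(\<Sum>i. emeasure M (A i)) |A f. generates_mod_null M R A f}"

definition free_action_costs :: "('g, 'b) monoid_scheme \<Rightarrow> ennreal set" where
  "free_action_costs G =
     {cost M (orbit_relation G M \<phi>) |(M :: real measure) \<phi>.
        standard_probability_space M \<and> pmp_action G M \<phi> \<and> essentially_free G M \<phi>}"

definition inf_cost :: "('g, 'b) monoid_scheme \<Rightarrow> ennreal" where
  "inf_cost G = Inf (free_action_costs G)"

definition sup_cost :: "('g, 'b) monoid_scheme \<Rightarrow> ennreal" where
  "sup_cost G = Sup (free_action_costs G)"

definition fixed_price :: "('g, 'b) monoid_scheme \<Rightarrow> bool" where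
  "fixed_price G \<longleftrightarrow> inf_cost G = sup_cost G"


section \<open>Ultraproducts and Loeb spaces\<close>

definition nonprincipal_ultrafilter :: "nat filter \<Rightarrow> bool" where
  "nonprincipal_ultrafilter \<UU> \<longleftrightarrow>
     \<UU> \<noteq> bot \<and>
     (\<forall>P. eventually P \<UU> \<or> eventually (\<lambda>n. \<not> P n) \<UU>) \<and>
     (\<forall>k. \<not> eventually (\<lambda>n. n = k) \<UU>)"

definition ultraclass :: "nat filter \<Rightarrow> (nat \<Rightarrow> 'y set) \<Rightarrow> (nat \<Rightarrow> 'y) \<Rightarrow> (nat \<Rightarrow> 'y) set" where
  "ultraclass \<UU> Y y = {z \<in> Pi UNIV Y. eventually (\<lambda>n. z n = y n) \<UU>}"

definition ultraproduct :: "nat filter \<Rightarrow> (nat \<Rightarrow> 'y set) \<Rightarrow> (nat \<Rightarrow> 'y) set set" where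
  "ultraproduct \<UU> Y = ultraclass \<UU> Y ` Pi UNIV Y"

definition internal_set ::
    "nat filter \<Rightarrow> (nat \<Rightarrow> 'y set) \<Rightarrow> (nat \<Rightarrow> 'y set) \<Rightarrow> (nat \<Rightarrow> 'y) set set" where
  "internal_set \<UU> Y A =
     ultraclass \<UU> Y ` {y \<in> Pi UNIV Y. eventually (\<lambda>n. y n \<in> A n) \<UU>}"

text \<open>The Loeb measure of the uniform probability measures on the finite sets \<open>Y n\<close>: the
  extension, to the \<open>\<sigma>\<close>-algebra generated by the internal sets, of the ultralimit of the
  uniform measures. That this extension exists is shown in \<open>emeasure_Loeb\<close> below.\<close>

definition Loeb :: "nat filter \<Rightarrow> (nat \<Rightarrow> 'y set) \<Rightarrow> (nat \<Rightarrow> 'y) set measure" where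
  "Loeb \<UU> Y =
     extend_measure (ultraproduct \<UU> Y) {A. \<forall>n. A n \<subseteq> Y n} (internal_set \<UU> Y)
       (\<lambda>A. ennreal (Lim \<UU> (\<lambda>n. real (card (A n)) / real (card (Y n)))))"

text \<open>The ultraproduct action, \<open>g[y\<^sub>n] = [g y\<^sub>n]\<close>; the union runs over all
  representatives of a class and all of them yield the same set.\<close>

definition ultraproduct_action ::
    "nat filter \<Rightarrow> (nat \<Rightarrow> 'y set) \<Rightarrow> (nat \<Rightarrow> 'g \<Rightarrow> 'y \<Rightarrow> 'y) \<Rightarrow> 'g \<Rightarrow> (nat \<Rightarrow> 'y) set \<Rightarrow> (nat \<Rightarrow> 'y) set" where
  "ultraproduct_action \<UU> Y \<phi> g C = (\<Union>y\<in>C. ultraclass \<UU> Y (\<lambda>n. \<phi> n g (y n)))"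

definition sofic_approximation ::
    "('g, 'b) monoid_scheme \<Rightarrow> (nat \<Rightarrow> 'y set) \<Rightarrow> (nat \<Rightarrow> 'g \<Rightarrow> 'y \<Rightarrow> 'y) \<Rightarrow> bool" where
  "sofic_approximation G Y \<phi> \<longleftrightarrow>
     (\<forall>n. finite (Y n) \<and> Y n \<noteq> {} \<and> group_action G (Y n) (\<phi> n)) \<and>
     (\<forall>\<UU>. nonprincipal_ultrafilter \<UU> \<longrightarrow>
        essentially_free G (Loeb \<UU> Y) (ultraproduct_action \<UU> Y \<phi>))"


subsection \<open>Existence of the Loeb measure\<close>

context
  fixes \<UU> :: "nat filter" and Y :: "nat \<Rightarrow> 'y set"
  assumes U: "nonprincipal_ultrafilter \<UU>"
    and Y: "\<And>n. finite (Y n)" "\<And>n. Y n \<noteq> {}"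
begin

lemma ultrafilter_cases: "eventually P \<UU> \<or> eventually (\<lambda>n. \<not> P n) \<UU>"
  using U by (simp add: nonprincipal_ultrafilter_def)

lemma ultrafilter_not: "eventually (\<lambda>n. \<not> P n) \<UU> \<longleftrightarrow> \<not> eventually P \<UU>"
proof
  assume "eventually (\<lambda>n. \<not> P n) \<UU>"
  show "\<not> eventually P \<UU>"
  proof
    assume "eventually P \<UU>"
    with \<open>eventually (\<lambda>n. \<not> P n) \<UU>\<close> have "eventually (\<lambda>n. False) \<UU>"
      by eventually_elim simp
    then show False using U by (simp add: nonprincipal_ultrafilter_def)
  qed
qed (use ultrafilter_cases[of P] in blast)

lemma ultrafilter_ge: "eventually (\<lambda>n. n \<ge> k) \<UU>"
proof (induction k)
  case (Suc k)
  have "eventually (\<lambda>n. n \<noteq> k) \<UU>"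
    using U ultrafilter_cases[of "\<lambda>n. n = k"] by (simp add: nonprincipal_ultrafilter_def)
  with Suc show ?case by eventually_elim simp
qed simp

lemma ultralimit_exists:
  fixes f :: "nat \<Rightarrow> real"
  assumes "\<And>n. f n \<in> {0..1}"
  shows "(f \<longlongrightarrow> Lim \<UU> f) \<UU>" "Lim \<UU> f \<ge> 0"
proof -
  have nb: "\<UU> \<noteq> bot" using U by (simp add: nonprincipal_ultrafilter_def)
  have "filtermap f \<UU> \<noteq> bot" using nb by (simp add: filtermap_bot_iff)
  moreover have "eventually (\<lambda>x. x \<in> {0..1}) (filtermap f \<UU>)"
    using assms by (simp add: eventually_filtermap)
  ultimately obtain l where l: "l \<in> {0..1}" "inf (nhds l) (filtermap f \<UU>) \<noteq> bot"
    using compact_Icc[of "0::real" 1] unfolding compact_filter by blast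
  have "(f \<longlongrightarrow> l) \<UU>"
  proof (rule topological_tendstoI)
    fix S assume S: "open S" "l \<in> S"
    show "eventually (\<lambda>n. f n \<in> S) \<UU>"
    proof (rule ccontr)
      assume "\<not> eventually (\<lambda>n. f n \<in> S) \<UU>"
      then have "eventually (\<lambda>x. x \<notin> S) (filtermap f \<UU>)"
        using ultrafilter_cases[of "\<lambda>n. f n \<in> S"] by (simp add: eventually_filtermap)
      moreover have "eventually (\<lambda>x. x \<in> S) (nhds l)" using S by (rule eventually_nhds_in_open)
      ultimately have "eventually (\<lambda>x. False) (inf (nhds l) (filtermap f \<UU>))"
        unfolding eventually_inf by blast
      with l show False by (simp add: eventually_False)
    qed
  qed
  moreover from this have "Lim \<UU> f = l" using nb by (intro tendsto_Lim)
  ultimately show "(f \<longlongrightarrow> Lim \<UU> f) \<UU>" "Lim \<UU> f \<ge> 0" using l by auto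
qed

lemma ultraclass_eq_iff:
  assumes "y \<in> Pi UNIV Y" "z \<in> Pi UNIV Y"
  shows "ultraclass \<UU> Y y = ultraclass \<UU> Y z \<longleftrightarrow> eventually (\<lambda>n. y n = z n) \<UU>"
proof
  assume "ultraclass \<UU> Y y = ultraclass \<UU> Y z"
  moreover have "y \<in> ultraclass \<UU> Y y" using assms by (simp add: ultraclass_def)
  ultimately show "eventually (\<lambda>n. y n = z n) \<UU>" by (auto simp: ultraclass_def)
next
  assume ev: "eventually (\<lambda>n. y n = z n) \<UU>"
  have "eventually (\<lambda>n. w n = y n) \<UU> \<longleftrightarrow> eventually (\<lambda>n. w n = z n) \<UU>" for w
    by (rule eventually_cong[OF ev]) auto
  then show "ultraclass \<UU> Y y = ultraclass \<UU> Y z"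
    by (auto simp: ultraclass_def)
qed

lemma ultraclass_mem_internal_set:
  assumes "y \<in> Pi UNIV Y"
  shows "ultraclass \<UU> Y y \<in> internal_set \<UU> Y A \<longleftrightarrow> eventually (\<lambda>n. y n \<in> A n) \<UU>"
proof
  assume "ultraclass \<UU> Y y \<in> internal_set \<UU> Y A"
  then obtain z where z: "z \<in> Pi UNIV Y" "eventually (\<lambda>n. z n \<in> A n) \<UU>"
    "ultraclass \<UU> Y y = ultraclass \<UU> Y z" by (auto simp: internal_set_def)
  with assms have "eventually (\<lambda>n. y n = z n) \<UU>" by (simp add: ultraclass_eq_iff)
  with z(2) show "eventually (\<lambda>n. y n \<in> A n) \<UU>" by eventually_elim simp
qed (use assms in \<open>auto simp: internal_set_def\<close>)

lemma internal_set_subset: "internal_set \<UU> Y A \<subseteq> ultraproduct \<UU> Y"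
  by (auto simp: internal_set_def ultraproduct_def)

lemma internal_set_eqI:
  assumes "S \<subseteq> ultraproduct \<UU> Y"
    and "\<And>y. y \<in> Pi UNIV Y \<Longrightarrow>
           ultraclass \<UU> Y y \<in> S \<longleftrightarrow> eventually (\<lambda>n. y n \<in> A n) \<UU>"
  shows "internal_set \<UU> Y A = S"
proof (rule Set.set_eqI)
  fix C
  show "C \<in> internal_set \<UU> Y A \<longleftrightarrow> C \<in> S"
  proof (cases "C \<in> ultraproduct \<UU> Y")
    case True
    then obtain y where "y \<in> Pi UNIV Y" "C = ultraclass \<UU> Y y"
      unfolding ultraproduct_def by blast
    then show ?thesis by (simp add: assms(2) ultraclass_mem_internal_set)
  qed (use assms(1) internal_set_subset[of A] in blast)
qed

lemma internal_set_Diff: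
  "internal_set \<UU> Y (\<lambda>n. A n - B n) = internal_set \<UU> Y A - internal_set \<UU> Y B"
proof (rule internal_set_eqI)
  fix y assume "y \<in> Pi UNIV Y"
  then show "ultraclass \<UU> Y y \<in> internal_set \<UU> Y A - internal_set \<UU> Y B \<longleftrightarrow>
      eventually (\<lambda>n. y n \<in> A n - B n) \<UU>"
    using ultrafilter_not[of "\<lambda>n. y n \<in> B n"]
    by (simp add: ultraclass_mem_internal_set eventually_conj_iff)
qed (use internal_set_subset in blast)

lemma internal_set_Int:
  "internal_set \<UU> Y (\<lambda>n. A n \<inter> B n) = internal_set \<UU> Y A \<inter> internal_set \<UU> Y B"
proof (rule internal_set_eqI)
  fix y assume "y \<in> Pi UNIV Y"
  then show "ultraclass \<UU> Y y \<in> internal_set \<UU> Y A \<inter> internal_set \<UU> Y B \<longleftrightarrow>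
      eventually (\<lambda>n. y n \<in> A n \<inter> B n) \<UU>"
    by (simp add: ultraclass_mem_internal_set eventually_conj_iff)
qed (use internal_set_subset in blast)

lemma internal_set_Un:
  "internal_set \<UU> Y (\<lambda>n. A n \<union> B n) = internal_set \<UU> Y A \<union> internal_set \<UU> Y B"
proof (rule internal_set_eqI)
  fix y assume "y \<in> Pi UNIV Y"
  then show "ultraclass \<UU> Y y \<in> internal_set \<UU> Y A \<union> internal_set \<UU> Y B \<longleftrightarrow>
      eventually (\<lambda>n. y n \<in> A n \<union> B n) \<UU>"
    using ultrafilter_not[of "\<lambda>n. y n \<in> A n \<union> B n"] ultrafilter_not[of "\<lambda>n. y n \<in> A n"]
      ultrafilter_not[of "\<lambda>n. y n \<in> B n"]
    by (simp add: ultraclass_mem_internal_set eventually_conj_iff) blast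
qed (use internal_set_subset in blast)

lemma internal_set_UNIV: "internal_set \<UU> Y Y = ultraproduct \<UU> Y"
proof (rule internal_set_eqI)
  fix y assume y: "y \<in> Pi UNIV Y"
  then have "y n \<in> Y n" for n by auto
  with y show "ultraclass \<UU> Y y \<in> ultraproduct \<UU> Y \<longleftrightarrow> eventually (\<lambda>n. y n \<in> Y n) \<UU>"
    by (simp add: ultraproduct_def)
qed simp

lemma internal_set_empty_iff:
  assumes "\<And>n. A n \<subseteq> Y n"
  shows "internal_set \<UU> Y A = {} \<longleftrightarrow> eventually (\<lambda>n. A n = {}) \<UU>"
proof
  assume "internal_set \<UU> Y A = {}"
  define y where "y n = (SOME a. a \<in> (if A n = {} then Y n else A n))" for n
  have y: "y n \<in> (if A n = {} then Y n else A n)" for n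
  proof -
    have "\<exists>a. a \<in> (if A n = {} then Y n else A n)" using Y(2)[of n] by auto
    then show ?thesis unfolding y_def by (rule someI_ex)
  qed
  have "y n \<in> Y n" for n
    using assms[of n] y[of n] by (cases "A n = {}") auto
  then have "y \<in> Pi UNIV Y" by simp
  with \<open>internal_set \<UU> Y A = {}\<close> have "\<not> eventually (\<lambda>n. y n \<in> A n) \<UU>"
    by (auto simp: internal_set_def)
  then have "eventually (\<lambda>n. y n \<notin> A n) \<UU>" by (simp add: ultrafilter_not)
  then show "eventually (\<lambda>n. A n = {}) \<UU>"
  proof eventually_elim
    case (elim n)
    then show ?case using y[of n] by (cases "A n = {}") auto
  qed
next
  assume "eventually (\<lambda>n. A n = {}) \<UU>"
  then have "eventually (\<lambda>n. y n \<notin> A n) \<UU>" for y by eventually_elim simp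
  then show "internal_set \<UU> Y A = {}" by (auto simp: internal_set_def ultrafilter_not)
qed

lemma internal_set_saturation:
  fixes A :: "nat \<Rightarrow> nat \<Rightarrow> 'y set"
  assumes "\<And>i n. A i n \<subseteq> Y n" "(\<Inter>i. internal_set \<UU> Y (A i)) = {}"
  obtains k where "(\<Inter>i\<le>k. internal_set \<UU> Y (A i)) = {}"
proof (rule ccontr)
  assume "\<not> thesis"
  have ne: "(\<Inter>i\<le>k. internal_set \<UU> Y (A i)) \<noteq> {}" for k
    using that[of k] \<open>\<not> thesis\<close> by (rule contrapos_nn[rotated])
  define B where "B k n = (\<Inter>i\<le>k. A i n)" for k n
  have B: "eventually (\<lambda>n. B k n \<noteq> {}) \<UU>" for k
  proof -
    have "internal_set \<UU> Y (B k) = (\<Inter>i\<le>k. internal_set \<UU> Y (A i))"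
    proof (rule internal_set_eqI)
      show "(\<Inter>i\<le>k. internal_set \<UU> Y (A i)) \<subseteq> ultraproduct \<UU> Y"
        using internal_set_subset[of "A 0"] by fastforce
      fix y assume "y \<in> Pi UNIV Y"
      then show "ultraclass \<UU> Y y \<in> (\<Inter>i\<le>k. internal_set \<UU> Y (A i)) \<longleftrightarrow>
          eventually (\<lambda>n. y n \<in> B k n) \<UU>"
        by (simp add: ultraclass_mem_internal_set B_def eventually_ball_finite_distrib)
    qed
    moreover have "B k n \<subseteq> Y n" for n using assms(1) by (auto simp: B_def)
    ultimately show ?thesis
      using ne[of k] internal_set_empty_iff[of "B k"] ultrafilter_not by simp
  qed
  define P where "P n k \<longleftrightarrow> k \<le> n \<and> B k n \<noteq> {}" for n k
  have "\<exists>a\<in>Y n. \<forall>i. P n i \<longrightarrow> a \<in> A i n" for n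
  proof (cases "\<exists>k. P n k")
    case True
    define m where "m = (GREATEST k. P n k)"
    have m: "P n m" unfolding m_def using True by (metis GreatestI_nat P_def)
    have le: "i \<le> m" if "P n i" for i
      unfolding m_def using that by (rule Greatest_le_nat[where b = n]) (simp add: P_def)
    from m obtain a where "a \<in> B m n" by (auto simp: P_def)
    then have a: "a \<in> A i n" if "i \<le> m" for i using that by (auto simp: B_def)
    then have "a \<in> Y n" using assms(1) by blast
    with a le show ?thesis by blast
  qed (use Y(2)[of n] in auto)
  then obtain y where y: "\<And>n. y n \<in> Y n" "\<And>n i. P n i \<Longrightarrow> y n \<in> A i n" by metis
  have "eventually (\<lambda>n. y n \<in> A i n) \<UU>" for i
    using B[of i] ultrafilter_ge[of i] by eventually_elim (simp add: y(2) P_def)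
  then have "ultraclass \<UU> Y y \<in> (\<Inter>i. internal_set \<UU> Y (A i))"
    using y(1) by (auto simp: ultraclass_mem_internal_set)
  with assms(2) show False by blast
qed

lemma emeasure_Loeb:
  assumes "\<And>n. A n \<subseteq> Y n"
  shows "emeasure (Loeb \<UU> Y) (internal_set \<UU> Y A) =
           ennreal (Lim \<UU> (\<lambda>n. real (card (A n)) / real (card (Y n))))"
proof -
  define I where "I = {A. \<forall>n. A n \<subseteq> Y n}"
  define m where "m A = Lim \<UU> (\<lambda>n. real (card (A n)) / real (card (Y n)))" for A :: "nat \<Rightarrow> 'y set"
  define \<Omega> where "\<Omega> = ultraproduct \<UU> Y"
  let ?G = "internal_set \<UU> Y"
  define sel where "sel S = (SOME A. A \<in> I \<and> ?G A = S)" for S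
  define f where "f S = ennreal (m (sel S))" for S
  have nb: "\<UU> \<noteq> bot" using U by (simp add: nonprincipal_ultrafilter_def)
  have lim: "((\<lambda>n. real (card (A n)) / real (card (Y n))) \<longlongrightarrow> m A) \<UU>" and m0: "m A \<ge> 0" if "A \<in> I" for A
  proof -
    have "real (card (A n)) / real (card (Y n)) \<in> {0..1}" for n
      using card_mono[OF Y(1), of "A n" n] that by (auto simp: I_def divide_le_eq_1)
    from ultralimit_exists[OF this]
    show "((\<lambda>n. real (card (A n)) / real (card (Y n))) \<longlongrightarrow> m A) \<UU>" "m A \<ge> 0"
      by (simp_all add: m_def)
  qed
  have add: "m C = m A + m B"
    if "A \<in> I" "B \<in> I" "C \<in> I" "?G A \<inter> ?G B = {}" "?G C = ?G A \<union> ?G B" for A B C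
  proof -
    have 1: "eventually (\<lambda>n. A n \<inter> B n = {}) \<UU>"
      using that internal_set_Int[of A B] internal_set_empty_iff[of "\<lambda>n. A n \<inter> B n"]
      by (auto simp: I_def)
    have "?G (\<lambda>n. C n - (A n \<union> B n)) = {}" "?G (\<lambda>n. (A n \<union> B n) - C n) = {}"
      using that(5) by (simp_all only: internal_set_Diff internal_set_Un Diff_cancel)
    then have 2: "eventually (\<lambda>n. C n - (A n \<union> B n) = {}) \<UU>"
      "eventually (\<lambda>n. (A n \<union> B n) - C n = {}) \<UU>"
      using that(1-3) internal_set_empty_iff[of "\<lambda>n. C n - (A n \<union> B n)"]
        internal_set_empty_iff[of "\<lambda>n. (A n \<union> B n) - C n"]
      by (simp_all add: I_def Diff_subset_conv le_supI1 le_supI2)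
    have "eventually (\<lambda>n. real (card (A n)) / real (card (Y n)) + real (card (B n)) / real (card (Y n))
        = real (card (C n)) / real (card (Y n))) \<UU>"
      using 1 2
    proof eventually_elim
      case (elim n)
      then have "C n = A n \<union> B n" by blast
      moreover have "finite (A n)" "finite (B n)"
        using that finite_subset[OF _ Y(1)[of n]] by (simp_all add: I_def)
      ultimately show ?case
        using elim by (simp add: card_Un_disjoint add_divide_distrib)
    qed
    with tendsto_add[OF lim[OF that(1)] lim[OF that(2)]]
    have "((\<lambda>n. real (card (C n)) / real (card (Y n))) \<longlongrightarrow> m A + m B) \<UU>"
      by (rule Lim_transform_eventually)
    with lim[OF that(3)] nb show ?thesis by (meson tendsto_unique)
  qed
  have empty_I: "(\<lambda>_. {}) \<in> I" by (simp add: I_def)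
  have empty_G: "?G (\<lambda>_. {}) = {}" using nb by (simp add: internal_set_def)
  have m_empty: "m (\<lambda>_. {}) = 0"
    unfolding m_def by (rule tendsto_Lim[OF nb]) simp
  have m_cong: "m A = m B" if "A \<in> I" "B \<in> I" "?G A = ?G B" for A B
    using add[of B "\<lambda>_. {}" A] that empty_I empty_G m_empty by simp
  have sel: "sel S \<in> I" "?G (sel S) = S" if "S \<in> ?G ` I" for S
  proof -
    have "\<exists>A. A \<in> I \<and> ?G A = S" using that by blast
    from someI_ex[OF this] show "sel S \<in> I" "?G (sel S) = S" by (simp_all add: sel_def)
  qed
  have f_eq: "f (?G A) = ennreal (m A)" if "A \<in> I" for A
    unfolding f_def using sel[of "?G A"] that m_cong[of "sel (?G A)" A] by auto
  have f_empty: "f {} = 0" using f_eq[OF empty_I] empty_G m_empty by simp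
  have sub: "?G ` I \<subseteq> Pow \<Omega>" using internal_set_subset by (auto simp: \<Omega>_def)
  interpret ring_of_sets \<Omega> "?G ` I"
    unfolding ring_of_sets_iff
  proof (intro conjI ballI sub)
    show "{} \<in> ?G ` I" using empty_I empty_G by (metis imageI)
    fix S T assume "S \<in> ?G ` I" "T \<in> ?G ` I"
    then obtain A B where AB: "A \<in> I" "B \<in> I" "S = ?G A" "T = ?G B" by blast
    have "S \<union> T = ?G (\<lambda>n. A n \<union> B n)" "S - T = ?G (\<lambda>n. A n - B n)"
      using AB by (simp_all add: internal_set_Un internal_set_Diff)
    moreover have "(\<lambda>n. A n \<union> B n) \<in> I" "(\<lambda>n. A n - B n) \<in> I"
      using AB by (auto simp: I_def)
    ultimately show "S \<union> T \<in> ?G ` I" "S - T \<in> ?G ` I" by blast+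
  qed
  have "\<exists>\<mu>. (\<forall>s\<in>?G ` I. \<mu> s = f s) \<and> measure_space \<Omega> (sigma_sets \<Omega> (?G ` I)) \<mu>"
  proof (rule caratheodory_empty_continuous)
    show "positive (?G ` I) f" by (simp add: positive_def f_empty)
    show "additive (?G ` I) f"
      unfolding additive_def
    proof (intro ballI impI)
      fix S T assume ST: "S \<in> ?G ` I" "T \<in> ?G ` I" "S \<inter> T = {}"
      then have "m (sel (S \<union> T)) = m (sel S) + m (sel T)"
        by (intro add) (simp_all add: sel Un)
      then show "f (S \<union> T) = f S + f T"
        using ST m0 sel by (simp add: f_def ennreal_plus)
    qed
    show "f S \<noteq> \<infinity>" for S by (simp add: f_def)
    fix S :: "nat \<Rightarrow> _" assume S: "range S \<subseteq> ?G ` I" "decseq S" "(\<Inter>i. S i) = {}"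
    have Ssel: "?G (sel (S i)) = S i" "sel (S i) n \<subseteq> Y n" for i n
      using sel[of "S i"] subsetD[OF S(1) rangeI] by (simp_all add: I_def)
    obtain k where "(\<Inter>i\<le>k. ?G (sel (S i))) = {}"
      using internal_set_saturation[of "\<lambda>i. sel (S i)"] Ssel S(3) by auto
    moreover have "S k \<subseteq> S i" if "i \<le> k" for i using S(2) that by (simp add: decseq_def)
    ultimately have "S k = {}" by (auto simp: Ssel)
    then have "S i = {}" if "i \<ge> k" for i using S(2) that by (auto simp: decseq_def)
    then have "eventually (\<lambda>i. f (S i) = 0) sequentially"
      unfolding eventually_sequentially using f_empty by metis
    then show "(\<lambda>i. f (S i)) \<longlonglongrightarrow> 0" by (rule tendsto_eventually)
  qed
  then obtain \<mu> where \<mu>: "\<And>s. s \<in> ?G ` I \<Longrightarrow> \<mu> s = f s"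
    "measure_space \<Omega> (sigma_sets \<Omega> (?G ` I)) \<mu>" by blast
  have L: "Loeb \<UU> Y = extend_measure \<Omega> I ?G (\<lambda>A. ennreal (m A))"
    by (simp add: Loeb_def \<Omega>_def I_def m_def)
  have "emeasure (Loeb \<UU> Y) (?G A) = ennreal (m A)"
  proof (rule emeasure_extend_measure[OF L])
    show "\<mu> (?G B) = ennreal (m B)" if "B \<in> I" for B using \<mu>(1) f_eq that by simp
    show "positive (sets (Loeb \<UU> Y)) \<mu>" "countably_additive (sets (Loeb \<UU> Y)) \<mu>"
      using \<mu>(2) by (simp_all add: L sets_extend_measure[OF sub] measure_space_def)
  qed (use sub assms in \<open>auto simp: I_def\<close>)
  then show ?thesis by (simp add: m_def)
qed

lemma prob_space_Loeb: "prob_space (Loeb \<UU> Y)"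
proof
  have "Lim \<UU> (\<lambda>n. real (card (Y n)) / real (card (Y n))) = 1"
    using Y U by (intro tendsto_Lim) (auto simp: nonprincipal_ultrafilter_def)
  moreover have "space (Loeb \<UU> Y) = internal_set \<UU> Y Y"
    unfolding Loeb_def internal_set_UNIV
    by (rule space_extend_measure) (use internal_set_subset in blast)
  ultimately show "emeasure (Loeb \<UU> Y) (space (Loeb \<UU> Y)) = 1"
    using emeasure_Loeb[of Y] by simp
qed

end

end

theory Submission
  imports Defs
begin

text \<open>Fix a nonprincipal ultrafilter, and colour the finite sets \<open>Y\<^sub>n = \<Gamma>/\<Gamma>\<^sub>n\<close> in such a way that, for
  every \<open>\<gamma>\<close>, a point moved by \<open>\<gamma>\<close> and its image have different \<open>\<gamma>\<close>-colours. Recording the colours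
  seen along the orbit of a point maps the ultraproduct of the \<open>Y\<^sub>n\<close> equivariantly to a Cantor
  space, and the image of the Loeb measure gives a p.m.p. action on a standard space whose
  stabilizers and orbits are visible in cylinder sets. Since the \<open>Y\<^sub>n\<close> are transitive and
  \<open>|Y\<^sub>n| \<rightarrow> \<infinity>\<close>, its orbits are infinite; so its stabilizers are finite, and elements of infinite
  order have asymptotically no fixed points in \<open>Y\<^sub>n\<close>.

  By means of a spanning tree, a generating set of the action groupoid of \<open>\<Gamma>\<close> on \<open>\<Gamma>/\<Gamma>\<^sub>n\<close> with \<open>e\<close> arrows
  is as good as a generating set of \<open>\<Gamma>\<^sub>n\<close> with \<open>e - [\<Gamma> : \<Gamma>\<^sub>n] + 1\<close> elements. Such arrows lift to a
  graphing of every free action that has \<open>\<Gamma>/\<Gamma>\<^sub>n\<close> as a factor, which bounds the infimal cost from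
  above by the rank. Conversely, a graphing of the limit action whose cost is close to the infimum
  can be cut down to finitely many group elements, approximated by cylinder sets and copied to
  \<open>Y\<^sub>n\<close>, which bounds the ranks by the supremal cost. If \<open>\<Gamma>\<close> has torsion, this last argument is
  applied to the sets \<open>\<Gamma>/\<Gamma>\<^sub>n \<times> \<Gamma>/\<Lambda>\<close> with \<open>\<Lambda>\<close> torsion free of finite index.\<close>

section \<open>Preliminaries\<close>

text \<open>The obstacle is that \<open>Stuck_Zimmer\<close> and the costs speak about standard
  probability spaces, whereas the ultraproduct with its Loeb measure is in general not standard;
  hence the passage to a countably generated factor. A factor may have larger stabilizers and
  smaller orbits than the ultraproduct, and this is what the separating colours rule out.

  The two bounds on the rank differ in nature. The lower one holds for each single \<open>n\<close>,
  since for an infimum one free action with the factor \<open>\<Gamma>/\<Gamma>\<^sub>n\<close>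
  suffices. The upper one is asymptotic, and as nothing but freeness is known about the limit
  action, it involves the supremum; fixed price makes the two meet. Freeness enters through the
  uniqueness of the group element that carries one point to another: a graphing can be cut into
  pieces indexed by \<Gamma> without raising its cost.

  With torsion, the detour through \<open>\<Gamma>\<^sub>n \<inter> \<Lambda>\<close> multiplies the
  bound: the upper limit of (rank - 1) / index is at most (c - 1) [\<Gamma> : \<Lambda>] for price
  c. This is conclusive for c = 1.\<close>

lemma nonprincipal_ultrafilter_containing:
  assumes "infinite (S :: nat set)"
  obtains \<UU> where "nonprincipal_ultrafilter \<UU>" "eventually (\<lambda>n. n \<in> S) \<UU>"
proof -
  define \<A> :: "nat set set set" where
    "\<A> = {F. S \<in> F \<and> (\<forall>A\<in>F. infinite A) \<and> (\<forall>A\<in>F. \<forall>B\<in>F. A \<inter> B \<in> F) \<and>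
              (\<forall>A\<in>F. \<forall>B. A \<subseteq> B \<longrightarrow> B \<in> F) \<and> (\<forall>A\<in>F. \<forall>k. A - {k} \<in> F)}"
  \<comment> \<open>Zorn's lemma starts from the Frechet filter of \<open>S\<close>. That all
    members of a family in \<open>\<A>\<close> are infinite will make the result both proper and
    nonprincipal.\<close>
  have nonempty: "{B. finite (S - B)} \<in> \<A>"
  proof -
    have i1: "infinite B" if "finite (S - B)" for B
      using assms that by (metis Diff_infinite_finite finite_Diff2)
    have i2: "finite (S - (A \<inter> B))" if "finite (S - A)" "finite (S - B)" for A B
      using that by (simp add: Diff_Int)
    have i3: "finite (S - (A - {k}))" if "finite (S - A)" for A k
      by (rule finite_subset[of _ "insert k (S - A)"]) (use that in auto)
    have i4: "finite (S - B)" if "finite (S - A)" "A \<subseteq> B" for A B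
      by (rule finite_subset[OF _ that(1)]) (use that(2) in blast)
    show ?thesis
      unfolding \<A>_def mem_Collect_eq
    proof (intro conjI ballI allI impI, goal_cases)
      case 1
      show ?case by (simp only: Diff_cancel finite.emptyI)
    next
      case (2 A)
      then show ?case unfolding mem_Collect_eq by (rule i1)
    next
      case (3 A B)
      then show ?case unfolding mem_Collect_eq by (rule i2)
    next
      case (4 A B)
      then show ?case unfolding mem_Collect_eq by (rule i4)
    next
      case (5 A k)
      then show ?case unfolding mem_Collect_eq by (rule i3)
    qed
  qed
  have chain: "\<Union>\<C> \<in> \<A>" if "\<C> \<noteq> {}" "subset.chain \<A> \<C>" for \<C>
  proof -
    from that(2) have sub: "\<C> \<subseteq> \<A>" and ch: "\<And>X Y. X \<in> \<C> \<Longrightarrow> Y \<in> \<C> \<Longrightarrow> X \<subseteq> Y \<or> Y \<subseteq> X"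
      by (auto simp: subset_chain_def)
    have i1: "A \<inter> B \<in> \<Union>\<C>" if "A \<in> \<Union>\<C>" "B \<in> \<Union>\<C>" for A B
    proof -
      from that obtain X Y where XY: "A \<in> X" "X \<in> \<C>" "B \<in> Y" "Y \<in> \<C>" by blast
      then show ?thesis using ch[of X Y] sub unfolding \<A>_def by blast
    qed
    have i2: "S \<in> \<Union>\<C>" using that(1) sub unfolding \<A>_def by blast
    have i3: "infinite A" "A - {k} \<in> \<Union>\<C>" "A \<subseteq> B \<Longrightarrow> B \<in> \<Union>\<C>"
      if "A \<in> \<Union>\<C>" for A B k
      using that sub unfolding \<A>_def by blast+
    show ?thesis
      unfolding \<A>_def mem_Collect_eq
    proof (intro conjI ballI allI impI, goal_cases)
      case 1
      show ?case by (rule i2)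
    next
      case (2 A)
      then show ?case by (rule i3(1))
    next
      case (3 A B)
      then show ?case by (rule i1)
    next
      case (4 A B)
      then show ?case by (rule i3(3))
    next
      case (5 A k)
      then show ?case by (rule i3(2))
    qed
  qed
  have "\<exists>F\<in>\<A>. \<forall>X\<in>\<A>. F \<subseteq> X \<longrightarrow> X = F"
    by (rule subset_Zorn_nonempty) (use nonempty chain in blast)+
  then obtain F where F: "F \<in> \<A>" and max: "\<And>X. X \<in> \<A> \<Longrightarrow> F \<subseteq> X \<Longrightarrow> X = F"
    by blast
  have F1: "S \<in> F" "\<And>A. A \<in> F \<Longrightarrow> infinite A" "\<And>A B. A \<in> F \<Longrightarrow> B \<in> F \<Longrightarrow> A \<inter> B \<in> F"
    "\<And>A B. A \<in> F \<Longrightarrow> A \<subseteq> B \<Longrightarrow> B \<in> F" "\<And>A k. A \<in> F \<Longrightarrow> A - {k} \<in> F"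
    using F unfolding \<A>_def by blast+
  \<comment> \<open>Maximality: a set that meets every member in an infinite set can be adjoined, so
    it already belongs to \<open>F\<close>. This is applied below to a set and to its
    complement.\<close>
  have add: "X \<in> F" if X: "\<And>A. A \<in> F \<Longrightarrow> infinite (A \<inter> X)" for X
  proof -
    let ?F = "{B. \<exists>A\<in>F. A \<inter> X \<subseteq> B}"
    have "?F \<in> \<A>"
      unfolding \<A>_def
    proof (intro CollectI conjI ballI allI impI)
      show "\<exists>A\<in>F. A \<inter> X \<subseteq> S" using F1(1) by blast
      show "infinite B" if "B \<in> ?F" for B using that X finite_subset by blast
      show "\<exists>C\<in>F. C \<inter> X \<subseteq> A \<inter> B" if "A \<in> ?F" "B \<in> ?F" for A B
      proof -
        from that obtain A' B' where "A' \<in> F" "B' \<in> F" "A' \<inter> X \<subseteq> A" "B' \<inter> X \<subseteq> B" by blast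
        then show ?thesis using F1(3) by (intro bexI[of _ "A' \<inter> B'"]) auto
      qed
      show "\<exists>C\<in>F. C \<inter> X \<subseteq> B" if "A \<in> ?F" "A \<subseteq> B" for A B using that by blast
      show "\<exists>C\<in>F. C \<inter> X \<subseteq> A - {k}" if "A \<in> ?F" for A k
      proof -
        from that obtain A' where "A' \<in> F" "A' \<inter> X \<subseteq> A" by blast
        then show ?thesis using F1(5) by (intro bexI[of _ "A' - {k}"]) auto
      qed
    qed
    moreover have "F \<subseteq> ?F" by blast
    ultimately have "?F = F" using max by blast
    then show ?thesis using F1(1) by blast
  qed
  define \<UU> where "\<UU> = Abs_filter (\<lambda>P. {n. P n} \<in> F)"
  have ev: "eventually P \<UU> \<longleftrightarrow> {n. P n} \<in> F" for P
    unfolding \<UU>_def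
  proof (rule eventually_Abs_filter, rule is_filter.intro)
    show "{n. True} \<in> F" using F1(4)[OF F1(1)] by simp
    show "{n. P n \<and> Q n} \<in> F" if "{n. P n} \<in> F" "{n. Q n} \<in> F" for P Q
      using F1(3)[OF that] by (simp add: Collect_conj_eq)
    show "{n. Q n} \<in> F" if "\<forall>n. P n \<longrightarrow> Q n" "{n. P n} \<in> F" for P Q
      using F1(4)[OF that(2)] that(1) by blast
  qed
  have "nonprincipal_ultrafilter \<UU>"
    unfolding nonprincipal_ultrafilter_def
  proof (intro conjI allI)
    show "\<UU> \<noteq> bot" unfolding trivial_limit_def ev using F1(2) by auto
    show "\<not> eventually (\<lambda>n. n = k) \<UU>" for k unfolding ev using F1(2) by auto
    show "eventually P \<UU> \<or> eventually (\<lambda>n. \<not> P n) \<UU>" for P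
    proof (rule ccontr)
      assume "\<not> ?thesis"
      then have n: "{n. P n} \<notin> F" "{n. \<not> P n} \<notin> F" unfolding ev by auto
      obtain A where A: "A \<in> F" "finite (A \<inter> {n. P n})" using add n(1) by blast
      obtain B where B: "B \<in> F" "finite (B \<inter> {n. \<not> P n})" using add n(2) by blast
      have "finite (A \<inter> B)"
        by (rule finite_subset[of _ "(A \<inter> {n. P n}) \<union> (B \<inter> {n. \<not> P n})"]) (use A B in auto)
      then show False using F1(2,3) A B by blast
    qed
  qed
  moreover have "eventually (\<lambda>n. n \<in> S) \<UU>" unfolding ev using F1(1) by simp
  ultimately show ?thesis by (rule that)
qed

text \<open>If \<open>P\<close> fails infinitely often, some nonprincipal ultrafilter contains the
  set of failures. This brings results along ultrafilters back to sequences.\<close>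

lemma eventually_sequentially_ultrafilterI:
  assumes "\<And>\<UU>. nonprincipal_ultrafilter \<UU> \<Longrightarrow> eventually P \<UU>"
  shows "eventually P sequentially"
proof (rule ccontr)
  assume "\<not> eventually P sequentially"
  then have "infinite {n. \<not> P n}"
    by (simp add: cofinite_eq_sequentially[symmetric] eventually_cofinite)
  then obtain \<UU> where \<UU>: "nonprincipal_ultrafilter \<UU>" "eventually (\<lambda>n. \<not> P n) \<UU>"
    by (rule nonprincipal_ultrafilter_containing) simp
  from assms[OF \<UU>(1)] \<UU>(2) have "eventually (\<lambda>n. False) \<UU>" by eventually_elim simp
  then have "\<UU> = bot" by (simp add: eventually_False)
  with \<UU>(1) show False unfolding nonprincipal_ultrafilter_def by blast
qed

lemma nonprincipal_ultrafilter_le_sequentially: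
  assumes "nonprincipal_ultrafilter \<UU>"
  shows "\<UU> \<le> sequentially"
proof (rule filter_leI)
  fix P assume "eventually P sequentially"
  then obtain k where k: "\<forall>n\<ge>k. P n"
    unfolding eventually_sequentially by (rule exE)
  have "eventually (\<lambda>n. n \<ge> k) \<UU>"
  proof (induction k)
    case (Suc k)
    have "eventually (\<lambda>n. n \<noteq> k) \<UU>"
      using assms unfolding nonprincipal_ultrafilter_def by blast
    with Suc show ?case by eventually_elim simp
  qed simp
  then show "eventually P \<UU>" by eventually_elim (use k in simp)
qed

text \<open>In the graph joining \<open>x\<close> to \<open>f x\<close> every vertex has at most one
  edge going out and, by injectivity, one coming in; so a greedy colouring gets by with three
  colours. That the number is independent of \<open>A\<close> lets a fixed finite set of bits serve
  all \<open>Y n\<close> at once.\<close>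

lemma three_colouring:
  assumes "finite A" "inj_on f B" "A \<subseteq> B"
  obtains c :: "'a \<Rightarrow> nat" where "\<And>x. c x < 3"
    "\<And>x. x \<in> A \<Longrightarrow> f x \<in> A \<Longrightarrow> f x \<noteq> x \<Longrightarrow> c (f x) \<noteq> c x"
proof -
  have "\<exists>c :: 'a \<Rightarrow> nat. (\<forall>x. c x < 3) \<and> (\<forall>x\<in>A. f x \<in> A \<longrightarrow> f x \<noteq> x \<longrightarrow> c (f x) \<noteq> c x)"
    using assms(1,3)
  proof (induction A rule: finite_induct)
    case (insert a A)
    then obtain c :: "'a \<Rightarrow> nat" where c: "\<And>x. c x < 3"
      "\<And>x. x \<in> A \<Longrightarrow> f x \<in> A \<Longrightarrow> f x \<noteq> x \<Longrightarrow> c (f x) \<noteq> c x" by auto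
    \<comment> \<open>The only possible predecessor of \<open>a\<close> in \<open>A\<close>; if
      there is none, an arbitrary point, which merely excludes one more colour.\<close>
    define p where "p = (SOME x. x \<in> A \<and> f x = a)"
    have p: "x = p" if "x \<in> A" "f x = a" for x
    proof -
      have "p \<in> A \<and> f p = a" unfolding p_def by (rule someI[of _ x]) (use that in simp)
      with that show ?thesis using assms(2) insert.prems by (auto dest: inj_onD)
    qed
    have "\<exists>k<3. k \<noteq> i \<and> k \<noteq> j" for i j :: nat by presburger
    then obtain k :: nat where k: "k < 3" "k \<noteq> c (f a)" "k \<noteq> c p" by blast
    show ?case
    proof (rule exI[of _ "c(a := k)"], intro conjI allI ballI impI)
      show "(c(a := k)) x < 3" for x using c k by simp
      show "(c(a := k)) (f x) \<noteq> (c(a := k)) x" if "x \<in> insert a A" "f x \<in> insert a A" "f x \<noteq> x" for x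
        using that c k p[of x] insert.hyps by (cases "x = a"; cases "f x = a") auto
    qed
  qed (auto intro!: exI[of _ "\<lambda>_. 0"])
  then show ?thesis using that by blast
qed

lemma group_actionI:
  fixes G (structure)
  assumes "group G"
    and ext: "\<And>g. g \<in> carrier G \<Longrightarrow> \<phi> g \<in> extensional E"
    and closed: "\<And>g x. g \<in> carrier G \<Longrightarrow> x \<in> E \<Longrightarrow> \<phi> g x \<in> E"
    and one: "\<And>x. x \<in> E \<Longrightarrow> \<phi> \<one>\<^bsub>G\<^esub> x = x"
    and mult: "\<And>g h x. g \<in> carrier G \<Longrightarrow> h \<in> carrier G \<Longrightarrow> x \<in> E \<Longrightarrow>
                 \<phi> (g \<otimes>\<^bsub>G\<^esub> h) x = \<phi> g (\<phi> h x)"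
  shows "group_action G E \<phi>"
proof -
  interpret group G by fact
  have bij: "\<phi> g \<in> Bij E" if "g \<in> carrier G" for g
  proof -
    have "bij_betw (\<phi> g) E E"
      by (rule bij_betw_byWitness[where f' = "\<phi> (inv g)"])
        (use that in \<open>auto simp: closed one simp flip: mult\<close>)
    with ext that show ?thesis by (simp add: Bij_def)
  qed
  have "\<phi> \<in> hom G (BijGroup E)"
  proof (rule homI)
    show "\<phi> g \<in> carrier (BijGroup E)" if "g \<in> carrier G" for g
      using bij that by (simp add: BijGroup_def)
    show "\<phi> (g \<otimes> h) = \<phi> g \<otimes>\<^bsub>BijGroup E\<^esub> \<phi> h" if "g \<in> carrier G" "h \<in> carrier G" for g h
    proof -
      have "\<phi> (g \<otimes> h) = compose E (\<phi> g) (\<phi> h)"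
        by (rule extensionalityI[of _ E]) (use that in \<open>auto simp: ext mult compose_eq\<close>)
      then show ?thesis using that by (simp add: BijGroup_def bij)
    qed
  qed
  then show ?thesis
    by (intro group_action.intro group_hom.intro group_hom_axioms.intro group_BijGroup is_group)
qed

lemma (in group_action) inv_action:
  assumes "g \<in> carrier G" "x \<in> E"
  shows "\<phi> (inv g) (\<phi> g x) = x" "\<phi> g (\<phi> (inv g) x) = x"
proof -
  interpret group G using group_hom group_hom.axioms(1) by auto
  show "\<phi> (inv g) (\<phi> g x) = x" "\<phi> g (\<phi> (inv g) x) = x"
    using assms by (simp_all flip: composition_rule id_eq_one)
qed

lemma (in group_action) one_action: "x \<in> E \<Longrightarrow> \<phi> \<one> x = x"
  by (simp flip: id_eq_one)

text \<open>The sets that can be approximated from \<C> form a \<sigma>-algebra. For a countable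
  union, continuity of the measure leaves a finite union, whose members are approximated one by
  one.\<close>

lemma (in finite_measure) algebra_approximation:
  assumes gen: "sets M = sigma_sets (space M) \<C>" and \<C>: "algebra (space M) \<C>"
    and A: "A \<in> sets M" and "\<epsilon> > 0"
  obtains B where "B \<in> \<C>" "measure M (sym_diff A B) < \<epsilon>"
proof -
  interpret \<C>: algebra "space M" \<C> by fact
  have \<C>M: "B \<in> sets M" if "B \<in> \<C>" for B using that gen by auto
  have "A \<in> sigma_sets (space M) \<C>" using A gen by simp
  then have "\<forall>\<epsilon>>0. \<exists>B\<in>\<C>. measure M (sym_diff A B) < \<epsilon>"
  proof (induction A rule: sigma_sets.induct)
    case (Basic a)
    show ?case by (intro allI impI bexI[OF _ Basic]) simp
  next
    case Empty
    show ?case by (intro allI impI bexI[of _ "{}"]) auto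
  next
    case (Compl a)
    show ?case
    proof (intro allI impI)
      fix \<epsilon> :: real assume "\<epsilon> > 0"
      with Compl.IH obtain B where B: "B \<in> \<C>" "measure M (sym_diff a B) < \<epsilon>" by blast
      have "a \<subseteq> space M" using Compl.hyps \<C>.space_closed sigma_sets_into_sp by blast
      moreover have "B \<subseteq> space M" using B(1) \<C>.space_closed by blast
      ultimately have "sym_diff (space M - a) (space M - B) = sym_diff a B" by blast
      with B show "\<exists>B\<in>\<C>. measure M (sym_diff (space M - a) B) < \<epsilon>"
        by (intro bexI[of _ "space M - B"]) auto
    qed
  next
    case (Union a)
    have aM: "a i \<in> sets M" for i using Union.hyps gen by simp
    show ?case
    proof (intro allI impI)
      fix \<epsilon> :: real assume \<epsilon>: "\<epsilon> > 0"
      have "(\<lambda>n. measure M ((\<Union>i. a i) - (\<Union>i<n. a i))) \<longlonglongrightarrow> measure M (\<Inter>n. (\<Union>i. a i) - (\<Union>i<n. a i))"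
        by (rule finite_Lim_measure_decseq) (use aM in \<open>auto simp: decseq_def\<close>)
      moreover have "(\<Inter>n. (\<Union>i. a i) - (\<Union>i<n. a i)) = {}" by blast
      ultimately have "(\<lambda>n. measure M ((\<Union>i. a i) - (\<Union>i<n. a i))) \<longlonglongrightarrow> 0"
        by (simp only: measure_empty)
      then have "eventually (\<lambda>n. measure M ((\<Union>i. a i) - (\<Union>i<n. a i)) < \<epsilon>/2) sequentially"
        using \<epsilon> by (intro order_tendstoD(2)) auto
      then obtain n where n: "measure M ((\<Union>i. a i) - (\<Union>i<n. a i)) < \<epsilon>/2"
        unfolding eventually_sequentially by blast
      \<comment> \<open>Half of \<epsilon> is shared among \<open>n\<close> sets; the summand 1
        covers \<open>n = 0\<close>.\<close>
      define \<delta> where "\<delta> = \<epsilon> / 2 / (real n + 1)"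
      have "\<delta> > 0" using \<epsilon> by (simp add: \<delta>_def)
      with Union.IH have "\<exists>B\<in>\<C>. measure M (sym_diff (a i) B) < \<delta>" for i by blast
      then obtain B where B: "\<And>i. B i \<in> \<C>" "\<And>i. measure M (sym_diff (a i) (B i)) < \<delta>" by metis
      have BM: "(\<Union>i<n. B i) \<in> \<C>" using B(1) by (intro \<C>.finite_UN) auto
      have "measure M (sym_diff (\<Union>i. a i) (\<Union>i<n. B i))
          \<le> measure M (((\<Union>i. a i) - (\<Union>i<n. a i)) \<union> (\<Union>i<n. sym_diff (a i) (B i)))"
        by (rule finite_measure_mono) (use aM B \<C>M in \<open>auto intro!: sets.Un sets.Diff sets.finite_UN\<close>)
      also have "\<dots> \<le> measure M ((\<Union>i. a i) - (\<Union>i<n. a i)) + measure M (\<Union>i<n. sym_diff (a i) (B i))"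
        by (rule measure_Un_le) (use aM B \<C>M in \<open>auto intro!: sets.Un sets.Diff sets.finite_UN\<close>)
      also have "measure M (\<Union>i<n. sym_diff (a i) (B i)) \<le> (\<Sum>i<n. measure M (sym_diff (a i) (B i)))"
        by (rule measure_UNION_le) (use aM B \<C>M in \<open>auto intro!: sets.Un sets.Diff\<close>)
      also have "\<dots> \<le> (\<Sum>i<n. \<delta>)" using B(2) by (intro sum_mono) (simp add: less_imp_le)
      also have "\<dots> \<le> \<epsilon> / 2" using \<epsilon> by (simp add: \<delta>_def field_simps)
      finally have "measure M (sym_diff (\<Union>i. a i) (\<Union>i<n. B i)) < \<epsilon>" using n by simp
      with BM show "\<exists>B\<in>\<C>. measure M (sym_diff (\<Union>i. a i) B) < \<epsilon>" by blast
    qed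
  qed
  with \<open>\<epsilon> > 0\<close> that show ?thesis by blast
qed

section \<open>The limit of a sequence of finite actions\<close>

definition real_digits :: "real \<Rightarrow> nat set" where
  "real_digits = (SOME b. bij b)"

lemma bij_real_digits: "bij real_digits"
proof -
  obtain b :: "nat set \<Rightarrow> real" where "bij b"
    using nat_sets_eqpoll_reals unfolding eqpoll_def by (rule exE)
  then have "bij (inv_into UNIV b)" by (rule bij_imp_bij_inv)
  then show ?thesis unfolding real_digits_def by (rule someI[of bij])
qed

text \<open>Real values are taken for the two digits so that the Cantor space becomes a closed
  subset of the Polish space \<open>nat \<Rightarrow> real\<close>.\<close>

definition digit :: "real \<Rightarrow> nat \<Rightarrow> real" where
  "digit x k = (if k \<in> real_digits x then 1 else 0)"

lemma digit_eq_1_iff: "digit x k = 1 \<longleftrightarrow> k \<in> real_digits x"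
  by (simp add: digit_def)

lemma inj_digit: "inj digit"
proof (rule injI)
  fix x y assume "digit x = digit y"
  then have "k \<in> real_digits x \<longleftrightarrow> k \<in> real_digits y" for k
    by (metis digit_eq_1_iff)
  then have "real_digits x = real_digits y" by blast
  then show "x = y" by (rule injD[OF bij_is_inj[OF bij_real_digits]])
qed

lemma range_digit: "range digit = {w. \<forall>k. w k \<in> {0, 1}}"
proof (intro equalityI subsetI)
  fix w :: "nat \<Rightarrow> real" assume "w \<in> {w. \<forall>k. w k \<in> {0, 1}}"
  then have w: "\<And>k. w k \<in> {0, 1}" by blast
  obtain x where x: "{k. w k = 1} = real_digits x"
    by (rule surjE[OF bij_is_surj[OF bij_real_digits]])
  have "digit x = w"
  proof
    fix k show "digit x k = w k"
      using w[of k] x unfolding digit_def by auto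
  qed
  then show "w \<in> range digit" by blast
qed (auto simp: digit_def)

text \<open>The Polish topology of the Cantor space, carried over to the set of real numbers by an
  arbitrary bijection; the usual topology of the reals plays no role.\<close>

definition cantor_topology :: "real topology" where
  "cantor_topology = pullback_topology UNIV digit euclidean"

text \<open>The underlying type is \<open>real\<close> because \<open>Stuck_Zimmer\<close> and
  \<open>free_action_costs\<close> range over measures on that type.\<close>

definition cantor_algebra :: "real measure" where
  "cantor_algebra = vimage_algebra UNIV digit borel"

lemma space_cantor_algebra [simp]: "space cantor_algebra = UNIV"
  by (simp add: cantor_algebra_def)

lemma cantor_topology_homeomorphic:
  "cantor_topology homeomorphic_space top_of_set (range digit)"
proof (rule homeomorphic_map_imp_homeomorphic_space, rule bijective_open_imp_homeomorphic_map)
  have top: "topspace cantor_topology = UNIV"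
    by (simp add: cantor_topology_def topspace_pullback_topology)
  have op: "openin cantor_topology U \<longleftrightarrow> (\<exists>V. open V \<and> U = digit -` V)" for U
    by (simp add: cantor_topology_def openin_pullback_topology)
  show "continuous_map cantor_topology (top_of_set (range digit)) digit"
    unfolding continuous_map_def top
  proof (intro conjI allI impI)
    fix U assume "openin (top_of_set (range digit)) U"
    then obtain V where "open V" "U = range digit \<inter> V" unfolding openin_open by blast
    then have "{x \<in> UNIV. digit x \<in> U} = digit -` V" by blast
    with \<open>open V\<close> show "openin cantor_topology {x \<in> UNIV. digit x \<in> U}" unfolding op by blast
  qed simp
  show "open_map cantor_topology (top_of_set (range digit)) digit"
    unfolding open_map_def
  proof (intro allI impI)
    fix U assume "openin cantor_topology U"
    then obtain V where "open V" "U = digit -` V" unfolding op by blast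
    then show "openin (top_of_set (range digit)) (digit ` U)"
      unfolding openin_open by blast
  qed
  show "digit ` topspace cantor_topology = topspace (top_of_set (range digit))"
    by (simp add: top)
  show "inj_on digit (topspace cantor_topology)"
    using inj_digit by (simp add: top)
qed

lemma closed_range_digit: "closed (range digit)"
proof -
  have "closed {w :: nat \<Rightarrow> real. w k \<in> {0, 1}}" for k
  proof -
    have "closed ((\<lambda>w :: nat \<Rightarrow> real. w k) -` {0, 1})"
    proof (rule closed_vimage)
      show "closed {0, 1::real}" by simp
      show "continuous_on UNIV (\<lambda>w :: nat \<Rightarrow> real. w k)"
        by (rule continuous_on_product_coordinates)
    qed
    then show ?thesis by (simp add: vimage_def)
  qed
  then show ?thesis unfolding range_digit by (intro closed_Collect_all)
qed

lemma second_countable_euclidean: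
  "second_countable (euclidean :: 'x :: second_countable_topology topology)"
proof -
  obtain B :: "'x set set" where B: "countable B" "topological_basis B"
    using ex_countable_basis by blast
  show ?thesis
    unfolding second_countable_def
  proof (intro exI[of _ B] conjI ballI allI impI)
    show "openin euclidean V" if "V \<in> B" for V
      using topological_basis_open[OF B(2) that] by simp
    show "\<exists>V\<in>B. x \<in> V \<and> V \<subseteq> U" if "openin euclidean U \<and> x \<in> U" for U x
      using topological_basisE[OF B(2), of U x] that by (metis open_openin)
  qed (fact B(1))
qed

text \<open>Closed subspaces of Polish spaces are Polish; and since taking preimages commutes with
  generating a \<sigma>-algebra, \<open>cantor_algebra\<close> consists of the Borel sets of
  \<open>cantor_topology\<close>.\<close>

lemma standard_probability_space_cantor:
  assumes "prob_space M" "sets M = sets cantor_algebra"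
  shows "standard_probability_space M"
  unfolding standard_probability_space_def
proof (intro conjI exI[of _ cantor_topology])
  have sp: "space M = UNIV" using sets_eq_imp_space_eq[OF assms(2)] by simp
  show "prob_space M" by fact
  show "completely_metrizable_space cantor_topology"
    unfolding homeomorphic_completely_metrizable_space[OF cantor_topology_homeomorphic]
    by (rule completely_metrizable_space_closedin[OF completely_metrizable_space_euclidean])
      (simp add: closed_range_digit)
  show "second_countable cantor_topology"
    unfolding homeomorphic_space_second_countability[OF cantor_topology_homeomorphic]
    by (rule second_countable_subtopology[OF second_countable_euclidean])
  show "topspace cantor_topology = space M"
    by (simp add: cantor_topology_def topspace_pullback_topology sp)
  have "cantor_algebra = sigma UNIV {digit -` A \<inter> UNIV | A. A \<in> {S. open S}}"
    unfolding cantor_algebra_def borel_def by (rule vimage_algebra_sigma) auto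
  then have "sets M = sets (sigma UNIV {digit -` A \<inter> UNIV | A. A \<in> {S. open S}})"
    using assms(2) by (simp only:)
  also have "\<dots> = sigma_sets UNIV {digit -` A \<inter> UNIV | A. A \<in> {S. open S}}"
    by (rule sets_measure_of) simp
  finally have "sets M = sigma_sets UNIV {digit -` A \<inter> UNIV | A. A \<in> {S. open S}}" .
  moreover have "{digit -` A \<inter> UNIV | A. A \<in> {S. open S}} = {U. openin cantor_topology U}"
    by (auto simp: cantor_topology_def openin_pullback_topology)
  ultimately show "sets M = sigma_sets (space M) {U. openin cantor_topology U}"
    by (simp only: sp)
qed

lemma measurable_cantor_algebraI:
  assumes "\<And>k. {x \<in> space N. k \<in> real_digits (f x)} \<in> sets N"
  shows "f \<in> measurable N cantor_algebra"
  unfolding cantor_algebra_def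
proof (rule measurable_vimage_algebra2)
  show "(\<lambda>x. digit (f x)) \<in> borel_measurable N"
  proof (rule measurable_coordinatewise_then_product)
    fix k
    have "Measurable.pred N (\<lambda>x. k \<in> real_digits (f x))"
      by (simp add: pred_def assms)
    then show "(\<lambda>x. digit (f x) k) \<in> borel_measurable N"
      unfolding digit_def by measurable
  qed
qed simp

lemma real_digits_measurable: "{x. k \<in> real_digits x} \<in> sets cantor_algebra"
proof -
  have "(\<lambda>w :: nat \<Rightarrow> real. w k) \<in> borel_measurable borel"
    by (rule borel_measurable_continuous_onI) (rule continuous_on_product_coordinates)
  then have "(\<lambda>w :: nat \<Rightarrow> real. w k) -` {1} \<inter> space borel \<in> sets borel"
    by (rule measurable_sets) simp
  then have "digit -` ((\<lambda>w :: nat \<Rightarrow> real. w k) -` {1} \<inter> space borel) \<inter> UNIV \<in> sets cantor_algebra"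
    unfolding cantor_algebra_def by (rule in_vimage_algebra)
  moreover have "digit -` ((\<lambda>w :: nat \<Rightarrow> real. w k) -` {1} \<inter> space borel) \<inter> UNIV
      = {x. k \<in> real_digits x}"
    by (auto simp: digit_eq_1_iff)
  ultimately show ?thesis by simp
qed

text \<open>Cylinder sets, encoded as predicates on colour patterns rather than as sets of reals:
  the same \<open>P\<close> can then be evaluated at a point of the limit space and at a point of a
  finite set \<open>Y n\<close>.\<close>

definition finitary :: "'a set \<Rightarrow> (('a \<Rightarrow> nat \<Rightarrow> bool) \<Rightarrow> bool) \<Rightarrow> bool" where
  "finitary S P \<longleftrightarrow>
     (\<exists>J. finite J \<and> J \<subseteq> S \<times> UNIV \<and> (\<forall>v w. (\<forall>(h, j)\<in>J. v h j = w h j) \<longrightarrow> P v = P w))"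

lemma finitaryE:
  assumes "finitary S P"
  obtains J where "finite J" "J \<subseteq> S \<times> UNIV"
    "\<forall>v w. (\<forall>(h, j)\<in>J. v h j = w h j) \<longrightarrow> P v = P w"
  using assms unfolding finitary_def by blast

lemma finitaryI:
  assumes "finite J" "J \<subseteq> S \<times> UNIV" "\<And>v w. \<forall>(h, j)\<in>J. v h j = w h j \<Longrightarrow> P v = P w"
  shows "finitary S P"
  unfolding finitary_def
proof (intro exI[of _ J] conjI allI impI)
  show "P v = P w" if "\<forall>(h, j)\<in>J. v h j = w h j" for v w using that by (rule assms(3))
qed fact+

lemma finitary_bit: "h \<in> S \<Longrightarrow> finitary S (\<lambda>v. v h j)"
  by (rule finitaryI[of "{(h, j)}"]) auto

lemma finitary_const: "finitary S (\<lambda>v. b)"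
  by (rule finitaryI[of "{}"]) auto

lemma finitary_not: "finitary S P \<Longrightarrow> finitary S (\<lambda>v. \<not> P v)"
  unfolding finitary_def by simp

text \<open>The index sets of the finitely many \<open>P i\<close> are united. As \<open>Q\<close>
  need not be written as a formula in the \<open>P i\<close>, this also applies to connectedness of
  a finite graph with edges decided by the \<open>P i\<close>.\<close>

lemma finitary_combine:
  fixes S :: "'a set"
  assumes "finite I" "\<And>i. i \<in> I \<Longrightarrow> finitary S (P i)"
    and "\<And>v w. (\<And>i. i \<in> I \<Longrightarrow> P i v = P i w) \<Longrightarrow> Q v = Q w"
  shows "finitary S Q"
proof -
  have "\<forall>i\<in>I. \<exists>J. finite J \<and> J \<subseteq> S \<times> UNIV \<and>
          (\<forall>v w. (\<forall>(h, j)\<in>J. v h j = w h j) \<longrightarrow> P i v = P i w)"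
    using assms(2) unfolding finitary_def by (rule ballI)
  from bchoice[OF this] obtain J where
    "\<forall>i\<in>I. finite (J i) \<and> J i \<subseteq> S \<times> UNIV \<and>
          (\<forall>v w. (\<forall>(h, j)\<in>J i. v h j = w h j) \<longrightarrow> P i v = P i w)" by (rule exE)
  note * = bspec[OF this]
  show ?thesis
  proof (rule finitaryI[of "\<Union>i\<in>I. J i"])
    show "finite (\<Union>i\<in>I. J i)" using assms(1) * by blast
    show "(\<Union>i\<in>I. J i) \<subseteq> S \<times> UNIV" using * by blast
    fix v w :: "'a \<Rightarrow> nat \<Rightarrow> bool"
    assume eq: "\<forall>(h, j)\<in>(\<Union>i\<in>I. J i). v h j = w h j"
    show "Q v = Q w"
    proof (rule assms(3))
      fix i assume i: "i \<in> I"
      then have "\<forall>(h, j)\<in>J i. v h j = w h j" using eq by blast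
      then show "P i v = P i w" using *[OF i] by blast
    qed
  qed
qed

lemma finitary_conj:
  assumes "finitary S P" "finitary S Q"
  shows "finitary S (\<lambda>v. P v \<and> Q v)"
proof (rule finitary_combine[of "{True, False}" S "\<lambda>b. if b then P else Q"])
  fix v w
  assume eq: "\<And>i. i \<in> {True, False} \<Longrightarrow> (if i then P else Q) v = (if i then P else Q) w"
  show "(P v \<and> Q v) = (P w \<and> Q w)" using eq[of True] eq[of False] by simp
qed (use assms in auto)

lemma finitary_ball:
  assumes "finite I" "\<And>i. i \<in> I \<Longrightarrow> finitary S (P i)"
  shows "finitary S (\<lambda>v. \<forall>i\<in>I. P i v)"
proof (rule finitary_combine[OF assms])
  fix v w assume "\<And>i. i \<in> I \<Longrightarrow> P i v = P i w"
  then show "(\<forall>i\<in>I. P i v) = (\<forall>i\<in>I. P i w)" by (rule ball_cong[OF refl])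
qed

lemma finitary_bex:
  assumes "finite I" "\<And>i. i \<in> I \<Longrightarrow> finitary S (P i)"
  shows "finitary S (\<lambda>v. \<exists>i\<in>I. P i v)"
proof (rule finitary_combine[OF assms])
  fix v w assume "\<And>i. i \<in> I \<Longrightarrow> P i v = P i w"
  then show "(\<exists>i\<in>I. P i v) = (\<exists>i\<in>I. P i w)" by (rule bex_cong[OF refl])
qed

lemma (in group) finitary_translate:
  assumes P: "finitary (carrier G) P" and g: "g \<in> carrier G"
  shows "finitary (carrier G) (\<lambda>v. P (\<lambda>h j. v (h \<otimes> g) j))"
proof -
  obtain J where J: "finite J" "J \<subseteq> carrier G \<times> UNIV"
    "\<forall>v w. (\<forall>(h, j)\<in>J. v h j = w h j) \<longrightarrow> P v = P w"
    by (rule finitaryE[OF P])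
  show ?thesis
  proof (rule finitaryI[of "(\<lambda>(h, j). (h \<otimes> g, j)) ` J"])
    show "(\<lambda>(h, j). (h \<otimes> g, j)) ` J \<subseteq> carrier G \<times> UNIV" using J(2) g by auto
    fix v w :: "'a \<Rightarrow> nat \<Rightarrow> bool"
    assume eq: "\<forall>(h, j)\<in>(\<lambda>(h, j). (h \<otimes> g, j)) ` J. v h j = w h j"
    show "P (\<lambda>h j. v (h \<otimes> g) j) = P (\<lambda>h j. w (h \<otimes> g) j)"
    proof (rule J(3)[rule_format], clarify)
      fix h j assume "(h, j) \<in> J"
      then have "(h \<otimes> g, j) \<in> (\<lambda>(h, j). (h \<otimes> g, j)) ` J"
        by (intro image_eqI[of _ _ "(h, j)"]) simp_all
      with eq show "v (h \<otimes> g) j = w (h \<otimes> g) j" by blast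
    qed
  qed (use J(1) in simp)
qed

text \<open>The space splits into finitely many parts according to the set \<open>K\<close> of
  indices whose condition holds, and \<open>Q\<close> is constant on each part.\<close>

lemma finite_pattern_measurable:
  assumes I: "finite I" and P: "\<And>i. i \<in> I \<Longrightarrow> {x \<in> space M. P i x} \<in> sets M"
    and Q: "\<And>v w. (\<And>i. i \<in> I \<Longrightarrow> v i = w i) \<Longrightarrow> Q v = Q w"
  shows "{x \<in> space M. Q (\<lambda>i. P i x)} \<in> sets M"
proof -
  have "{x \<in> space M. Q (\<lambda>i. P i x)} =
      (\<Union>K\<in>{K \<in> Pow I. Q (\<lambda>i. i \<in> K)}. {x \<in> space M. \<forall>i\<in>I. P i x = (i \<in> K)})"
  proof (intro equalityI subsetI)
    fix x assume x: "x \<in> {x \<in> space M. Q (\<lambda>i. P i x)}"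
    let ?K = "{i \<in> I. P i x}"
    have "Q (\<lambda>i. P i x) = Q (\<lambda>i. i \<in> ?K)" by (rule Q) simp
    with x show "x \<in> (\<Union>K\<in>{K \<in> Pow I. Q (\<lambda>i. i \<in> K)}. {x \<in> space M. \<forall>i\<in>I. P i x = (i \<in> K)})"
      by (intro UN_I[of ?K]) auto
  next
    fix x assume "x \<in> (\<Union>K\<in>{K \<in> Pow I. Q (\<lambda>i. i \<in> K)}. {x \<in> space M. \<forall>i\<in>I. P i x = (i \<in> K)})"
    then obtain K where K: "Q (\<lambda>i. i \<in> K)" "x \<in> space M" "\<forall>i\<in>I. P i x = (i \<in> K)" by blast
    have "Q (\<lambda>i. P i x) = Q (\<lambda>i. i \<in> K)" by (rule Q) (use K(3) in blast)
    with K show "x \<in> {x \<in> space M. Q (\<lambda>i. P i x)}" by simp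
  qed
  also have "\<dots> \<in> sets M"
  proof (rule sets.finite_UN)
    fix K
    have "{x \<in> space M. P i x = (i \<in> K)} \<in> sets M" if "i \<in> I" for i
    proof (cases "i \<in> K")
      case False
      have "space M - {x \<in> space M. P i x} \<in> sets M" using P[OF that] by (rule sets.compl_sets)
      moreover have "space M - {x \<in> space M. P i x} = {x \<in> space M. P i x = (i \<in> K)}"
        using False by auto
      ultimately show ?thesis by simp
    qed (use P[OF that] in simp)
    then show "{x \<in> space M. \<forall>i\<in>I. P i x = (i \<in> K)} \<in> sets M"
      using I by (intro sets.sets_Collect_finite_All)
  qed (use I in simp)
  finally show ?thesis .
qed

text \<open>The limit along \<open>\<UU>\<close> of the coloured actions: a point of the limit space is an arbitrary
  colouring of \<open>G\<close>, and the limit measure of a cylinder set is the \<open>\<UU>\<close>-limit of the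
  frequency with which the orbit map of a point of \<open>Y n\<close> shows that pattern.\<close>

locale coloured_actions = group G for G :: "('a, 'b) monoid_scheme" (structure) +
  fixes \<UU> :: "nat filter" and Y :: "nat \<Rightarrow> 'y set"
    and \<psi> :: "nat \<Rightarrow> 'a \<Rightarrow> 'y \<Rightarrow> 'y" and c :: "nat \<Rightarrow> nat \<Rightarrow> 'y \<Rightarrow> bool"
  assumes countable_carrier: "countable (carrier G)"
    and U: "nonprincipal_ultrafilter \<UU>"
    and finite_Y: "\<And>n. finite (Y n)" and nonempty_Y: "\<And>n. Y n \<noteq> {}"
    and action: "\<And>n. group_action G (Y n) (\<psi> n)"
begin

lemma U_not_bot: "\<UU> \<noteq> bot"
  using U unfolding nonprincipal_ultrafilter_def by blast

lemmas U_not = ultrafilter_not[OF U finite_Y nonempty_Y]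

lemma eventually_U_const [simp]: "eventually (\<lambda>n. b) \<UU> \<longleftrightarrow> b"
  using U_not_bot by (simp add: eventually_const_iff)

section \<open>Colour patterns on the group as real numbers\<close>

definition code :: "'a \<Rightarrow> nat \<Rightarrow> nat" where
  "code h j = to_nat_on (carrier G \<times> UNIV) (h, j)"

definition decode :: "nat \<Rightarrow> 'a \<times> nat" where
  "decode = from_nat_into (carrier G \<times> UNIV)"

lemma countable_index: "countable (carrier G \<times> (UNIV :: nat set))"
  using countable_carrier by simp

text \<open>The factor \<open>UNIV\<close> ensures this even for a finite group. It makes
  \<open>decode\<close> a right inverse on all natural numbers, so that every bit position of a real
  number belongs to some index and \<open>bits\<close> is injective.\<close>

lemma infinite_index: "infinite (carrier G \<times> (UNIV :: nat set))"
  using one_closed by (auto simp: finite_cartesian_product_iff)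

lemma decode_code: "h \<in> carrier G \<Longrightarrow> decode (code h j) = (h, j)"
  unfolding decode_def code_def by (rule from_nat_into_to_nat_on[OF countable_index]) simp

lemma code_decode: "code (fst (decode k)) (snd (decode k)) = k"
  unfolding decode_def code_def
  by (simp add: to_nat_on_from_nat_into_infinite[OF countable_index infinite_index])

lemma decode_carrier: "fst (decode k) \<in> carrier G"
proof -
  have "decode k \<in> carrier G \<times> UNIV"
    unfolding decode_def by (rule from_nat_into) (use one_closed in blast)
  then show ?thesis by (simp add: mem_Times_iff)
qed

definition bits :: "real \<Rightarrow> 'a \<Rightarrow> nat \<Rightarrow> bool" where
  "bits x h j \<longleftrightarrow> code h j \<in> real_digits x"

definition of_bits :: "('a \<Rightarrow> nat \<Rightarrow> bool) \<Rightarrow> real" where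
  "of_bits w = inv_into UNIV real_digits {k. w (fst (decode k)) (snd (decode k))}"

lemma real_digits_of_bits: "real_digits (of_bits w) = {k. w (fst (decode k)) (snd (decode k))}"
  unfolding of_bits_def by (rule surj_f_inv_f[OF bij_is_surj[OF bij_real_digits]])

lemma bits_of_bits: "h \<in> carrier G \<Longrightarrow> bits (of_bits w) h j = w h j"
  by (simp add: bits_def real_digits_of_bits decode_code)

lemma bits_eqI:
  assumes "\<And>h j. h \<in> carrier G \<Longrightarrow> bits x h j = bits y h j"
  shows "x = y"
proof -
  have "k \<in> real_digits x \<longleftrightarrow> k \<in> real_digits y" for k
    using assms[OF decode_carrier, of k "snd (decode k)"] by (simp add: bits_def code_decode)
  then have "real_digits x = real_digits y" by blast
  then show ?thesis by (rule injD[OF bij_is_inj[OF bij_real_digits]])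
qed

definition pattern :: "nat \<Rightarrow> 'y \<Rightarrow> 'a \<Rightarrow> nat \<Rightarrow> bool" where
  "pattern n y h j = c n j (\<psi> n h y)"

text \<open>Phrased with internal sets, this chooses no representative of the class
  \<open>C\<close>, and the preimage of each bit is Loeb measurable by construction.\<close>

definition limit_point :: "(nat \<Rightarrow> 'y) set \<Rightarrow> real" where
  "limit_point C = of_bits (\<lambda>h j. C \<in> internal_set \<UU> Y (\<lambda>n. {y \<in> Y n. pattern n y h j}))"

definition limit_measure :: "real measure" where
  "limit_measure = distr (Loeb \<UU> Y) cantor_algebra limit_point"

text \<open>Right translation of the argument is a left action. It copies the finite picture, where
  the colour seen by \<open>h\<close> from \<open>g y\<close> is the colour seen by
  \<open>h \<otimes> g\<close> from \<open>y\<close>.\<close>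

definition limit_action :: "'a \<Rightarrow> real \<Rightarrow> real" where
  "limit_action g x = of_bits (\<lambda>h j. bits x (h \<otimes> g) j)"

lemma bits_limit_action:
  "h \<in> carrier G \<Longrightarrow> bits (limit_action g x) h j = bits x (h \<otimes> g) j"
  by (simp add: limit_action_def bits_of_bits)

lemma space_limit [simp]: "space limit_measure = UNIV"
  and sets_limit: "sets limit_measure = sets cantor_algebra"
  by (simp_all add: limit_measure_def)

lemma bits_measurable: "{x. bits x h j} \<in> sets limit_measure"
  unfolding sets_limit bits_def by (rule real_digits_measurable)

lemma group_action_limit: "group_action G UNIV limit_action"
proof (rule group_actionI)
  show "group G" by (rule is_group)
  show "limit_action \<one> x = x" for x
    by (rule bits_eqI) (simp add: bits_limit_action)
  show "limit_action (g \<otimes> h) x = limit_action g (limit_action h x)"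
    if "g \<in> carrier G" "h \<in> carrier G" for g h x
    by (rule bits_eqI) (simp add: bits_limit_action that m_assoc)
qed auto

lemma space_Loeb: "space (Loeb \<UU> Y) = ultraproduct \<UU> Y"
  unfolding Loeb_def
  by (rule space_extend_measure, intro image_subsetI PowI internal_set_subset[OF U finite_Y nonempty_Y])

lemma internal_set_measurable:
  assumes "\<And>n. A n \<subseteq> Y n"
  shows "internal_set \<UU> Y A \<in> sets (Loeb \<UU> Y)"
proof -
  have "sets (Loeb \<UU> Y) = sigma_sets (ultraproduct \<UU> Y) (internal_set \<UU> Y ` {A. \<forall>n. A n \<subseteq> Y n})"
    unfolding Loeb_def
    by (rule sets_extend_measure, intro image_subsetI PowI internal_set_subset[OF U finite_Y nonempty_Y])
  then show ?thesis using assms by auto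
qed

lemma bits_limit_point:
  assumes y: "y \<in> Pi UNIV Y" and h: "h \<in> carrier G"
  shows "bits (limit_point (ultraclass \<UU> Y y)) h j \<longleftrightarrow> eventually (\<lambda>n. pattern n (y n) h j) \<UU>"
proof -
  have "y n \<in> Y n" for n using y by blast
  then show ?thesis
    unfolding limit_point_def
    by (simp add: bits_of_bits[OF h] ultraclass_mem_internal_set[OF U finite_Y nonempty_Y y])
qed

text \<open>A form of Los's theorem. The ultrafilter decides each of the finitely many bits on which
  \<open>P\<close> depends, so for almost all \<open>n\<close> all of them agree with those of the
  limit point.\<close>

lemma finitary_limit_point:
  assumes P: "finitary (carrier G) P" and y: "y \<in> Pi UNIV Y"
  shows "P (bits (limit_point (ultraclass \<UU> Y y))) \<longleftrightarrow> eventually (\<lambda>n. P (pattern n (y n))) \<UU>"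
proof -
  let ?x = "limit_point (ultraclass \<UU> Y y)"
  obtain J where J: "finite J" "J \<subseteq> carrier G \<times> UNIV"
    "\<forall>v w. (\<forall>(h, j)\<in>J. v h j = w h j) \<longrightarrow> P v = P w"
    by (rule finitaryE[OF P])
  have "eventually (\<lambda>n. bits ?x (fst i) (snd i) = pattern n (y n) (fst i) (snd i)) \<UU>" if "i \<in> J" for i
  proof -
    have h: "fst i \<in> carrier G" using J(2) that by auto
    show ?thesis
    proof (cases "bits ?x (fst i) (snd i)")
      case True
      then show ?thesis using bits_limit_point[OF y h] by simp
    next
      case False
      then show ?thesis using bits_limit_point[OF y h] U_not by simp
    qed
  qed
  then have "eventually (\<lambda>n. \<forall>i\<in>J. bits ?x (fst i) (snd i) = pattern n (y n) (fst i) (snd i)) \<UU>"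
    using J(1) by (simp add: eventually_ball_finite_distrib)
  then have "eventually (\<lambda>n. P (bits ?x) = P (pattern n (y n))) \<UU>"
  proof eventually_elim
    case (elim n)
    show ?case by (rule J(3)[rule_format]) (use elim in \<open>simp add: case_prod_beta\<close>)
  qed
  then have "eventually (\<lambda>n. P (bits ?x)) \<UU> \<longleftrightarrow> eventually (\<lambda>n. P (pattern n (y n))) \<UU>"
    by (rule eventually_cong) simp
  then show ?thesis by simp
qed

lemma limit_point_vimage:
  assumes P: "finitary (carrier G) P"
  shows "limit_point -` {x. P (bits x)} \<inter> space (Loeb \<UU> Y)
           = internal_set \<UU> Y (\<lambda>n. {y \<in> Y n. P (pattern n y)})"
proof (rule internal_set_eqI[OF U finite_Y nonempty_Y, symmetric])
  show "limit_point -` {x. P (bits x)} \<inter> space (Loeb \<UU> Y) \<subseteq> ultraproduct \<UU> Y"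
    by (simp add: space_Loeb)
  fix y assume y: "y \<in> Pi UNIV Y"
  then have "ultraclass \<UU> Y y \<in> ultraproduct \<UU> Y" by (simp add: ultraproduct_def)
  moreover have "y n \<in> Y n" for n using y by blast
  ultimately show "ultraclass \<UU> Y y \<in> limit_point -` {x. P (bits x)} \<inter> space (Loeb \<UU> Y)
      \<longleftrightarrow> eventually (\<lambda>n. y n \<in> {y \<in> Y n. P (pattern n y)}) \<UU>"
    by (simp add: space_Loeb finitary_limit_point[OF P y])
qed

lemma limit_point_measurable: "limit_point \<in> measurable (Loeb \<UU> Y) cantor_algebra"
proof (rule measurable_cantor_algebraI)
  fix k
  have "finitary (carrier G) (\<lambda>v. v (fst (decode k)) (snd (decode k)))"
    using decode_carrier by (rule finitary_bit)
  note * = limit_point_vimage[OF this]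
  have "{C \<in> space (Loeb \<UU> Y). k \<in> real_digits (limit_point C)}
      = limit_point -` {x. bits x (fst (decode k)) (snd (decode k))} \<inter> space (Loeb \<UU> Y)"
    by (auto simp: bits_def code_decode)
  also have "\<dots> \<in> sets (Loeb \<UU> Y)"
    unfolding * by (rule internal_set_measurable) blast
  finally show "{C \<in> space (Loeb \<UU> Y). k \<in> real_digits (limit_point C)} \<in> sets (Loeb \<UU> Y)" .
qed

sublocale limit: prob_space limit_measure
  unfolding limit_measure_def
  by (rule prob_space.prob_space_distr[OF prob_space_Loeb[OF U finite_Y nonempty_Y] limit_point_measurable])

lemma standard_limit: "standard_probability_space limit_measure"
  by (rule standard_probability_space_cantor) (unfold_locales, rule sets_limit)

lemma finitary_measurable:
  assumes P: "finitary (carrier G) P"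
  shows "{x. P (bits x)} \<in> sets limit_measure"
proof -
  obtain J where J: "finite J" "J \<subseteq> carrier G \<times> UNIV"
    "\<forall>v w. (\<forall>(h, j)\<in>J. v h j = w h j) \<longrightarrow> P v = P w"
    by (rule finitaryE[OF P])
  have "{x \<in> space limit_measure. (\<lambda>u. P (\<lambda>h j. u (h, j))) (\<lambda>i. bits x (fst i) (snd i))}
      \<in> sets limit_measure"
  proof (rule finite_pattern_measurable[OF J(1), where Q = "\<lambda>u. P (\<lambda>h j. u (h, j))"])
    show "{x \<in> space limit_measure. bits x (fst i) (snd i)} \<in> sets limit_measure" for i
      using bits_measurable by simp
    show "P (\<lambda>h j. v (h, j)) = P (\<lambda>h j. w (h, j))" if "\<And>i. i \<in> J \<Longrightarrow> v i = w i" for v w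
      by (rule J(3)[rule_format]) (use that in blast)
  qed
  then show ?thesis by simp
qed

text \<open>The preimage of a cylinder set is internal, so its Loeb measure is an ultralimit of
  normalized counts. Measures in the limit space are computed from the finite actions in this
  way.\<close>

lemma limit_measure_tendsto:
  assumes P: "finitary (carrier G) P"
  shows "((\<lambda>n. real (card {y \<in> Y n. P (pattern n y)}) / real (card (Y n)))
            \<longlongrightarrow> measure limit_measure {x. P (bits x)}) \<UU>"
proof -
  let ?f = "\<lambda>n. real (card {y \<in> Y n. P (pattern n y)}) / real (card (Y n))"
  have "?f n \<in> {0..1}" for n
    using card_mono[OF finite_Y, of "{y \<in> Y n. P (pattern n y)}" n] by (auto simp: divide_le_eq_1)
  note lim = ultralimit_exists[OF U finite_Y nonempty_Y, of ?f, OF this]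
  have "emeasure limit_measure {x. P (bits x)}
      = emeasure (Loeb \<UU> Y) (limit_point -` {x. P (bits x)} \<inter> space (Loeb \<UU> Y))"
    unfolding limit_measure_def
    using limit_point_measurable finitary_measurable[OF P] sets_limit by (intro emeasure_distr) auto
  also have "\<dots> = ennreal (Lim \<UU> ?f)"
    unfolding limit_point_vimage[OF P] by (rule emeasure_Loeb[OF U finite_Y nonempty_Y]) blast
  finally have "measure limit_measure {x. P (bits x)} = Lim \<UU> ?f"
    using lim(2) by (simp add: measure_def)
  with lim(1) show ?thesis by simp
qed

text \<open>Laws of the finite actions pass to the limit, since frequency 1 becomes measure 1. As
  the limit space contains every colouring, such laws hold only almost everywhere there.\<close>

lemma limit_measure_AE:
  assumes P: "finitary (carrier G) P"
    and ev: "eventually (\<lambda>n. \<forall>y\<in>Y n. P (pattern n y)) \<UU>"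
  shows "AE x in limit_measure. P (bits x)"
proof -
  have "eventually (\<lambda>n. 1 = real (card {y \<in> Y n. P (pattern n y)}) / real (card (Y n))) \<UU>"
    using ev
  proof eventually_elim
    case (elim n)
    then have "{y \<in> Y n. P (pattern n y)} = Y n" by blast
    then show ?case using finite_Y[of n] nonempty_Y[of n] by simp
  qed
  then have "((\<lambda>n. real (card {y \<in> Y n. P (pattern n y)}) / real (card (Y n))) \<longlongrightarrow> 1) \<UU>"
    by (rule tendsto_eventually[OF eventually_mono]) simp
  with limit_measure_tendsto[OF P] have "measure limit_measure {x. P (bits x)} = 1"
    using U_not_bot tendsto_unique by blast
  then have "AE x in limit_measure. x \<in> {x. P (bits x)}"
    using finitary_measurable[OF P] by (simp add: limit.prob_eq_1)
  then show ?thesis by simp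
qed

section \<open>Cylinder sets and invariance of the limit measure\<close>

definition cylinders :: "real set set" where
  "cylinders = (\<lambda>P. {x. P (bits x)}) ` Collect (finitary (carrier G))"

lemma algebra_cylinders: "algebra UNIV cylinders"
  unfolding algebra_iff_Int
proof (intro conjI ballI)
  have "finitary (carrier G) (\<lambda>v. False)" by (rule finitary_const)
  then show "{} \<in> cylinders" unfolding cylinders_def by (rule_tac image_eqI) auto
  fix A assume "A \<in> cylinders"
  then obtain P where P: "finitary (carrier G) P" "A = {x. P (bits x)}"
    unfolding cylinders_def by blast
  have "UNIV - A = {x. \<not> P (bits x)}" using P(2) by blast
  with finitary_not[OF P(1)] show "UNIV - A \<in> cylinders"
    unfolding cylinders_def by (rule_tac image_eqI) auto
  fix B assume "B \<in> cylinders"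
  then obtain Q where Q: "finitary (carrier G) Q" "B = {x. Q (bits x)}"
    unfolding cylinders_def by blast
  have "A \<inter> B = {x. P (bits x) \<and> Q (bits x)}" using P(2) Q(2) by blast
  with finitary_conj[OF P(1) Q(1)] show "A \<inter> B \<in> cylinders"
    unfolding cylinders_def by (rule_tac image_eqI) auto
qed simp

lemma sets_limit_cylinders: "sets limit_measure = sigma_sets UNIV cylinders"
proof (rule antisym)
  have cyl: "cylinders \<subseteq> sets limit_measure"
    unfolding cylinders_def using finitary_measurable by blast
  show "sigma_sets UNIV cylinders \<subseteq> sets limit_measure"
    using sets.sigma_sets_subset[OF cyl] by simp
  have "(\<lambda>x. x) \<in> measurable (sigma UNIV cylinders) cantor_algebra"
  proof (rule measurable_cantor_algebraI)
    fix k
    have "finitary (carrier G) (\<lambda>v. v (fst (decode k)) (snd (decode k)))"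
      using decode_carrier by (rule finitary_bit)
    then have "{x. k \<in> real_digits x} \<in> cylinders"
      unfolding cylinders_def by (rule_tac image_eqI) (auto simp: bits_def code_decode)
    then show "{x \<in> space (sigma UNIV cylinders). k \<in> real_digits x} \<in> sets (sigma UNIV cylinders)"
      by simp
  qed
  then have "sets cantor_algebra \<subseteq> sets (sigma UNIV cylinders)"
    by (auto simp: measurable_def)
  then show "sets limit_measure \<subseteq> sigma_sets UNIV cylinders" by (simp add: sets_limit)
qed

lemma limit_approximation:
  assumes "A \<in> sets limit_measure" "\<epsilon> > 0"
  obtains P where "finitary (carrier G) P" "measure limit_measure (sym_diff A {x. P (bits x)}) < \<epsilon>"
proof -
  obtain B where "B \<in> cylinders" "measure limit_measure (sym_diff A B) < \<epsilon>"
    using limit.algebra_approximation[of cylinders A \<epsilon>] assms algebra_cylinders sets_limit_cylinders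
    by auto
  then show ?thesis using that unfolding cylinders_def by blast
qed

lemma limit_action_measurable: "limit_action g \<in> measurable limit_measure limit_measure"
proof -
  have "limit_action g \<in> measurable limit_measure cantor_algebra"
  proof (rule measurable_cantor_algebraI)
    fix k
    have "{x \<in> space limit_measure. k \<in> real_digits (limit_action g x)}
        = {x. bits x (fst (decode k) \<otimes> g) (snd (decode k))}"
      by (simp add: limit_action_def real_digits_of_bits)
    also have "\<dots> \<in> sets limit_measure" by (rule bits_measurable)
    finally show "{x \<in> space limit_measure. k \<in> real_digits (limit_action g x)} \<in> sets limit_measure" .
  qed
  then show ?thesis by (simp cong: measurable_cong_sets add: sets_limit)
qed

lemma finitary_limit_action:
  assumes P: "finitary (carrier G) P"
  shows "P (bits (limit_action g x)) = P (\<lambda>h j. bits x (h \<otimes> g) j)"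
proof -
  obtain J where J: "finite J" "J \<subseteq> carrier G \<times> UNIV"
    "\<forall>v w. (\<forall>(h, j)\<in>J. v h j = w h j) \<longrightarrow> P v = P w"
    by (rule finitaryE[OF P])
  show ?thesis
    by (rule J(3)[rule_format]) (use J(2) in \<open>auto simp: bits_limit_action\<close>)
qed

lemma finitary_pattern_action:
  assumes P: "finitary (carrier G) P" and y: "y \<in> Y n" and g: "g \<in> carrier G"
  shows "P (pattern n (\<psi> n g y)) = P (\<lambda>h j. pattern n y (h \<otimes> g) j)"
proof -
  interpret A: group_action G "Y n" "\<psi> n" by (rule action)
  obtain J where J: "finite J" "J \<subseteq> carrier G \<times> UNIV"
    "\<forall>v w. (\<forall>(h, j)\<in>J. v h j = w h j) \<longrightarrow> P v = P w"
    by (rule finitaryE[OF P])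
  show ?thesis
    by (rule J(3)[rule_format]) (use J(2) y g in \<open>auto simp: pattern_def A.composition_rule\<close>)
qed

lemma card_translate:
  assumes g: "g \<in> carrier G"
  shows "card {y \<in> Y n. Q (\<psi> n g y)} = card {y \<in> Y n. Q y}"
proof -
  interpret A: group_action G "Y n" "\<psi> n" by (rule action)
  have "\<psi> n g ` {y \<in> Y n. Q (\<psi> n g y)} = {y \<in> Y n. Q y}"
  proof (intro equalityI subsetI)
    fix y assume y: "y \<in> {y \<in> Y n. Q y}"
    then have "\<psi> n (inv g) y \<in> {y \<in> Y n. Q (\<psi> n g y)}"
      using g A.element_image[of "inv g" y] by (simp add: A.inv_action)
    moreover have "y = \<psi> n g (\<psi> n (inv g) y)" using y g by (simp add: A.inv_action)
    ultimately show "y \<in> \<psi> n g ` {y \<in> Y n. Q (\<psi> n g y)}" by blast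
  qed (use g A.element_image in auto)
  moreover have "inj_on (\<psi> n g) {y \<in> Y n. Q (\<psi> n g y)}"
    using A.inj_prop[OF g] by (rule inj_on_subset) blast
  ultimately show ?thesis by (metis card_image)
qed

lemma pmp_limit: "pmp_action G limit_measure limit_action"
  unfolding pmp_action_def
proof (intro conjI ballI)
  show "group_action G (space limit_measure) limit_action"
    using group_action_limit by simp
  fix g assume g: "g \<in> carrier G"
  show "limit_action g \<in> measurable limit_measure limit_measure" by (rule limit_action_measurable)
  let ?D = "distr limit_measure limit_measure (limit_action g)"
  show "?D = limit_measure"
  proof (rule measure_eqI_generator_eq[where E = cylinders and \<Omega> = UNIV and A = "\<lambda>_. UNIV"])
    interpret algebra UNIV cylinders by (rule algebra_cylinders)
    show "Int_stable cylinders" unfolding Int_stable_def by blast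
    show "range (\<lambda>_. UNIV) \<subseteq> cylinders" using top by blast
    show "sets ?D = sigma_sets UNIV cylinders" "sets limit_measure = sigma_sets UNIV cylinders"
      by (simp_all add: sets_limit_cylinders)
    show "emeasure ?D UNIV \<noteq> \<infinity>" for i :: nat
      using prob_space.emeasure_space_1[OF limit.prob_space_distr[OF limit_action_measurable]]
      by simp
    fix A assume "A \<in> cylinders"
    then obtain P where P: "finitary (carrier G) P" "A = {x. P (bits x)}"
      unfolding cylinders_def by blast
    have eq: "P (bits (limit_action g x)) = P (\<lambda>h j. bits x (h \<otimes> g) j)" for x
      by (rule finitary_limit_action[OF P(1)])
    \<comment> \<open>Invariance holds exactly at each finite stage, because
      \<open>\<psi> n g\<close> permutes \<open>Y n\<close>; only equalities of counts are passed to
      the limit.\<close>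
    have "card {y \<in> Y n. P (\<lambda>h j. pattern n y (h \<otimes> g) j)} = card {y \<in> Y n. P (pattern n y)}" for n
      using card_translate[OF g, of n "\<lambda>y. P (pattern n y)"] finitary_pattern_action[OF P(1) _ g]
      by (simp cong: conj_cong)
    with limit_measure_tendsto[OF finitary_translate[OF P(1) g]]
    have "((\<lambda>n. real (card {y \<in> Y n. P (pattern n y)}) / real (card (Y n)))
            \<longlongrightarrow> measure limit_measure {x. P (\<lambda>h j. bits x (h \<otimes> g) j)}) \<UU>" by simp
    with limit_measure_tendsto[OF P(1)]
    have "measure limit_measure {x. P (\<lambda>h j. bits x (h \<otimes> g) j)} = measure limit_measure {x. P (bits x)}"
      using U_not_bot tendsto_unique by blast
    then show "emeasure ?D A = emeasure limit_measure A"
      using finitary_measurable[OF P(1)] limit_action_measurable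
      by (subst emeasure_distr) (simp_all add: P(2) limit.emeasure_eq_measure vimage_def eq)
  qed auto
qed

end

section \<open>Generators of action groupoids\<close>

text \<open>The vertices are group elements and not points of the orbit: a graph that is merely
  connected on the orbit need not generate the stabilizers.\<close>

definition arrow_graph ::
    "('a, 'b) monoid_scheme \<Rightarrow> ('a \<Rightarrow> 'y \<Rightarrow> 'y) \<Rightarrow> ('a \<times> 'y) set \<Rightarrow> 'y \<Rightarrow> ('a \<times> 'a) set" where
  "arrow_graph G \<phi> E y =
     {(h, \<gamma> \<otimes>\<^bsub>G\<^esub> h) |h \<gamma>. h \<in> carrier G \<and> \<gamma> \<in> carrier G \<and> (\<gamma>, \<phi> h y) \<in> E}"

definition arrow_connected ::
    "('a, 'b) monoid_scheme \<Rightarrow> ('a \<Rightarrow> 'y \<Rightarrow> 'y) \<Rightarrow> ('a \<times> 'y) set \<Rightarrow> 'y \<Rightarrow> ('a \<times> 'a) set" where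
  "arrow_connected G \<phi> E y = (arrow_graph G \<phi> E y \<union> (arrow_graph G \<phi> E y)\<inverse>)\<^sup>*"

text \<open>An arrow \<open>(\<gamma>, y)\<close> goes from \<open>y\<close> to \<open>\<gamma> y\<close> in the action groupoid. A set of arrows generates the
  groupoid iff, for every \<open>y\<close>, its preimage under \<open>h \<mapsto> h y\<close> is a connected graph on \<open>G\<close>.\<close>

definition generates_groupoid ::
    "('a, 'b) monoid_scheme \<Rightarrow> 'y set \<Rightarrow> ('a \<Rightarrow> 'y \<Rightarrow> 'y) \<Rightarrow> ('a \<times> 'y) set \<Rightarrow> bool" where
  "generates_groupoid G Y \<phi> E \<longleftrightarrow>
     (\<forall>y\<in>Y. \<forall>g\<in>carrier G. (\<one>\<^bsub>G\<^esub>, g) \<in> arrow_connected G \<phi> E y)"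

lemma arrow_connected_sym: "(a, b) \<in> arrow_connected G \<phi> E y \<Longrightarrow> (b, a) \<in> arrow_connected G \<phi> E y"
proof -
  have "sym (arrow_connected G \<phi> E y)"
    unfolding arrow_connected_def by (intro sym_rtrancl sym_Un_converse)
  then show "(a, b) \<in> arrow_connected G \<phi> E y \<Longrightarrow> (b, a) \<in> arrow_connected G \<phi> E y"
    by (rule symD)
qed

lemma arrow_connected_refl: "(a, a) \<in> arrow_connected G \<phi> E y"
  unfolding arrow_connected_def by (rule rtrancl_refl)

lemma arrow_connected_trans:
  "(a, b) \<in> arrow_connected G \<phi> E y \<Longrightarrow> (b, d) \<in> arrow_connected G \<phi> E y \<Longrightarrow>
     (a, d) \<in> arrow_connected G \<phi> E y"
  unfolding arrow_connected_def by (rule rtrancl_trans)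

lemma arrow_connected_edge:
  "h \<in> carrier G \<Longrightarrow> \<gamma> \<in> carrier G \<Longrightarrow> (\<gamma>, \<phi> h y) \<in> E \<Longrightarrow>
     (h, \<gamma> \<otimes>\<^bsub>G\<^esub> h) \<in> arrow_connected G \<phi> E y"
  unfolding arrow_connected_def arrow_graph_def by (intro r_into_rtrancl UnI1) blast

lemma rtrancl_exit:
  assumes "(a, b) \<in> r\<^sup>*" "P a" "\<not> P b"
  obtains u v where "(a, u) \<in> r\<^sup>*" "(u, v) \<in> r" "P u" "\<not> P v"
proof -
  have "\<exists>u v. (a, u) \<in> r\<^sup>* \<and> (u, v) \<in> r \<and> P u \<and> \<not> P v"
    using assms by (induction rule: rtrancl_induct) blast+
  then show ?thesis using that by blast
qed

lemma (in group) inv_cancel: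
  assumes "a \<in> carrier G" "b \<in> carrier G"
  shows "a \<otimes> (inv a \<otimes> b) = b" "inv a \<otimes> (a \<otimes> b) = b"
  using assms by (simp_all flip: m_assoc)

context group_action
begin

lemma is_group_G: "group G"
  using group_hom group_hom.axioms(1) by blast

text \<open>Since \<open>\<phi> u (\<phi> k y) = \<phi> (u \<otimes> k) y\<close>, right
  multiplication by \<open>k\<close> carries the graph over \<open>\<phi> k y\<close> into the graph
  over \<open>y\<close>.\<close>

lemma arrow_connected_translate:
  assumes "(a, b) \<in> arrow_connected G \<phi> A (\<phi> k y)" "k \<in> carrier G" "y \<in> E"
  shows "(a \<otimes> k, b \<otimes> k) \<in> arrow_connected G \<phi> A y"
proof -
  interpret group G by (rule is_group_G)
  have edge: "(u \<otimes> k, v \<otimes> k) \<in> arrow_connected G \<phi> A y" if "(u, v) \<in> arrow_graph G \<phi> A (\<phi> k y)" for u v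
  proof -
    from that obtain \<gamma> where g: "u \<in> carrier G" "\<gamma> \<in> carrier G" "v = \<gamma> \<otimes> u" "(\<gamma>, \<phi> u (\<phi> k y)) \<in> A"
      unfolding arrow_graph_def by blast
    then have "(\<gamma>, \<phi> (u \<otimes> k) y) \<in> A" using assms by (simp add: composition_rule)
    with g assms have "(u \<otimes> k, \<gamma> \<otimes> (u \<otimes> k)) \<in> arrow_connected G \<phi> A y"
      by (intro arrow_connected_edge) auto
    with g assms show ?thesis by (simp add: m_assoc)
  qed
  from assms(1) show ?thesis
    unfolding arrow_connected_def[of G \<phi> A "\<phi> k y"]
  proof (induction rule: rtrancl_induct)
    case base
    show ?case by (rule arrow_connected_refl)
  next
    case (step u v)
    have "(u \<otimes> k, v \<otimes> k) \<in> arrow_connected G \<phi> A y"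
    proof (cases "(u, v) \<in> arrow_graph G \<phi> A (\<phi> k y)")
      case False
      with step.hyps(2) have "(v, u) \<in> arrow_graph G \<phi> A (\<phi> k y)" by blast
      then show ?thesis by (intro arrow_connected_sym[OF edge])
    qed (rule edge)
    with step.IH show ?case by (rule arrow_connected_trans)
  qed
qed

text \<open>A word in \<open>S\<close> is followed letter by letter. Each letter acts at the point
  reached by the letters to its right, which is why the hypothesis is made at all points;
  translation brings the path back over \<open>y\<close>.\<close>

lemma generates_groupoidI:
  assumes S: "S \<subseteq> carrier G" "generate G S = carrier G"
    and conn: "\<And>y s. y \<in> E \<Longrightarrow> s \<in> S \<Longrightarrow> (\<one>, s) \<in> arrow_connected G \<phi> A y"
  shows "generates_groupoid G E \<phi> A"
proof -
  interpret group G by (rule is_group_G)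
  have "(\<one>, g) \<in> arrow_connected G \<phi> A y" if "g \<in> generate G S" "y \<in> E" for g y
    using that
  proof (induction arbitrary: y rule: generate.induct)
    case one
    show ?case by (rule arrow_connected_refl)
  next
    case (incl h)
    then show ?case by (simp add: conn)
  next
    case (inv h)
    then have h: "h \<in> carrier G" using S by blast
    then have "\<phi> (inv h) y \<in> E" using inv.prems element_image by blast
    then have "(\<one>, h) \<in> arrow_connected G \<phi> A (\<phi> (inv h) y)" using inv conn by blast
    from arrow_connected_translate[OF this _ inv.prems] h
    have "(inv h, \<one>) \<in> arrow_connected G \<phi> A y" by simp
    then show ?case by (rule arrow_connected_sym)
  next
    case (eng h1 h2)
    then have h: "h1 \<in> carrier G" "h2 \<in> carrier G" using S by blast+
    then have "\<phi> h2 y \<in> E" using eng.prems element_image by blast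
    then have "(\<one>, h1) \<in> arrow_connected G \<phi> A (\<phi> h2 y)" using eng.IH by blast
    from arrow_connected_translate[OF this _ eng.prems] h
    have "(h2, h1 \<otimes> h2) \<in> arrow_connected G \<phi> A y" by simp
    with eng.IH(2)[OF eng.prems] show ?case by (rule arrow_connected_trans)
  qed
  then show ?thesis unfolding generates_groupoid_def using S by blast
qed

lemma orbit_subset: "y \<in> E \<Longrightarrow> orbit G \<phi> y \<subseteq> E"
  unfolding orbit_def using element_image by blast

lemma orbit_eqI:
  assumes "y \<in> E" "g \<in> carrier G"
  shows "orbit G \<phi> (\<phi> g y) = orbit G \<phi> y"
proof -
  interpret group G by (rule is_group_G)
  show ?thesis
  proof (intro equalityI subsetI)
    fix z assume "z \<in> orbit G \<phi> (\<phi> g y)"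
    then obtain h where "h \<in> carrier G" "z = \<phi> h (\<phi> g y)" unfolding orbit_def by blast
    then have "h \<otimes> g \<in> carrier G" "z = \<phi> (h \<otimes> g) y"
      using assms by (simp_all add: composition_rule)
    then show "z \<in> orbit G \<phi> y" unfolding orbit_def by blast
  next
    fix z assume "z \<in> orbit G \<phi> y"
    then obtain h where h: "h \<in> carrier G" "z = \<phi> h y" unfolding orbit_def by blast
    have "\<phi> (h \<otimes> inv g) (\<phi> g y) = \<phi> h (\<phi> (inv g) (\<phi> g y))"
      using h(1) assms element_image[OF assms(2,1)] by (intro composition_rule) auto
    also have "\<dots> = z" using h(2) inv_action(1)[OF assms(2,1)] by simp
    finally show "z \<in> orbit G \<phi> (\<phi> g y)"
      using h(1) assms(2) unfolding orbit_def by blast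
  qed
qed

text \<open>A spanning forest of the graph formed by the arrows: \<open>W\<close> is the set of vertices reached so
  far, \<open>F\<close> the set of arrows used and \<open>t y\<close> the product of the arrows on the path from the root of
  \<open>y\<close> to \<open>y\<close>. Contracting it leaves one generator of the stabilizer for each unused arrow.\<close>

lemma spanning_forest:
  assumes fin: "finite E" and A: "finite A" "A \<subseteq> carrier G \<times> E" and gen: "generates_groupoid G E \<phi> A"
    and root: "\<And>y. y \<in> E \<Longrightarrow> \<rho> y \<in> orbit G \<phi> y" "\<And>g y. g \<in> carrier G \<Longrightarrow> y \<in> E \<Longrightarrow> \<rho> (\<phi> g y) = \<rho> y"
  obtains t F where "\<And>y. y \<in> E \<Longrightarrow> t y \<in> carrier G" "\<And>y. y \<in> E \<Longrightarrow> t (\<rho> y) = \<one>"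
    "\<And>y. y \<in> E \<Longrightarrow> \<phi> (t y) (\<rho> y) = y" "F \<subseteq> A" "card F + card (\<rho> ` E) = card E"
    "\<And>\<gamma> y. (\<gamma>, y) \<in> F \<Longrightarrow> t (\<phi> \<gamma> y) = \<gamma> \<otimes> t y"
proof -
  interpret group G by (rule is_group_G)
  define forest where "forest W t F \<longleftrightarrow> \<rho> ` E \<subseteq> W \<and> W \<subseteq> E \<and> (\<forall>y. t y \<in> carrier G) \<and>
      (\<forall>y\<in>E. t (\<rho> y) = \<one>) \<and> (\<forall>y\<in>W. \<phi> (t y) (\<rho> y) = y) \<and> F \<subseteq> A \<and>
      card F + card (\<rho> ` E) = card W \<and>
      (\<forall>(\<gamma>, y)\<in>F. y \<in> W \<and> \<phi> \<gamma> y \<in> W \<and> t (\<phi> \<gamma> y) = \<gamma> \<otimes> t y)" for W t F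
  have \<rho>E: "\<rho> y \<in> E" if "y \<in> E" for y using root(1) orbit_subset that by blast
  have \<rho>\<rho>: "\<rho> (\<rho> y) = \<rho> y" if y: "y \<in> E" for y
  proof -
    obtain g where "g \<in> carrier G" "\<rho> y = \<phi> g y" using root(1)[OF y] unfolding orbit_def by blast
    then show ?thesis using root(2)[OF _ y] by metis
  qed
  have "forest (\<rho> ` E) (\<lambda>_. \<one>) {}"
    unfolding forest_def using \<rho>E \<rho>\<rho> by (auto simp: one_action)
  then have ex: "\<exists>t F. forest (\<rho> ` E) t F" by blast
  have bound: "\<forall>W. (\<exists>t F. forest W t F) \<longrightarrow> card W < Suc (card E)"
  proof (intro allI impI)
    fix W assume "\<exists>t F. forest W t F"
    then have "W \<subseteq> E" unfolding forest_def by (elim exE conjE)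
    then show "card W < Suc (card E)" using card_mono[OF fin] by (simp add: less_Suc_eq_le)
  qed
  \<comment> \<open>The number of vertices reached is bounded, so a largest forest exists; it turns
    out to be spanning.\<close>
  have "\<exists>W. (\<exists>t F. forest W t F) \<and> (\<forall>W'. (\<exists>t F. forest W' t F) \<longrightarrow> card W' \<le> card W)"
    by (rule Lattices_Big.ex_has_greatest_nat[of "\<lambda>W. \<exists>t F. forest W t F", OF ex bound])
  then obtain W where "\<exists>t F. forest W t F"
    and max: "\<And>W'. (\<exists>t F. forest W' t F) \<Longrightarrow> card W' \<le> card W" by blast
  then obtain t F where f: "forest W t F" by blast
  then have W: "\<rho> ` E \<subseteq> W" "W \<subseteq> E" and t: "\<And>y. t y \<in> carrier G" "\<And>y. y \<in> E \<Longrightarrow> t (\<rho> y) = \<one>"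
    "\<And>y. y \<in> W \<Longrightarrow> \<phi> (t y) (\<rho> y) = y"
    and F: "F \<subseteq> A" "card F + card (\<rho> ` E) = card W"
    "\<And>\<gamma> y. (\<gamma>, y) \<in> F \<Longrightarrow> y \<in> W \<and> \<phi> \<gamma> y \<in> W \<and> t (\<phi> \<gamma> y) = \<gamma> \<otimes> t y"
    unfolding forest_def by auto
  have finW: "finite W" and finF: "finite F" using W(2) fin F(1) A(1) finite_subset by blast+
  \<comment> \<open>An arrow with one end outside \<open>W\<close> would enlarge the forest. The
    value \<open>s\<close> at the new vertex \<open>z\<close> is dictated by the arrow: it
    multiplies by \<open>\<gamma>\<close> or by \<open>inv \<gamma>\<close>, depending on the
    direction.\<close>
  have extend: False
    if z: "z \<in> E" "z \<notin> W" and s: "s \<in> carrier G" "\<phi> s (\<rho> z) = z" and e: "(\<gamma>, y) \<in> A"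
      and y: "y \<in> insert z W" "\<phi> \<gamma> y \<in> insert z W" "z = y \<or> z = \<phi> \<gamma> y"
      and ts: "(t(z := s)) (\<phi> \<gamma> y) = \<gamma> \<otimes> (t(z := s)) y" for z s \<gamma> y
  proof -
    have "forest (insert z W) (t(z := s)) (insert (\<gamma>, y) F)"
      unfolding forest_def
    proof (intro conjI)
      show "\<forall>y\<in>E. (t(z := s)) (\<rho> y) = \<one>" using t(2) W(1) z(2) by auto
      have "(\<gamma>, y) \<notin> F" using F(3) y(3) z(2) by blast
      then show "card (insert (\<gamma>, y) F) + card (\<rho> ` E) = card (insert z W)"
        using F(2) finF finW z(2) by simp
      show "\<forall>(\<gamma>', y')\<in>insert (\<gamma>, y) F. y' \<in> insert z W \<and> \<phi> \<gamma>' y' \<in> insert z W \<and>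
          (t(z := s)) (\<phi> \<gamma>' y') = \<gamma>' \<otimes> (t(z := s)) y'"
      proof clarify
        fix \<gamma>' y' assume "(\<gamma>', y') \<in> insert (\<gamma>, y) F"
        then consider "\<gamma>' = \<gamma>" "y' = y" | "(\<gamma>', y') \<in> F" by blast
        then show "y' \<in> insert z W \<and> \<phi> \<gamma>' y' \<in> insert z W \<and>
          (t(z := s)) (\<phi> \<gamma>' y') = \<gamma>' \<otimes> (t(z := s)) y'"
        proof cases
          case 1
          then show ?thesis using y ts by blast
        next
          case 2
          from F(3)[OF this] z(2) show ?thesis by auto
        qed
      qed
    qed (use W z t s e F(1) in auto)
    then have "card (insert z W) \<le> card W" using max by blast
    then show False using finW z(2) by simp
  qed
  have "W = E"
  proof (rule ccontr)
    assume "W \<noteq> E"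
    then obtain y where y: "y \<in> E" "y \<notin> W" using W(2) by blast
    let ?r = "\<rho> y"
    have r: "?r \<in> E" "\<phi> \<one> ?r \<in> W" using \<rho>E[OF y(1)] W(1) y(1) by (auto simp: one_action)
    have "y \<in> orbit G \<phi> ?r" using orbit_sym[OF y(1) r(1)] root(1)[OF y(1)] by blast
    then obtain g where g: "g \<in> carrier G" "y = \<phi> g ?r" unfolding orbit_def by blast
    \<comment> \<open>This path in the group projects to a path of points from the root to
      \<open>y\<close>, which must leave \<open>W\<close> along some arrow.\<close>
    have "(\<one>, g) \<in> (arrow_graph G \<phi> A ?r \<union> (arrow_graph G \<phi> A ?r)\<inverse>)\<^sup>*"
      using gen g(1) r(1) unfolding generates_groupoid_def arrow_connected_def by blast
    moreover have "\<phi> g ?r \<notin> W" using y(2) g(2) by simp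
    ultimately obtain a b where ab: "(a, b) \<in> arrow_graph G \<phi> A ?r \<union> (arrow_graph G \<phi> A ?r)\<inverse>"
      "\<phi> a ?r \<in> W" "\<phi> b ?r \<notin> W"
      using r(2) rtrancl_exit[where P = "\<lambda>u. \<phi> u ?r \<in> W"] by metis
    have root_eq: "\<rho> (\<phi> u ?r) = ?r" if "u \<in> carrier G" for u
      using root(2)[OF that r(1)] \<rho>\<rho>[OF y(1)] by simp
    from ab(1) show False
    proof
      assume "(a, b) \<in> arrow_graph G \<phi> A ?r"
      then obtain \<gamma> where e: "a \<in> carrier G" "\<gamma> \<in> carrier G" "b = \<gamma> \<otimes> a" "(\<gamma>, \<phi> a ?r) \<in> A"
        unfolding arrow_graph_def by blast
      have b: "\<phi> b ?r = \<phi> \<gamma> (\<phi> a ?r)" "b \<in> carrier G" using e r(1) by (auto simp: composition_rule)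
      show False
      proof (rule extend[of "\<phi> b ?r" "\<gamma> \<otimes> t (\<phi> a ?r)" \<gamma> "\<phi> a ?r"])
        show "\<phi> b ?r \<in> E" using b(2) r(1) element_image by blast
        have "\<phi> (t (\<phi> a ?r)) ?r = \<phi> a ?r" using t(3)[OF ab(2)] root_eq[OF e(1)] by simp
        then show "\<phi> (\<gamma> \<otimes> t (\<phi> a ?r)) (\<rho> (\<phi> b ?r)) = \<phi> b ?r"
          using composition_rule[OF r(1) e(2) t(1)] root_eq[OF b(2)] by (simp add: b(1))
        show "(t(\<phi> b ?r := \<gamma> \<otimes> t (\<phi> a ?r))) (\<phi> \<gamma> (\<phi> a ?r))
            = \<gamma> \<otimes> (t(\<phi> b ?r := \<gamma> \<otimes> t (\<phi> a ?r))) (\<phi> a ?r)"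
          using b(1) ab by auto
      qed (use ab e t(1) b in auto)
    next
      assume "(a, b) \<in> (arrow_graph G \<phi> A ?r)\<inverse>"
      then obtain \<gamma> where e: "b \<in> carrier G" "\<gamma> \<in> carrier G" "a = \<gamma> \<otimes> b" "(\<gamma>, \<phi> b ?r) \<in> A"
        unfolding arrow_graph_def by blast
      have a: "\<phi> a ?r = \<phi> \<gamma> (\<phi> b ?r)" "a \<in> carrier G" using e r(1) by (auto simp: composition_rule)
      have bE: "\<phi> b ?r \<in> E" using e(1) r(1) element_image by blast
      show False
      proof (rule extend[of "\<phi> b ?r" "inv \<gamma> \<otimes> t (\<phi> a ?r)" \<gamma> "\<phi> b ?r"])
        show "\<phi> b ?r \<in> E" by (rule bE)
        have "\<phi> (t (\<phi> a ?r)) ?r = \<phi> a ?r" using t(3)[OF ab(2)] root_eq[OF a(2)] by simp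
        then have "\<phi> (inv \<gamma> \<otimes> t (\<phi> a ?r)) ?r = \<phi> (inv \<gamma>) (\<phi> \<gamma> (\<phi> b ?r))"
          using r(1) e t(1) a by (simp add: composition_rule)
        then show "\<phi> (inv \<gamma> \<otimes> t (\<phi> a ?r)) (\<rho> (\<phi> b ?r)) = \<phi> b ?r"
          using e bE by (simp add: inv_action root_eq)
        have "\<gamma> \<otimes> (inv \<gamma> \<otimes> t (\<phi> a ?r)) = t (\<phi> a ?r)"
          using e(2) t(1) by (simp flip: m_assoc)
        then show "(t(\<phi> b ?r := inv \<gamma> \<otimes> t (\<phi> a ?r))) (\<phi> \<gamma> (\<phi> b ?r))
            = \<gamma> \<otimes> (t(\<phi> b ?r := inv \<gamma> \<otimes> t (\<phi> a ?r))) (\<phi> b ?r)"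
          using a(1) ab by auto
      qed (use ab e t(1) a in auto)
    qed
  qed
  with t F show ?thesis by (intro that[of t F]) auto
qed

text \<open>These are Schreier generators, one for each arrow outside the forest in the orbit of
  \<open>y0\<close>. The forest has as many arrows as there are points minus orbits, which gives the
  count.\<close>

theorem stabilizer_generators:
  assumes fin: "finite E" and A: "finite A" "A \<subseteq> carrier G \<times> E" and gen: "generates_groupoid G E \<phi> A"
    and y0: "y0 \<in> E"
  obtains T where "finite T" "T \<subseteq> stabilizer G \<phi> y0" "generate G T = stabilizer G \<phi> y0"
    "card T + card E \<le> card A + card (orbits G E \<phi>)"
proof -
  interpret group G by (rule is_group_G)
  \<comment> \<open>A root is chosen from the orbit as a set and is therefore constant along it. The
    special case makes \<open>y0\<close> a root, so that \<open>t y0 = \<one>\<close>.\<close>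
  define r where "r X = (if y0 \<in> X then y0 else (SOME y. y \<in> X))" for X
  define \<rho> where "\<rho> y = r (orbit G \<phi> y)" for y
  have \<rho>1: "\<rho> y \<in> orbit G \<phi> y" if "y \<in> E" for y
    unfolding \<rho>_def r_def using someI[of "\<lambda>z. z \<in> orbit G \<phi> y", OF orbit_refl[OF that]] by simp
  have \<rho>2: "\<rho> (\<phi> g y) = \<rho> y" if "g \<in> carrier G" "y \<in> E" for g y
    unfolding \<rho>_def by (simp add: orbit_eqI that)
  have \<rho>0: "\<rho> y = y0" if y: "y \<in> orbit G \<phi> y0" for y
  proof -
    obtain g where "g \<in> carrier G" "y = \<phi> g y0" using y unfolding orbit_def by blast
    then have "orbit G \<phi> y = orbit G \<phi> y0" using orbit_eqI y0 by blast
    then show ?thesis unfolding \<rho>_def r_def using orbit_refl[OF y0] by simp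
  qed
  obtain t F where t: "\<And>y. y \<in> E \<Longrightarrow> t y \<in> carrier G" "\<And>y. y \<in> E \<Longrightarrow> t (\<rho> y) = \<one>"
    "\<And>y. y \<in> E \<Longrightarrow> \<phi> (t y) (\<rho> y) = y" and F: "F \<subseteq> A" "card F + card (\<rho> ` E) = card E"
    "\<And>\<gamma> y. (\<gamma>, y) \<in> F \<Longrightarrow> t (\<phi> \<gamma> y) = \<gamma> \<otimes> t y"
    using spanning_forest[OF fin A gen \<rho>1 \<rho>2] by metis
  have ty0: "t y0 = \<one>" using t(2)[OF y0] \<rho>0[OF orbit_refl[OF y0]] by simp
  have orbE: "y \<in> E" if "y \<in> orbit G \<phi> y0" for y using that orbit_subset y0 by blast
  define e where "e = (\<lambda>(\<gamma>, y). inv (t (\<phi> \<gamma> y)) \<otimes> \<gamma> \<otimes> t y)"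
  define T where "T = e ` {(\<gamma>, y) \<in> A - F. y \<in> orbit G \<phi> y0}"
  have finT: "finite T" unfolding T_def using A(1) by (intro finite_imageI finite_subset[OF _ A(1)]) auto
  have "card T \<le> card {(\<gamma>, y) \<in> A - F. y \<in> orbit G \<phi> y0}"
    unfolding T_def by (rule card_image_le) (rule finite_subset[OF _ A(1)], auto)
  also have "\<dots> \<le> card (A - F)" by (rule card_mono) (use A(1) in auto)
  also have "\<dots> = card A - card F" using F(1) A(1) by (simp add: card_Diff_subset finite_subset)
  finally have "card T + card F \<le> card A" using card_mono[OF A(1) F(1)] by simp
  moreover have "card (\<rho> ` E) \<le> card (orbits G E \<phi>)"
  proof -
    have "\<rho> ` E = r ` orbits G E \<phi>" unfolding \<rho>_def orbits_def by auto
    moreover have "finite (orbits G E \<phi>)" unfolding orbits_def using fin by simp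
    ultimately show ?thesis by (simp add: card_image_le)
  qed
  ultimately have cT: "card T + card E \<le> card A + card (orbits G E \<phi>)" using F(2) by simp
  have e_stab: "e (\<gamma>, y) \<in> stabilizer G \<phi> y0" if "\<gamma> \<in> carrier G" "y \<in> orbit G \<phi> y0" for \<gamma> y
  proof -
    have y: "y \<in> E" using orbE that by blast
    have g: "\<phi> \<gamma> y \<in> E" using y that element_image by blast
    have "\<rho> y = y0" "\<rho> (\<phi> \<gamma> y) = y0" using \<rho>0 that \<rho>2[OF that(1) y] by auto
    then have "\<phi> (t y) y0 = y" "\<phi> (t (\<phi> \<gamma> y)) y0 = \<phi> \<gamma> y" using t(3)[OF y] t(3)[OF g] by auto
    then have "\<phi> (e (\<gamma>, y)) y0 = \<phi> (inv (t (\<phi> \<gamma> y))) (\<phi> (t (\<phi> \<gamma> y)) y0)"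
      using that y g y0 t(1) by (simp add: e_def composition_rule)
    also have "\<dots> = y0" using t(1)[OF g] y0 by (simp add: inv_action)
    finally show ?thesis using t(1)[OF y] t(1)[OF g] that by (simp add: stabilizer_def e_def)
  qed
  have stab: "subgroup (stabilizer G \<phi> y0) G" using stabilizer_subgroup y0 by blast
  have Tsub: "T \<subseteq> stabilizer G \<phi> y0" unfolding T_def using e_stab A(2) by auto
  have Tc: "T \<subseteq> carrier G" using Tsub unfolding stabilizer_def by blast
  have e_gen: "e (\<gamma>, y) \<in> generate G T" if "(\<gamma>, y) \<in> A" "y \<in> orbit G \<phi> y0" for \<gamma> y
  proof (cases "(\<gamma>, y) \<in> F")
    case True
    have y: "y \<in> E" "\<gamma> \<in> carrier G" using that A(2) by blast+
    then have "t y \<in> carrier G" by (simp add: t(1))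
    then have "e (\<gamma>, y) = \<one>" using F(3)[OF True] y by (simp add: e_def m_assoc l_inv)
    then show ?thesis by (simp add: generate.one)
  next
    case False
    then show ?thesis using that by (intro generate.incl) (auto simp: T_def)
  qed
  \<comment> \<open>Along a path from \<open>\<one>\<close> to \<open>b\<close> the elements
    \<open>e\<close> and their inverses telescope to
    \<open>inv (t (\<phi> b y0)) \<otimes> b\<close>; for \<open>b\<close> in the stabilizer this is
    \<open>b\<close> itself.\<close>
  have path: "b \<in> carrier G \<and> inv (t (\<phi> b y0)) \<otimes> b \<in> generate G T"
    if "(\<one>, b) \<in> arrow_connected G \<phi> A y0" for b
    using that unfolding arrow_connected_def
  proof (induction rule: rtrancl_induct)
    case base
    show ?case using y0 by (simp add: one_action ty0 generate.one)
  next
    case (step b b')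
    have bc: "b \<in> carrier G" and bgen: "inv (t (\<phi> b y0)) \<otimes> b \<in> generate G T" using step.IH by auto
    have tc: "t (\<phi> u y0) \<in> carrier G" if "u \<in> carrier G" for u
      using t(1) that y0 element_image by blast
    from step.hyps(2) show ?case
    proof
      assume "(b, b') \<in> arrow_graph G \<phi> A y0"
      then obtain \<gamma> where g: "\<gamma> \<in> carrier G" "b' = \<gamma> \<otimes> b" "(\<gamma>, \<phi> b y0) \<in> A"
        unfolding arrow_graph_def by blast
      have eq: "\<phi> b' y0 = \<phi> \<gamma> (\<phi> b y0)" "b' \<in> carrier G" using g bc y0 by (auto simp: composition_rule)
      have "e (\<gamma>, \<phi> b y0) \<otimes> (inv (t (\<phi> b y0)) \<otimes> b) \<in> generate G T"
        by (rule generate.eng[OF e_gen[OF g(3)] bgen]) (use bc in \<open>auto simp: orbit_def\<close>)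
      moreover have "e (\<gamma>, \<phi> b y0) \<otimes> (inv (t (\<phi> b y0)) \<otimes> b) = inv (t (\<phi> b' y0)) \<otimes> b'"
        using tc[OF bc] tc[OF eq(2)] bc g(1,2) unfolding e_def eq(1)
        by (simp add: m_assoc inv_cancel)
      ultimately show ?thesis using eq(2) by simp
    next
      assume "(b, b') \<in> (arrow_graph G \<phi> A y0)\<inverse>"
      then obtain \<gamma> where g: "\<gamma> \<in> carrier G" "b' \<in> carrier G" "b = \<gamma> \<otimes> b'" "(\<gamma>, \<phi> b' y0) \<in> A"
        unfolding arrow_graph_def by blast
      have eq: "\<phi> b y0 = \<phi> \<gamma> (\<phi> b' y0)" using g y0 by (simp add: composition_rule)
      have "inv (e (\<gamma>, \<phi> b' y0)) \<otimes> (inv (t (\<phi> b y0)) \<otimes> b) \<in> generate G T"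
        by (rule generate.eng[OF generate_m_inv_closed[OF Tc e_gen[OF g(4)]] bgen])
          (use g(2) in \<open>auto simp: orbit_def\<close>)
      moreover have "inv (e (\<gamma>, \<phi> b' y0)) \<otimes> (inv (t (\<phi> b y0)) \<otimes> b) = inv (t (\<phi> b' y0)) \<otimes> b'"
      proof -
        let ?u = "t (\<phi> b' y0)" and ?v = "t (\<phi> b y0)"
        have c: "?u \<in> carrier G" "?v \<in> carrier G" using tc bc g(2) by auto
        have "e (\<gamma>, \<phi> b' y0) \<otimes> (inv ?u \<otimes> b') = inv ?v \<otimes> b"
          using c g(1-3) unfolding e_def eq by (simp add: m_assoc inv_cancel)
        moreover have "e (\<gamma>, \<phi> b' y0) \<in> carrier G"
          using c g(1) unfolding e_def eq by simp
        ultimately show ?thesis using inv_cancel(2)[of "e (\<gamma>, \<phi> b' y0)" "inv ?u \<otimes> b'"] c g(2)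
          by simp
      qed
      ultimately show ?thesis using g(2) by simp
    qed
  qed
  have "stabilizer G \<phi> y0 \<subseteq> generate G T"
  proof
    fix g assume "g \<in> stabilizer G \<phi> y0"
    then have g: "g \<in> carrier G" "\<phi> g y0 = y0" unfolding stabilizer_def by auto
    have "(\<one>, g) \<in> arrow_connected G \<phi> A y0" using gen g(1) y0 unfolding generates_groupoid_def by blast
    from path[OF this] show "g \<in> generate G T" using g by (simp add: ty0)
  qed
  moreover have "generate G T \<subseteq> stabilizer G \<phi> y0" by (rule generate_subgroup_incl[OF Tsub stab])
  ultimately show ?thesis using that finT Tsub cT by blast
qed

text \<open>A star of \<open>card E - 1\<close> arrows from \<open>y0\<close> to the other points is
  completed by a loop at \<open>y0\<close> for each element of \<open>T\<close>. Together with
  \<open>stabilizer_generators\<close>, arrows minus points and generators minus one are exchanged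
  without loss for transitive actions.\<close>

theorem groupoid_generators:
  assumes fin: "finite E" and y0: "y0 \<in> E" and trans: "orbit G \<phi> y0 = E"
    and T: "finite T" "T \<subseteq> stabilizer G \<phi> y0" "generate G T = stabilizer G \<phi> y0"
  obtains A where "finite A" "A \<subseteq> carrier G \<times> E" "generates_groupoid G E \<phi> A"
    "card A + 1 \<le> card E + card T"
proof -
  interpret group G by (rule is_group_G)
  have "\<exists>g. g \<in> carrier G \<and> \<phi> g y0 = y" if "y \<in> E" for y
    using that trans unfolding orbit_def by blast
  then obtain t0 where t0: "\<And>y. y \<in> E \<Longrightarrow> t0 y \<in> carrier G" "\<And>y. y \<in> E \<Longrightarrow> \<phi> (t0 y) y0 = y" by metis
  define t where "t = t0(y0 := \<one>)"
  have t: "t y \<in> carrier G" "\<phi> (t y) y0 = y" if "y \<in> E" for y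
    using t0[OF that] y0 by (auto simp: t_def one_action)
  have Tc: "T \<subseteq> carrier G" using T(2) unfolding stabilizer_def by blast
  define A where "A = (\<lambda>y. (t y, y0)) ` (E - {y0}) \<union> (\<lambda>s. (s, y0)) ` T"
  have "finite A" unfolding A_def using fin T(1) by simp
  moreover have "A \<subseteq> carrier G \<times> E" unfolding A_def using t(1) y0 Tc by auto
  moreover have "card A + 1 \<le> card E + card T"
  proof -
    have "card A \<le> card ((\<lambda>y. (t y, y0)) ` (E - {y0})) + card ((\<lambda>s. (s, y0)) ` T)"
      unfolding A_def by (rule card_Un_le)
    also have "\<dots> \<le> card (E - {y0}) + card T"
      using fin T(1) by (intro add_mono card_image_le) auto
    moreover have "card E \<ge> 1" using fin y0 by (metis One_nat_def Suc_leI card_gt_0_iff empty_iff)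
    ultimately show ?thesis using fin y0 by (simp add: card_Diff_singleton)
  qed
  moreover have "generates_groupoid G E \<phi> A"
    unfolding generates_groupoid_def
  proof (intro ballI)
    fix y g assume y: "y \<in> E" and g: "g \<in> carrier G"
    have stab: "g \<in> stabilizer G \<phi> y0 \<and> (\<one>, g) \<in> arrow_connected G \<phi> A y0" if "g \<in> generate G T" for g
      using that
    proof (induction rule: generate.induct)
      case one
      show ?case using stabilizer_one_closed[OF y0] by (simp add: arrow_connected_refl)
    next
      case (incl h)
      then have "(h, \<phi> \<one> y0) \<in> A" using y0 by (simp add: A_def one_action)
      then have "(\<one>, h \<otimes> \<one>) \<in> arrow_connected G \<phi> A y0"
        using incl Tc by (intro arrow_connected_edge) auto
      then show ?case using incl Tc T(2) by auto
    next
      case (inv h)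
      have h: "h \<in> carrier G" "h \<in> stabilizer G \<phi> y0" using inv Tc T(2) by auto
      then have ih: "inv h \<in> stabilizer G \<phi> y0" using stabilizer_m_inv_closed[OF y0] by blast
      then have f: "\<phi> (inv h) y0 = y0" unfolding stabilizer_def by blast
      have "(h, \<phi> \<one> y0) \<in> A" using y0 inv by (simp add: A_def one_action)
      then have "(\<one>, h \<otimes> \<one>) \<in> arrow_connected G \<phi> A (\<phi> (inv h) y0)"
        unfolding f using h by (intro arrow_connected_edge) auto
      from arrow_connected_translate[OF this _ y0] h
      have "(inv h, \<one>) \<in> arrow_connected G \<phi> A y0" by simp
      from arrow_connected_sym[OF this] ih show ?case by (rule conjI[rotated])
    next
      case (eng h1 h2)
      then have h: "h1 \<in> carrier G" "h2 \<in> carrier G" "\<phi> h2 y0 = y0" unfolding stabilizer_def by auto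
      have "(\<one>, h1) \<in> arrow_connected G \<phi> A (\<phi> h2 y0)" unfolding h(3) using eng by blast
      from arrow_connected_translate[OF this _ y0] h
      have "(h2, h1 \<otimes> h2) \<in> arrow_connected G \<phi> A y0" by simp
      from arrow_connected_trans[OF conjunct2[OF eng.IH(2)] this]
      show ?case using stabilizer_m_closed[OF y0] eng.IH by simp
    qed
    have tree: "(\<one>, t z) \<in> arrow_connected G \<phi> A y0" if "z \<in> E" for z
    proof (cases "z = y0")
      case True
      then show ?thesis by (simp add: t_def arrow_connected_refl)
    next
      case False
      then have "(t z, \<phi> \<one> y0) \<in> A" using that y0 by (simp add: A_def one_action)
      then have "(\<one>, t z \<otimes> \<one>) \<in> arrow_connected G \<phi> A y0"
        using t(1)[OF that] by (intro arrow_connected_edge) auto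
      then show ?thesis using t(1)[OF that] by simp
    qed
    have gy: "\<phi> g y \<in> E" using g y element_image by blast
    \<comment> \<open>The arrow from \<open>y\<close> to \<open>g y\<close> is replaced by a detour:
      back to \<open>y0\<close>, around the loop \<open>s\<close>, and out to
      \<open>g y\<close>.\<close>
    define s where "s = inv (t (\<phi> g y)) \<otimes> (g \<otimes> t y)"
    have sc: "s \<in> carrier G" unfolding s_def using g t(1)[OF y] t(1)[OF gy] by simp
    have "\<phi> s y0 = \<phi> (inv (t (\<phi> g y))) (\<phi> (t (\<phi> g y)) y0)"
      unfolding s_def using g t y gy y0 by (simp add: composition_rule)
    then have fs: "\<phi> s y0 = y0" using t(1)[OF gy] y0 by (simp add: inv_action)
    then have "s \<in> generate G T" using sc T(3) by (simp add: stabilizer_def)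
    then have 1: "(\<one>, s) \<in> arrow_connected G \<phi> A y0" using stab by blast
    have "(\<one>, t (\<phi> g y)) \<in> arrow_connected G \<phi> A (\<phi> s y0)" unfolding fs by (rule tree[OF gy])
    from arrow_connected_translate[OF this sc y0]
    have "(s, t (\<phi> g y) \<otimes> s) \<in> arrow_connected G \<phi> A y0" using sc by simp
    moreover have "t (\<phi> g y) \<otimes> s = g \<otimes> t y"
      unfolding s_def using g t(1)[OF y] t(1)[OF gy] by (simp flip: m_assoc)
    ultimately have 2: "(s, g \<otimes> t y) \<in> arrow_connected G \<phi> A y0" by simp
    have "(t y, g \<otimes> t y) \<in> arrow_connected G \<phi> A y0"
      by (rule arrow_connected_trans[OF arrow_connected_sym[OF tree[OF y]] arrow_connected_trans[OF 1 2]])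
    then have "(t y, g \<otimes> t y) \<in> arrow_connected G \<phi> A (\<phi> (inv (t y)) y)"
      using t[OF y] y0 inv_action(1)[OF t(1)[OF y] y0] by simp
    from arrow_connected_translate[OF this _ y] t(1)[OF y] g
    show "(\<one>, g) \<in> arrow_connected G \<phi> A y" by (simp add: m_assoc)
  qed
  ultimately show ?thesis by (intro that[of A])
qed

end

lemma (in group) group_rank_le:
  assumes "subgroup H G" "finite S" "S \<subseteq> H" "generate G S = H"
  shows "group_rank (G\<lparr>carrier := H\<rparr>) \<le> card S"
  unfolding group_rank_def
  by (rule Least_le) (use assms generate_consistent[OF assms(3,1)] in auto)

lemma (in group) group_rank_generators:
  assumes "subgroup H G" "finite S" "S \<subseteq> H" "generate G S = H"
  obtains T where "finite T" "T \<subseteq> H" "generate G T = H" "card T = group_rank (G\<lparr>carrier := H\<rparr>)"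
proof -
  let ?P = "\<lambda>k. \<exists>S. finite S \<and> S \<subseteq> carrier (G\<lparr>carrier := H\<rparr>) \<and>
      generate (G\<lparr>carrier := H\<rparr>) S = carrier (G\<lparr>carrier := H\<rparr>) \<and> card S = k"
  have "?P (card S)" using assms generate_consistent[OF assms(3,1)] by auto
  then have "?P (group_rank (G\<lparr>carrier := H\<rparr>))" unfolding group_rank_def by (rule LeastI)
  then obtain T where "finite T" "T \<subseteq> H" "generate (G\<lparr>carrier := H\<rparr>) T = H"
    "card T = group_rank (G\<lparr>carrier := H\<rparr>)" by auto
  then show ?thesis using generate_consistent[OF _ assms(1)] by (intro that[of T]) auto
qed

section \<open>Stabilizers and orbits in the limit\<close>

text \<open>Whether two points of an orbit agree is visible in a cylinder set here, so the stabilizers and the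
  orbits of the limit action can be read off the finite actions.\<close>

locale separated_actions = coloured_actions G \<UU> Y \<psi> c
  for G :: "('a, 'b) monoid_scheme" (structure) and \<UU> and Y :: "nat \<Rightarrow> 'y set" and \<psi> c +
  fixes J :: "'a \<Rightarrow> nat set"
  assumes finite_J: "\<And>\<gamma>. finite (J \<gamma>)"
    and separated: "\<And>\<gamma> n y. \<gamma> \<in> carrier G \<Longrightarrow> y \<in> Y n \<Longrightarrow>
        (\<And>j. j \<in> J \<gamma> \<Longrightarrow> c n j (\<psi> n \<gamma> y) = c n j y) \<Longrightarrow> \<psi> n \<gamma> y = y"
begin

text \<open>A finitary substitute for \<open>limit_action \<gamma> x = x\<close>, which is a
  condition on infinitely many bits.\<close>

definition fixed :: "'a \<Rightarrow> ('a \<Rightarrow> nat \<Rightarrow> bool) \<Rightarrow> bool" where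
  "fixed \<gamma> v \<longleftrightarrow> (\<forall>j\<in>J \<gamma>. v \<gamma> j = v \<one> j)"

lemma finitary_eq_bits:
  assumes "g \<in> carrier G" "h \<in> carrier G"
  shows "finitary (carrier G) (\<lambda>v. v g j = v h j)"
  by (rule finitaryI[of "{(g, j), (h, j)}"]) (use assms in auto)

lemma finitary_agree:
  assumes "finite I" "g \<in> carrier G" "h \<in> carrier G"
  shows "finitary (carrier G) (\<lambda>v. \<forall>j\<in>I. v g j = v h j)"
  by (rule finitary_ball[OF assms(1) finitary_eq_bits[OF assms(2,3)]])

lemma finitary_fixed: "\<gamma> \<in> carrier G \<Longrightarrow> finitary (carrier G) (fixed \<gamma>)"
  unfolding fixed_def[abs_def] by (rule finitary_agree) (auto simp: finite_J)

lemma fixed_pattern: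
  assumes "\<gamma> \<in> carrier G" "y \<in> Y n"
  shows "fixed \<gamma> (pattern n y) \<longleftrightarrow> \<psi> n \<gamma> y = y"
proof -
  interpret A: group_action G "Y n" "\<psi> n" by (rule action)
  show ?thesis
    using separated[OF assms] assms by (auto simp: fixed_def pattern_def A.one_action)
qed

text \<open>In the finite actions equal colours at \<open>\<gamma> y\<close> and \<open>y\<close>
  force \<open>\<gamma> y = y\<close>, and then the colours at \<open>h \<gamma> y\<close> and
  \<open>h y\<close> agree for every \<open>h\<close>. These countably many finitary laws pass to
  the limit.\<close>

lemma stabilizer_AE:
  "AE x in limit_measure. \<forall>\<gamma>\<in>carrier G. limit_action \<gamma> x = x \<longleftrightarrow> fixed \<gamma> (bits x)"
proof -
  have "AE x in limit_measure. limit_action \<gamma> x = x \<longleftrightarrow> fixed \<gamma> (bits x)" if \<gamma>: "\<gamma> \<in> carrier G" for \<gamma>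
  proof -
    have "AE x in limit_measure. fixed \<gamma> (bits x) \<longrightarrow> bits x (h \<otimes> \<gamma>) j = bits x h j"
      if h: "h \<in> carrier G" for h j
    proof (rule limit_measure_AE)
      have "finitary (carrier G) (\<lambda>v. \<not> v (h \<otimes> \<gamma>) j = v h j)"
        using h \<gamma> by (intro finitary_not finitary_eq_bits) auto
      then have "finitary (carrier G) (\<lambda>v. \<not> (fixed \<gamma> v \<and> \<not> v (h \<otimes> \<gamma>) j = v h j))"
        by (rule finitary_not[OF finitary_conj[OF finitary_fixed[OF \<gamma>]]])
      then show "finitary (carrier G) (\<lambda>v. fixed \<gamma> v \<longrightarrow> v (h \<otimes> \<gamma>) j = v h j)" by simp
      show "eventually (\<lambda>n. \<forall>y\<in>Y n. fixed \<gamma> (pattern n y) \<longrightarrow>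
          pattern n y (h \<otimes> \<gamma>) j = pattern n y h j) \<UU>"
      proof (intro always_eventually allI ballI impI)
        fix n y assume y: "y \<in> Y n" "fixed \<gamma> (pattern n y)"
        interpret A: group_action G "Y n" "\<psi> n" by (rule action)
        show "pattern n y (h \<otimes> \<gamma>) j = pattern n y h j"
          using y fixed_pattern[OF \<gamma> y(1)] h \<gamma> by (simp add: pattern_def A.composition_rule)
      qed
    qed
    then have "AE x in limit_measure. \<forall>j. fixed \<gamma> (bits x) \<longrightarrow> bits x (h \<otimes> \<gamma>) j = bits x h j"
      if "h \<in> carrier G" for h using that unfolding AE_all_countable by blast
    then have "AE x in limit_measure. \<forall>h\<in>carrier G. \<forall>j. fixed \<gamma> (bits x) \<longrightarrow>
        bits x (h \<otimes> \<gamma>) j = bits x h j"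
      by (rule AE_ball_countable[OF countable_carrier, THEN iffD2, OF ballI])
    then show ?thesis
    proof (rule AE_mp, intro AE_I2 impI)
      fix x assume x: "\<forall>h\<in>carrier G. \<forall>j. fixed \<gamma> (bits x) \<longrightarrow> bits x (h \<otimes> \<gamma>) j = bits x h j"
      show "limit_action \<gamma> x = x \<longleftrightarrow> fixed \<gamma> (bits x)"
      proof
        assume "limit_action \<gamma> x = x"
        then have "bits x (\<one> \<otimes> \<gamma>) j = bits x \<one> j" for j
          using bits_limit_action[of \<one> \<gamma> x j] by simp
        then show "fixed \<gamma> (bits x)" using \<gamma> by (simp add: fixed_def)
      next
        assume "fixed \<gamma> (bits x)"
        then show "limit_action \<gamma> x = x"
          using x by (intro bits_eqI) (simp add: bits_limit_action)
      qed
    qed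
  qed
  then show ?thesis using countable_carrier by (simp add: AE_ball_countable)
qed

lemma fixed_tendsto:
  assumes \<gamma>: "\<gamma> \<in> carrier G"
  shows "((\<lambda>n. real (card {y \<in> Y n. \<psi> n \<gamma> y = y}) / real (card (Y n)))
            \<longlongrightarrow> measure limit_measure {x. fixed \<gamma> (bits x)}) \<UU>"
  using limit_measure_tendsto[OF finitary_fixed[OF \<gamma>]] by (simp add: fixed_pattern[OF \<gamma>] cong: conj_cong)

text \<open>Used in both directions: from left to right to draw conclusions from the Stuck-Zimmer
  dichotomy, from right to left to see that the limit action is free.\<close>

lemma fixed_AE_iff:
  assumes \<gamma>: "\<gamma> \<in> carrier G"
  shows "(AE x in limit_measure. limit_action \<gamma> x \<noteq> x) \<longleftrightarrow>
     ((\<lambda>n. real (card {y \<in> Y n. \<psi> n \<gamma> y = y}) / real (card (Y n))) \<longlongrightarrow> 0) \<UU>"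
proof -
  have "AE x in limit_measure. (limit_action \<gamma> x \<noteq> x) = (\<not> fixed \<gamma> (bits x))"
    using stabilizer_AE by eventually_elim (use \<gamma> in blast)
  then have "(AE x in limit_measure. limit_action \<gamma> x \<noteq> x) \<longleftrightarrow> (AE x in limit_measure. \<not> fixed \<gamma> (bits x))"
    by (rule eventually_cong) blast
  also have "\<dots> \<longleftrightarrow> measure limit_measure {x. fixed \<gamma> (bits x)} = 0"
    using limit.prob_eq_0[OF finitary_measurable[OF finitary_fixed[OF \<gamma>]]] by simp
  also have "\<dots> \<longleftrightarrow> ((\<lambda>n. real (card {y \<in> Y n. \<psi> n \<gamma> y = y}) / real (card (Y n))) \<longlongrightarrow> 0) \<UU>"
    (is "_ = ?lim")
  proof
    assume "measure limit_measure {x. fixed \<gamma> (bits x)} = 0"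
    then show ?lim using fixed_tendsto[OF \<gamma>] by simp
  next
    assume ?lim
    then show "measure limit_measure {x. fixed \<gamma> (bits x)} = 0"
      by (rule tendsto_unique[OF U_not_bot fixed_tendsto[OF \<gamma>]])
  qed
  finally show ?thesis .
qed

lemma essentially_free_limit:
  assumes "\<And>\<gamma>. \<gamma> \<in> carrier G \<Longrightarrow> \<gamma> \<noteq> \<one> \<Longrightarrow>
     ((\<lambda>n. real (card {y \<in> Y n. \<psi> n \<gamma> y = y}) / real (card (Y n))) \<longlongrightarrow> 0) \<UU>"
  shows "essentially_free G limit_measure limit_action"
  unfolding essentially_free_def
proof -
  have "AE x in limit_measure. \<forall>\<gamma>\<in>carrier G - {\<one>}. limit_action \<gamma> x \<noteq> x"
    using countable_carrier assms by (subst AE_ball_countable) (auto simp: fixed_AE_iff)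
  then show "AE x in limit_measure. stabilizer G limit_action x = {\<one>}"
  proof eventually_elim
    case (elim x)
    have "limit_action \<one> x = x" using group_action.one_action[OF group_action_limit] by simp
    with elim show ?case unfolding stabilizer_def by auto
  qed
qed

text \<open>That \<open>F r\<close> moves a point to \<open>r\<close> different places is a finitary
  law once different places are told apart by colours. It therefore passes to the limit for every
  \<open>r\<close>.\<close>

lemma infinite_orbits_limit:
  assumes F: "\<And>r. finite (F r)" "\<And>r. F r \<subseteq> carrier G"
    and ev: "\<And>r. eventually (\<lambda>n. \<forall>y\<in>Y n. card ((\<lambda>g. \<psi> n g y) ` F r) \<ge> r) \<UU>"
  shows "AE x in limit_measure. infinite (orbit G limit_action x)"
proof -
  \<comment> \<open>With \<open>\<gamma> = g \<otimes> inv h\<close>, the points \<open>g y\<close>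
    and \<open>h y\<close> are \<open>\<gamma> z\<close> and \<open>z\<close> for
    \<open>z = h y\<close>, so the colours in \<open>J (g \<otimes> inv h)\<close> distinguish
    them.\<close>
  define Q where "Q r v \<longleftrightarrow>
      (\<exists>A\<in>{A \<in> Pow (F r). card A = r}. \<forall>p\<in>{p \<in> A \<times> A. fst p \<noteq> snd p}.
         \<not> (\<forall>j\<in>J (fst p \<otimes> inv (snd p)). v (fst p) j = v (snd p) j))" for r and v :: "'a \<Rightarrow> nat \<Rightarrow> bool"
  have "AE x in limit_measure. Q r (bits x)" for r
  proof (rule limit_measure_AE)
    show "finitary (carrier G) (Q r)"
      unfolding Q_def[abs_def]
    proof (rule finitary_bex)
      show "finite {A \<in> Pow (F r). card A = r}" using F(1) by simp
      fix A assume "A \<in> {A \<in> Pow (F r). card A = r}"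
      then have A: "A \<subseteq> F r" by blast
      then have "finite A" using F(1) finite_subset by blast
      show "finitary (carrier G) (\<lambda>v. \<forall>p\<in>{p \<in> A \<times> A. fst p \<noteq> snd p}.
         \<not> (\<forall>j\<in>J (fst p \<otimes> inv (snd p)). v (fst p) j = v (snd p) j))"
      proof (rule finitary_ball)
        show "finite {p \<in> A \<times> A. fst p \<noteq> snd p}" using \<open>finite A\<close> by simp
        fix p assume "p \<in> {p \<in> A \<times> A. fst p \<noteq> snd p}"
        then have "fst p \<in> carrier G" "snd p \<in> carrier G" using A F(2)[of r] by auto
        then show "finitary (carrier G) (\<lambda>v. \<not> (\<forall>j\<in>J (fst p \<otimes> inv (snd p)). v (fst p) j = v (snd p) j))"
          by (intro finitary_not finitary_agree finite_J)
      qed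
    qed
    show "eventually (\<lambda>n. \<forall>y\<in>Y n. Q r (pattern n y)) \<UU>"
      using ev[of r]
    proof eventually_elim
      case (elim n)
      interpret A: group_action G "Y n" "\<psi> n" by (rule action)
      show ?case
      proof
        fix y assume y: "y \<in> Y n"
        with elim obtain B where B: "B \<subseteq> (\<lambda>g. \<psi> n g y) ` F r" "card B = r" "finite B"
          by (meson obtain_subset_with_card_n)
        obtain A where A: "A \<subseteq> F r" "inj_on (\<lambda>g. \<psi> n g y) A" "B = (\<lambda>g. \<psi> n g y) ` A"
          using B(1) by (metis subset_image_inj)
        have "card A = r" using A(2,3) B(2) by (simp add: card_image)
        moreover have "\<not> (\<forall>j\<in>J (g \<otimes> inv h). pattern n y g j = pattern n y h j)"
          if gh: "g \<in> A" "h \<in> A" "g \<noteq> h" for g h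
        proof
          assume eq: "\<forall>j\<in>J (g \<otimes> inv h). pattern n y g j = pattern n y h j"
          have c: "g \<in> carrier G" "h \<in> carrier G" using gh A(1) F(2) by blast+
          have hy: "\<psi> n h y \<in> Y n" using A.element_image c(2) y by blast
          have gy: "\<psi> n (g \<otimes> inv h) (\<psi> n h y) = \<psi> n g y"
            using c y hy by (simp add: A.composition_rule A.inv_action)
          have "\<psi> n (g \<otimes> inv h) (\<psi> n h y) = \<psi> n h y"
            by (rule separated) (use c hy eq gy in \<open>auto simp: pattern_def\<close>)
          then show False using gy gh A(2) by (auto dest: inj_onD)
        qed
        ultimately show "Q r (pattern n y)" unfolding Q_def using A(1) by (intro bexI[of _ A]) auto
      qed
    qed
  qed
  then have "AE x in limit_measure. \<forall>r. Q r (bits x)" by (simp add: AE_all_countable)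
  then show ?thesis
  proof eventually_elim
    case (elim x)
    show ?case
    proof
      assume fin: "finite (orbit G limit_action x)"
      define r where "r = Suc (card (orbit G limit_action x))"
      obtain A where A: "A \<subseteq> F r" "card A = r"
        and sep: "\<And>g h. g \<in> A \<Longrightarrow> h \<in> A \<Longrightarrow> g \<noteq> h \<Longrightarrow> \<not> (\<forall>j\<in>J (g \<otimes> inv h). bits x g j = bits x h j)"
        using elim[rule_format, of r] unfolding Q_def by auto
      have "inj_on (\<lambda>g. limit_action g x) A"
      proof (rule inj_onI, rule ccontr)
        fix g h assume gh: "g \<in> A" "h \<in> A" "limit_action g x = limit_action h x" "g \<noteq> h"
        have c: "g \<in> carrier G" "h \<in> carrier G" using gh A(1) F(2) by blast+
        have "bits x g j = bits x h j" for j
          using bits_limit_action[of \<one> g x j] bits_limit_action[of \<one> h x j] gh(3) c by simp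
        with sep[OF gh(1,2,4)] show False by blast
      qed
      then have "card A = card ((\<lambda>g. limit_action g x) ` A)" by (simp add: card_image)
      also have "\<dots> \<le> card (orbit G limit_action x)"
        using A(1) F(2)[of r] by (intro card_mono[OF fin]) (auto simp: orbit_def)
      finally show False using A(2) by (simp add: r_def)
    qed
  qed
qed

end

primrec word_ball :: "('a, 'b) monoid_scheme \<Rightarrow> 'a set \<Rightarrow> nat \<Rightarrow> 'a set" where
  "word_ball G S 0 = {\<one>\<^bsub>G\<^esub>}"
| "word_ball G S (Suc r) = word_ball G S r \<union> (\<lambda>(s, g). s \<otimes>\<^bsub>G\<^esub> g) ` (S \<times> word_ball G S r)"

lemma finite_word_ball: "finite S \<Longrightarrow> finite (word_ball G S r)"
  by (induction r) auto

lemma (in group) word_ball_carrier: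
  assumes "S \<subseteq> carrier G"
  shows "word_ball G S r \<subseteq> carrier G"
proof (induction r)
  case (Suc r)
  have "s \<otimes> g \<in> carrier G" if "s \<in> S" "g \<in> word_ball G S r" for s g
    using Suc.IH assms that by blast
  then show ?case using Suc.IH by auto
qed simp

text \<open>The balls of a transitive action grow until they exhaust it: a ball that does not grow is
  invariant under the generators.\<close>

lemma (in group_action) card_word_ball_orbit:
  assumes S: "S \<subseteq> carrier G" "finite S" "generate G S = carrier G"
    and y: "finite E" "y \<in> E" "orbit G \<phi> y = E" and r: "r < card E"
  shows "r < card ((\<lambda>g. \<phi> g y) ` word_ball G S r)"
  using r
proof (induction r)
  case 0
  then show ?case by simp
next
  case (Suc r)
  interpret group G by (rule is_group_G)
  let ?B = "\<lambda>r. (\<lambda>g. \<phi> g y) ` word_ball G S r"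
  have fin: "finite (?B k)" for k using S(2) by (simp add: finite_word_ball)
  have IH: "r < card (?B r)" using Suc by simp
  have sub: "?B r \<subseteq> ?B (Suc r)" by auto
  have c: "word_ball G S r \<subseteq> carrier G" by (rule word_ball_carrier[OF S(1)])
  have BE: "?B r \<subseteq> E" using c y(2) element_image by blast
  show ?case
  proof (cases "?B (Suc r) = ?B r")
    case eq: True
    have "\<phi> s z \<in> ?B r" if s: "s \<in> S" and z: "z \<in> ?B r" for s z
    proof -
      obtain g where g: "g \<in> word_ball G S r" "z = \<phi> g y" using z by blast
      have "s \<otimes> g \<in> word_ball G S (Suc r)" using s g(1) by auto
      then have "\<phi> (s \<otimes> g) y \<in> ?B (Suc r)" by (rule imageI)
      moreover have "\<phi> (s \<otimes> g) y = \<phi> s z"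
        using s g S(1) c y(2) by (auto intro!: composition_rule)
      ultimately show ?thesis unfolding eq by simp
    qed
    then have sub_s: "\<phi> s ` ?B r \<subseteq> ?B r" if "s \<in> S" for s using that by blast
    \<comment> \<open>Words also contain inverses of generators, for which an inclusion is not
      enough; an injection of a finite set into itself is onto.\<close>
    have inv_s: "\<phi> s ` ?B r = ?B r" if "s \<in> S" for s
    proof -
      have "inj_on (\<phi> s) (?B r)" using inj_on_subset[OF inj_prop[of s] BE] S(1) that by auto
      then show ?thesis using sub_s[OF that] fin by (intro card_subset_eq) (auto simp: card_image)
    qed
    have "\<phi> g z \<in> ?B r" if "g \<in> generate G S" "z \<in> ?B r" for g z
      using that
    proof (induction arbitrary: z rule: generate.induct)
      case one
      then have "z \<in> E" using BE by blast
      then have "\<phi> \<one> z = z" by (rule one_action)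
      with one show ?case by simp
    next
      case (incl h)
      then show ?case using sub_s by blast
    next
      case (inv h)
      then obtain w where w: "w \<in> ?B r" "z = \<phi> h w" using inv_s by blast
      have "h \<in> carrier G" "w \<in> E" using inv.hyps S(1) BE w(1) by blast+
      then have "\<phi> (inv h) z = w" unfolding w(2) by (rule inv_action(1))
      then show ?case using w(1) by simp
    next
      case (eng h1 h2)
      have "\<phi> (h1 \<otimes> h2) z = \<phi> h1 (\<phi> h2 z)"
        using eng.hyps eng.prems BE S(3) by (intro composition_rule) auto
      then show ?case using eng by simp
    qed
    moreover have "y \<in> ?B r"
    proof -
      have "\<one> \<in> word_ball G S r" by (induction r) auto
      then have "\<phi> \<one> y \<in> ?B r" by (rule imageI)
      then show ?thesis using one_action[OF y(2)] by simp
    qed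
    ultimately have "orbit G \<phi> y \<subseteq> ?B r" unfolding orbit_def S(3) by blast
    then have "?B (Suc r) = E" using BE y(3) unfolding eq by blast
    then show ?thesis using Suc.prems by simp
  next
    case False
    with sub have "card (?B r) < card (?B (Suc r))" using fin by (intro psubset_card_mono) blast+
    with IH show ?thesis by simp
  qed
qed

text \<open>Odd indices encode, for each \<open>\<gamma>\<close> and each \<open>i < 3\<close>,
  whether the \<gamma>-colour is \<open>i\<close>. Even indices keep the given colouring, which
  leaves room to record a prescribed finite factor.\<close>

lemma (in coloured_actions) separating_colouring:
  obtains c' J where "separated_actions G \<UU> Y \<psi> c' J" "\<And>n j y. c' n (2 * j) y = c n j y"
proof -
  have "\<exists>\<kappa> :: 'y \<Rightarrow> nat. (\<forall>y. \<kappa> y < 3) \<and>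
      (\<forall>y\<in>Y n. \<psi> n \<gamma> y \<in> Y n \<longrightarrow> \<psi> n \<gamma> y \<noteq> y \<longrightarrow> \<kappa> (\<psi> n \<gamma> y) \<noteq> \<kappa> y)"
    if "\<gamma> \<in> carrier G" for n \<gamma>
    by (rule three_colouring[OF finite_Y group_action.inj_prop[OF action that] order_refl, of n])
      blast
  then have "\<forall>n. \<forall>\<gamma>\<in>carrier G. \<exists>\<kappa> :: 'y \<Rightarrow> nat. (\<forall>y. \<kappa> y < 3) \<and>
      (\<forall>y\<in>Y n. \<psi> n \<gamma> y \<in> Y n \<longrightarrow> \<psi> n \<gamma> y \<noteq> y \<longrightarrow> \<kappa> (\<psi> n \<gamma> y) \<noteq> \<kappa> y)" by blast
  then have "\<exists>\<kappa> :: nat \<Rightarrow> 'a \<Rightarrow> 'y \<Rightarrow> nat. \<forall>n. \<forall>\<gamma>\<in>carrier G. (\<forall>y. \<kappa> n \<gamma> y < 3) \<and>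
      (\<forall>y\<in>Y n. \<psi> n \<gamma> y \<in> Y n \<longrightarrow> \<psi> n \<gamma> y \<noteq> y \<longrightarrow> \<kappa> n \<gamma> (\<psi> n \<gamma> y) \<noteq> \<kappa> n \<gamma> y)"
    by (intro choice allI bchoice) (rule spec)
  then obtain \<kappa> :: "nat \<Rightarrow> 'a \<Rightarrow> 'y \<Rightarrow> nat" where
    \<kappa>: "\<And>n \<gamma> y. \<gamma> \<in> carrier G \<Longrightarrow> \<kappa> n \<gamma> y < 3"
       "\<And>n \<gamma> y. \<gamma> \<in> carrier G \<Longrightarrow> y \<in> Y n \<Longrightarrow> \<psi> n \<gamma> y \<in> Y n \<Longrightarrow> \<psi> n \<gamma> y \<noteq> y \<Longrightarrow>
          \<kappa> n \<gamma> (\<psi> n \<gamma> y) \<noteq> \<kappa> n \<gamma> y" by blast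
  define c' where "c' n j y = (if even j then c n (j div 2) y
      else \<kappa> n (from_nat_into (carrier G) (fst (prod_decode (j div 2)))) y = snd (prod_decode (j div 2)))"
    for n j y
  define J where "J \<gamma> = (\<lambda>i. 2 * prod_encode (to_nat_on (carrier G) \<gamma>, i) + 1) ` {..<3}" for \<gamma>
  have c'_odd: "c' n (2 * prod_encode (to_nat_on (carrier G) \<gamma>, i) + 1) y \<longleftrightarrow> \<kappa> n \<gamma> y = i"
    if "\<gamma> \<in> carrier G" for n \<gamma> i y
    using that by (simp add: c'_def from_nat_into_to_nat_on[OF countable_carrier])
  have "separated_actions G \<UU> Y \<psi> c' J"
  proof (intro separated_actions.intro separated_actions_axioms.intro)
    show "coloured_actions G \<UU> Y \<psi>" by (rule coloured_actions_axioms)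
    show "finite (J \<gamma>)" for \<gamma> by (simp add: J_def)
    fix \<gamma> n y
    assume \<gamma>: "\<gamma> \<in> carrier G" and y: "y \<in> Y n" and eq: "\<And>j. j \<in> J \<gamma> \<Longrightarrow> c' n j (\<psi> n \<gamma> y) = c' n j y"
    have "2 * prod_encode (to_nat_on (carrier G) \<gamma>, \<kappa> n \<gamma> y) + 1 \<in> J \<gamma>"
      unfolding J_def using \<kappa>(1)[OF \<gamma>, of n y] by blast
    from eq[OF this] have "\<kappa> n \<gamma> (\<psi> n \<gamma> y) = \<kappa> n \<gamma> y" unfolding c'_odd[OF \<gamma>] by simp
    then show "\<psi> n \<gamma> y = y"
      using \<kappa>(2)[OF \<gamma> y] group_action.element_image[OF action \<gamma> y] by blast
  qed
  moreover have "c' n (2 * j) y = c n j y" for n j y by (simp add: c'_def)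
  ultimately show ?thesis by (rule that)
qed

lemma no_nonnull_finite_orbits:
  assumes "AE x in M. infinite (orbit G \<phi> x)"
  shows "\<not> nonnull_finite_orbits G M \<phi>"
proof
  assume "nonnull_finite_orbits G M \<phi>"
  then obtain A where A: "A \<in> sets M" "emeasure M A > 0" "\<And>x. x \<in> A \<Longrightarrow> finite (orbit G \<phi> x)"
    unfolding nonnull_finite_orbits_def by blast
  have "AE x in M. x \<notin> A" using assms by eventually_elim (use A(3) in blast)
  then have "A \<in> null_sets M" using A(1) by (simp add: AE_iff_null_sets)
  with A(2) show False by auto
qed

section \<open>Fixed points in finite actions of Stuck-Zimmer groups\<close>

context group
begin

text \<open>Since \<open>Y n\<close> is transitive and grows, the word ball of radius
  \<open>r\<close> eventually moves every point to at least \<open>r\<close> places. So the limit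
  has no finite orbits to speak of, and only the other branch of the dichotomy remains.\<close>

lemma Stuck_Zimmer_limit:
  assumes cnt: "countable (carrier G)" and fg: "finitely_generated G" and U: "nonprincipal_ultrafilter \<UU>"
    and Y: "\<And>n. finite (Y n)" "\<And>n. Y n \<noteq> {}" and act: "\<And>n. group_action G (Y n) (\<psi> n)"
    and trans: "\<And>n y. y \<in> Y n \<Longrightarrow> orbit G (\<psi> n) y = Y n"
    and lim: "filterlim (\<lambda>n. card (Y n)) at_top \<UU>"
  obtains M :: "real measure" and \<phi> where "standard_probability_space M" "pmp_action G M \<phi>"
    "\<not> nonnull_finite_orbits G M \<phi>"
    "\<And>\<gamma>. \<gamma> \<in> carrier G \<Longrightarrow> (AE x in M. \<phi> \<gamma> x \<noteq> x) \<Longrightarrow>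
      ((\<lambda>n. real (card {y \<in> Y n. \<psi> n \<gamma> y = y}) / real (card (Y n))) \<longlongrightarrow> 0) \<UU>"
proof -
  have "coloured_actions G \<UU> Y \<psi>"
    by (intro coloured_actions.intro coloured_actions_axioms.intro is_group cnt U Y act)
  then obtain c J where "separated_actions G \<UU> Y \<psi> c J"
    by (rule coloured_actions.separating_colouring)
  then interpret separated_actions G \<UU> Y \<psi> c J .
  obtain S where S: "finite S" "S \<subseteq> carrier G" "generate G S = carrier G"
    using fg unfolding finitely_generated_def by blast
  have "AE x in limit_measure. infinite (orbit G limit_action x)"
  proof (rule infinite_orbits_limit[of "word_ball G S"])
    show "finite (word_ball G S r)" for r using S(1) by (rule finite_word_ball)
    show "word_ball G S r \<subseteq> carrier G" for r by (rule word_ball_carrier[OF S(2)])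
    fix r
    have "eventually (\<lambda>n. Suc r \<le> card (Y n)) \<UU>" using lim unfolding filterlim_at_top by blast
    then show "eventually (\<lambda>n. \<forall>y\<in>Y n. r \<le> card ((\<lambda>g. \<psi> n g y) ` word_ball G S r)) \<UU>"
    proof eventually_elim
      case (elim n)
      show ?case
        using group_action.card_word_ball_orbit[OF act[of n] S(2,1,3) Y(1) _ trans, of _ r] elim
        by (simp add: Suc_le_eq less_imp_le)
    qed
  qed
  then have "\<not> nonnull_finite_orbits G limit_measure limit_action" by (rule no_nonnull_finite_orbits)
  with standard_limit pmp_limit show ?thesis by (rule that) (simp add: fixed_AE_iff)
qed

text \<open>A stabilizer that contains an element of infinite order contains all its powers and is
  infinite, so almost no point of the limit is fixed by such an element.\<close>

lemma Stuck_Zimmer_fixed_points: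
  assumes SZ: "Stuck_Zimmer G" and fg: "finitely_generated G" and U: "nonprincipal_ultrafilter \<UU>"
    and Y: "\<And>n. finite (Y n)" "\<And>n. Y n \<noteq> {}" and act: "\<And>n. group_action G (Y n) (\<psi> n)"
    and trans: "\<And>n y. y \<in> Y n \<Longrightarrow> orbit G (\<psi> n) y = Y n"
    and lim: "filterlim (\<lambda>n. card (Y n)) at_top \<UU>"
    and \<gamma>: "\<gamma> \<in> carrier G" "\<And>k :: nat. k > 0 \<Longrightarrow> \<gamma> [^] k \<noteq> \<one>"
  shows "((\<lambda>n. real (card {y \<in> Y n. \<psi> n \<gamma> y = y}) / real (card (Y n))) \<longlongrightarrow> 0) \<UU>"
proof -
  have cnt: "countable (carrier G)" using SZ unfolding Stuck_Zimmer_def by blast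
  obtain M :: "real measure" and \<phi> where M: "standard_probability_space M" "pmp_action G M \<phi>"
    "\<not> nonnull_finite_orbits G M \<phi>" and
    fix0: "\<And>\<gamma>. \<gamma> \<in> carrier G \<Longrightarrow> (AE x in M. \<phi> \<gamma> x \<noteq> x) \<Longrightarrow>
      ((\<lambda>n. real (card {y \<in> Y n. \<psi> n \<gamma> y = y}) / real (card (Y n))) \<longlongrightarrow> 0) \<UU>"
    using Stuck_Zimmer_limit[OF cnt fg U Y act trans lim] by blast
  have "AE x in M. finite (stabilizer G \<phi> x)"
    using SZ M unfolding Stuck_Zimmer_def by blast
  then have "AE x in M. \<phi> \<gamma> x \<noteq> x"
  proof (rule AE_mp, intro AE_I2 impI notI)
    fix x assume x: "x \<in> space M" "finite (stabilizer G \<phi> x)" "\<phi> \<gamma> x = x"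
    interpret A: group_action G "space M" \<phi> using M(2) unfolding pmp_action_def by blast
    have "\<gamma> [^] k \<in> stabilizer G \<phi> x" for k :: nat
    proof (induction k)
      case 0
      then show ?case using A.stabilizer_one_closed[OF x(1)] by simp
    next
      case (Suc k)
      moreover have "\<gamma> \<in> stabilizer G \<phi> x" using \<gamma>(1) x(3) by (simp add: stabilizer_def)
      ultimately show ?case using A.stabilizer_m_closed[OF x(1)] by simp
    qed
    then have "range (\<lambda>k :: nat. \<gamma> [^] k) \<subseteq> stabilizer G \<phi> x" by blast
    then have "finite (range (\<lambda>k :: nat. \<gamma> [^] k))" using x(2) finite_subset by blast
    then have "\<not> inj (\<lambda>k :: nat. \<gamma> [^] k)" using finite_imageD infinite_UNIV_nat by blast
    then obtain i j :: nat where "i < j" "\<gamma> [^] i = \<gamma> [^] j"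
      unfolding inj_def by (metis linorder_neqE_nat)
    moreover have "\<gamma> [^] i \<otimes> \<gamma> [^] (j - i) = \<gamma> [^] (i + (j - i))"
      by (rule nat_pow_mult[OF \<gamma>(1)])
    ultimately have "\<gamma> [^] i \<otimes> \<gamma> [^] (j - i) = \<gamma> [^] i \<otimes> \<one>"
      using \<gamma>(1) by simp
    then have "\<gamma> [^] (j - i) = \<one>" using \<gamma>(1) by simp
    with \<gamma>(2)[of "j - i"] \<open>i < j\<close> show False by simp
  qed
  then show ?thesis by (rule fix0[OF \<gamma>(1)])
qed

lemma strong_Stuck_Zimmer_fixed_points:
  assumes SZ: "strong_Stuck_Zimmer G" and fg: "finitely_generated G" and U: "nonprincipal_ultrafilter \<UU>"
    and Y: "\<And>n. finite (Y n)" "\<And>n. Y n \<noteq> {}" and act: "\<And>n. group_action G (Y n) (\<psi> n)"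
    and trans: "\<And>n y. y \<in> Y n \<Longrightarrow> orbit G (\<psi> n) y = Y n"
    and lim: "filterlim (\<lambda>n. card (Y n)) at_top \<UU>"
    and \<gamma>: "\<gamma> \<in> carrier G" "\<gamma> \<noteq> \<one>"
  shows "((\<lambda>n. real (card {y \<in> Y n. \<psi> n \<gamma> y = y}) / real (card (Y n))) \<longlongrightarrow> 0) \<UU>"
proof -
  have cnt: "countable (carrier G)" using SZ unfolding strong_Stuck_Zimmer_def by blast
  obtain M :: "real measure" and \<phi> where M: "standard_probability_space M" "pmp_action G M \<phi>"
    "\<not> nonnull_finite_orbits G M \<phi>" and
    fix0: "\<And>\<gamma>. \<gamma> \<in> carrier G \<Longrightarrow> (AE x in M. \<phi> \<gamma> x \<noteq> x) \<Longrightarrow>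
      ((\<lambda>n. real (card {y \<in> Y n. \<psi> n \<gamma> y = y}) / real (card (Y n))) \<longlongrightarrow> 0) \<UU>"
    using Stuck_Zimmer_limit[OF cnt fg U Y act trans lim] by blast
  have "AE x in M. stabilizer G \<phi> x = {\<one>}"
    using SZ M unfolding strong_Stuck_Zimmer_def by blast
  then have "AE x in M. \<phi> \<gamma> x \<noteq> x"
    by eventually_elim (use \<gamma> in \<open>auto simp: stabilizer_def\<close>)
  then show ?thesis by (rule fix0[OF \<gamma>(1)])
qed

section \<open>Actions on left cosets\<close>

lemma l_coset_eq_iff:
  assumes H: "subgroup H G" and "a \<in> carrier G" "b \<in> carrier G"
  shows "a <# H = b <# H \<longleftrightarrow> inv a \<otimes> b \<in> H"
proof
  have Hc: "H \<subseteq> carrier G" using H by (rule subgroup.subset)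
  assume "a <# H = b <# H"
  moreover have "b \<otimes> \<one> \<in> b <# H" unfolding l_coset_def using subgroup.one_closed[OF H] by blast
  ultimately obtain h where "h \<in> H" "b = a \<otimes> h" using assms unfolding l_coset_def by auto
  then show "inv a \<otimes> b \<in> H" using assms Hc by (auto simp: inv_cancel)
next
  have Hc: "H \<subseteq> carrier G" using H by (rule subgroup.subset)
  assume h: "inv a \<otimes> b \<in> H"
  have "b = a \<otimes> (inv a \<otimes> b)" using assms by (simp add: inv_cancel)
  then have "b \<in> a <# H" unfolding l_coset_def using h by blast
  then show "a <# H = b <# H" by (rule l_repr_independence[OF _ assms(2) H])
qed

lemma coset_action_coset:
  assumes H: "subgroup H G"
  shows "\<And>g a. g \<in> carrier G \<Longrightarrow> a \<in> carrier G \<Longrightarrow>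
      coset_action G H g (a <# H) = (g \<otimes> a) <# H"
proof -
  fix g a assume "g \<in> carrier G" "a \<in> carrier G"
  then show "coset_action G H g (a <# H) = (g \<otimes> a) <# H"
    using lcos_m_assoc[OF subgroup.subset[OF H]] by (auto simp: coset_action_def LCOSETS_def)
qed

lemma group_action_cosets:
  assumes H: "subgroup H G"
  shows "group_action G (lcosets H) (coset_action G H)"
proof (rule group_actionI)
  have Hc: "H \<subseteq> carrier G" using H by (rule subgroup.subset)
  show "group G" by (rule is_group)
  show "coset_action G H g \<in> extensional (lcosets H)" for g by (simp add: coset_action_def)
  fix C assume "C \<in> lcosets H"
  then obtain a where a: "a \<in> carrier G" "C = a <# H" unfolding LCOSETS_def by blast
  show "coset_action G H g C \<in> lcosets H" if "g \<in> carrier G" for g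
    using that a by (auto simp: coset_action_coset[OF H] LCOSETS_def)
  show "coset_action G H \<one> C = C" using a by (simp add: coset_action_coset[OF H])
  show "coset_action G H (g \<otimes> h) C = coset_action G H g (coset_action G H h C)"
    if "g \<in> carrier G" "h \<in> carrier G" for g h
    using that a by (simp add: coset_action_coset[OF H] m_assoc)
qed

lemma orbit_cosets:
  assumes H: "subgroup H G" and C: "C \<in> lcosets H"
  shows "orbit G (coset_action G H) C = lcosets H"
proof -
  obtain a where a: "a \<in> carrier G" "C = a <# H" using C unfolding LCOSETS_def by blast
  have "b <# H = coset_action G H (b \<otimes> inv a) C" if "b \<in> carrier G" for b
    using that a by (simp add: coset_action_coset[OF H] m_assoc)
  then have "lcosets H \<subseteq> orbit G (coset_action G H) C"
    unfolding LCOSETS_def orbit_def using a(1) by (auto intro!: exI[of _ "_ \<otimes> inv a"])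
  then show ?thesis
    using group_action.orbit_subset[OF group_action_cosets[OF H] C] by blast
qed

lemma coset_action_fixed_iff:
  assumes H: "subgroup H G" and "\<gamma> \<in> carrier G" "a \<in> carrier G"
  shows "coset_action G H \<gamma> (a <# H) = a <# H \<longleftrightarrow> inv a \<otimes> \<gamma> \<otimes> a \<in> H"
proof -
  have "coset_action G H \<gamma> (a <# H) = a <# H \<longleftrightarrow> a <# H = (\<gamma> \<otimes> a) <# H"
    using assms by (auto simp: coset_action_coset)
  also have "\<dots> \<longleftrightarrow> inv a \<otimes> \<gamma> \<otimes> a \<in> H"
    using assms by (simp add: l_coset_eq_iff m_assoc)
  finally show ?thesis .
qed

lemma conjugate_mem_iff:
  assumes H: "subgroup H G" and "\<gamma> \<in> carrier G" "a \<in> carrier G"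
  shows "\<gamma> \<in> a <# H #> inv a \<longleftrightarrow> inv a \<otimes> \<gamma> \<otimes> a \<in> H"
proof
  have Hc: "H \<subseteq> carrier G" using H by (rule subgroup.subset)
  assume "\<gamma> \<in> a <# H #> inv a"
  then obtain h where h: "h \<in> H" "\<gamma> = a \<otimes> h \<otimes> inv a" unfolding l_coset_def r_coset_def by blast
  then have "h \<in> carrier G" using Hc by blast
  then have "inv a \<otimes> \<gamma> \<otimes> a = h" using h(2) assms(3) by (simp add: m_assoc inv_cancel)
  then show "inv a \<otimes> \<gamma> \<otimes> a \<in> H" using h(1) by simp
next
  assume h: "inv a \<otimes> \<gamma> \<otimes> a \<in> H"
  have "\<gamma> = a \<otimes> (inv a \<otimes> \<gamma> \<otimes> a) \<otimes> inv a" using assms by (simp add: m_assoc inv_cancel)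
  then show "\<gamma> \<in> a <# H #> inv a" unfolding l_coset_def r_coset_def using h by blast
qed

lemma stabilizer_coset:
  assumes H: "subgroup H G"
  shows "stabilizer G (coset_action G H) H = H"
proof -
  have Hc: "H \<subseteq> carrier G" using H by (rule subgroup.subset)
  have "\<one> <# H = H" using Hc by (rule lcos_mult_one)
  then have "coset_action G H g H = H \<longleftrightarrow> g \<in> H" if "g \<in> carrier G" for g
    using coset_action_fixed_iff[OF H that one_closed] that by simp
  then show ?thesis unfolding stabilizer_def using Hc by blast
qed

lemma trivial_coset_mem: "subgroup H G \<Longrightarrow> H \<in> lcosets H"
  using lcos_mult_one[OF subgroup.subset] unfolding LCOSETS_def by blast

lemma group_action_restrict:
  assumes \<Lambda>: "subgroup \<Lambda> G" and "group_action G E \<phi>"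
  shows "group_action (G\<lparr>carrier := \<Lambda>\<rparr>) E \<phi>"
proof -
  interpret group_action G E \<phi> by fact
  have c: "\<Lambda> \<subseteq> carrier G" using \<Lambda> by (rule subgroup.subset)
  show ?thesis
  proof (rule group_actionI)
    show "group (G\<lparr>carrier := \<Lambda>\<rparr>)" using \<Lambda> by (rule subgroup_imp_group)
    show "\<phi> g \<in> extensional E" if "g \<in> carrier (G\<lparr>carrier := \<Lambda>\<rparr>)" for g
      using bij_prop0[of g] that c by (auto simp: Bij_def)
    show "\<phi> g x \<in> E" if "g \<in> carrier (G\<lparr>carrier := \<Lambda>\<rparr>)" "x \<in> E" for g x
      using element_image[of g x] that c by auto
    show "\<phi> (g \<otimes>\<^bsub>G\<lparr>carrier := \<Lambda>\<rparr>\<^esub> h) x = \<phi> g (\<phi> h x)"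
      if "g \<in> carrier (G\<lparr>carrier := \<Lambda>\<rparr>)" "h \<in> carrier (G\<lparr>carrier := \<Lambda>\<rparr>)" "x \<in> E" for g h x
      using composition_rule[of x g h] that c by auto
  qed (simp add: one_action)
qed

end

text \<open>The fixed points of \<gamma> in the ultraproduct form the internal set of the fixed
  point sets, whose Loeb measure is the ultralimit of the ratios; countability of the group then
  gives one common null set.\<close>

lemma sofic_approximationI:
  fixes G :: "('a, 'b) monoid_scheme" (structure)
  assumes G: "group G" and cnt: "countable (carrier G)"
    and Y: "\<And>n. finite (Y n)" "\<And>n. Y n \<noteq> {}" and act: "\<And>n. group_action G (Y n) (\<phi> n)"
    and lim: "\<And>\<UU> \<gamma>. nonprincipal_ultrafilter \<UU> \<Longrightarrow> \<gamma> \<in> carrier G \<Longrightarrow> \<gamma> \<noteq> \<one>\<^bsub>G\<^esub> \<Longrightarrow>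
      ((\<lambda>n. real (card {y \<in> Y n. \<phi> n \<gamma> y = y}) / real (card (Y n))) \<longlongrightarrow> 0) \<UU>"
  shows "sofic_approximation G Y \<phi>"
  unfolding sofic_approximation_def
proof (intro conjI allI impI Y act)
  interpret group G by fact
  fix \<UU> assume U: "nonprincipal_ultrafilter \<UU>"
  interpret coloured_actions G \<UU> Y \<phi>
    by (intro coloured_actions.intro coloured_actions_axioms.intro G cnt U Y act)
  let ?Fix = "\<lambda>\<gamma> n. {y \<in> Y n. \<phi> n \<gamma> y = y}"
  have act_class: "ultraproduct_action \<UU> Y \<phi> \<gamma> (ultraclass \<UU> Y y) = ultraclass \<UU> Y (\<lambda>n. \<phi> n \<gamma> (y n))"
    if \<gamma>: "\<gamma> \<in> carrier G" and y: "y \<in> Pi UNIV Y" for \<gamma> y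
  proof -
    have img: "(\<lambda>n. \<phi> n \<gamma> (z n)) \<in> Pi UNIV Y" if "z \<in> Pi UNIV Y" for z
      using that group_action.element_image[OF act \<gamma>] by blast
    have "ultraclass \<UU> Y (\<lambda>n. \<phi> n \<gamma> (z n)) = ultraclass \<UU> Y (\<lambda>n. \<phi> n \<gamma> (y n))"
      if z: "z \<in> ultraclass \<UU> Y y" for z
    proof -
      have zY: "z \<in> Pi UNIV Y" and ev: "eventually (\<lambda>n. z n = y n) \<UU>" using z unfolding ultraclass_def by auto
      have "eventually (\<lambda>n. \<phi> n \<gamma> (z n) = \<phi> n \<gamma> (y n)) \<UU>" using ev by eventually_elim simp
      then show ?thesis using ultraclass_eq_iff[OF U Y img[OF zY] img[OF y]] by blast
    qed
    moreover have "y \<in> ultraclass \<UU> Y y" using y by (simp add: ultraclass_def)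
    ultimately show ?thesis unfolding ultraproduct_action_def by blast
  qed
  have fix_iff: "ultraproduct_action \<UU> Y \<phi> \<gamma> C = C \<longleftrightarrow> C \<in> internal_set \<UU> Y (?Fix \<gamma>)"
    if \<gamma>: "\<gamma> \<in> carrier G" and C: "C \<in> ultraproduct \<UU> Y" for \<gamma> C
  proof -
    obtain y where y: "y \<in> Pi UNIV Y" "C = ultraclass \<UU> Y y" using C unfolding ultraproduct_def by blast
    have img: "(\<lambda>n. \<phi> n \<gamma> (y n)) \<in> Pi UNIV Y"
      using y(1) group_action.element_image[OF act \<gamma>] by blast
    have yY: "y n \<in> Y n" for n using y(1) by blast
    show ?thesis
      unfolding y(2) act_class[OF \<gamma> y(1)] ultraclass_eq_iff[OF U Y img y(1)]
        ultraclass_mem_internal_set[OF U Y y(1)] by (simp add: yY)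
  qed
  have "AE C in Loeb \<UU> Y. C \<notin> internal_set \<UU> Y (?Fix \<gamma>)" if \<gamma>: "\<gamma> \<in> carrier G - {\<one>}" for \<gamma>
  proof -
    have "Lim \<UU> (\<lambda>n. real (card (?Fix \<gamma> n)) / real (card (Y n))) = 0"
      by (rule tendsto_Lim[OF U_not_bot lim[OF U]]) (use \<gamma> in auto)
    then have "emeasure (Loeb \<UU> Y) (internal_set \<UU> Y (?Fix \<gamma>)) = 0"
      by (subst emeasure_Loeb[OF U Y]) auto
    moreover have "internal_set \<UU> Y (?Fix \<gamma>) \<in> sets (Loeb \<UU> Y)" by (rule internal_set_measurable) blast
    ultimately have "internal_set \<UU> Y (?Fix \<gamma>) \<in> null_sets (Loeb \<UU> Y)" by (rule null_setsI)
    then show ?thesis by (rule AE_not_in)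
  qed
  then have "AE C in Loeb \<UU> Y. \<forall>\<gamma>\<in>carrier G - {\<one>}. C \<notin> internal_set \<UU> Y (?Fix \<gamma>)"
    by (intro AE_ball_countable[THEN iffD2] countable_Diff cnt ballI)
  then show "essentially_free G (Loeb \<UU> Y) (ultraproduct_action \<UU> Y \<phi>)"
    unfolding essentially_free_def
  proof (rule AE_mp, intro AE_I2 impI)
    fix C assume C: "C \<in> space (Loeb \<UU> Y)" "\<forall>\<gamma>\<in>carrier G - {\<one>}. C \<notin> internal_set \<UU> Y (?Fix \<gamma>)"
    then have CU: "C \<in> ultraproduct \<UU> Y" by (simp add: space_Loeb)
    have "?Fix \<one> n = Y n" for n using group_action.one_action[OF act] by auto
    then have "C \<in> internal_set \<UU> Y (?Fix \<one>)"
      using CU internal_set_UNIV[OF U Y] by (simp add: fun_eq_iff)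
    then have "ultraproduct_action \<UU> Y \<phi> \<one> C = C" using fix_iff[OF one_closed CU] by blast
    then show "stabilizer G (ultraproduct_action \<UU> Y \<phi>) C = {\<one>}"
      unfolding stabilizer_def using C(2) fix_iff[OF _ CU] by auto
  qed
qed

section \<open>From graphings to generating sets of finite groupoids\<close>

text \<open>For finite \<open>F\<close>, this relation depends on finitely many truth values of \<open>T\<close> only, so events
  expressed by it can be approximated by cylinder sets.\<close>

definition truncated_connected ::
    "('a, 'b) monoid_scheme \<Rightarrow> 'a set \<Rightarrow> ('a \<Rightarrow> 'a \<Rightarrow> bool) \<Rightarrow> ('a \<times> 'a) set" where
  "truncated_connected G F T =
     ({(h, \<gamma> \<otimes>\<^bsub>G\<^esub> h) |h \<gamma>. h \<in> F \<and> \<gamma> \<in> F \<and> T \<gamma> h} \<union>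
      {(h, \<gamma> \<otimes>\<^bsub>G\<^esub> h) |h \<gamma>. h \<in> F \<and> \<gamma> \<in> F \<and> T \<gamma> h}\<inverse>)\<^sup>*"

lemma truncated_connected_cong:
  assumes "\<And>\<gamma> h. \<gamma> \<in> F \<Longrightarrow> h \<in> F \<Longrightarrow> T \<gamma> h = T' \<gamma> h"
  shows "truncated_connected G F T = truncated_connected G F T'"
proof -
  have "{(h, \<gamma> \<otimes>\<^bsub>G\<^esub> h) |h \<gamma>. h \<in> F \<and> \<gamma> \<in> F \<and> T \<gamma> h}
      = {(h, \<gamma> \<otimes>\<^bsub>G\<^esub> h) |h \<gamma>. h \<in> F \<and> \<gamma> \<in> F \<and> T' \<gamma> h}"
    using assms by blast
  then show ?thesis unfolding truncated_connected_def by simp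
qed

lemma truncated_connected_mono:
  assumes "F \<subseteq> F'"
  shows "truncated_connected G F T \<subseteq> truncated_connected G F' T"
  unfolding truncated_connected_def by (rule rtrancl_mono) (use assms in blast)

lemma truncated_connected_subset:
  assumes "F \<subseteq> carrier G" "\<And>h \<gamma>. h \<in> F \<Longrightarrow> \<gamma> \<in> F \<Longrightarrow> T \<gamma> h \<Longrightarrow> (\<gamma>, \<phi> h y) \<in> A"
  shows "truncated_connected G F T \<subseteq> arrow_connected G \<phi> A y"
proof -
  have "{(h, \<gamma> \<otimes>\<^bsub>G\<^esub> h) |h \<gamma>. h \<in> F \<and> \<gamma> \<in> F \<and> T \<gamma> h} \<subseteq> arrow_graph G \<phi> A y"
    using assms unfolding arrow_graph_def by blast
  then show ?thesis
    unfolding truncated_connected_def arrow_connected_def by (intro rtrancl_mono Un_mono) blast+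
qed

text \<open>A path has finitely many edges, and each of them is present from some stage of the
  exhaustion on.\<close>

lemma arrow_connected_truncate:
  assumes "(a, b) \<in> arrow_connected G \<phi> A y" and "incseq F" "carrier G \<subseteq> (\<Union>m. F m)"
  shows "\<exists>m. (a, b) \<in> truncated_connected G (F m) (\<lambda>\<gamma> h. (\<gamma>, \<phi> h y) \<in> A)"
  using assms(1) unfolding arrow_connected_def
proof (induction rule: rtrancl_induct)
  case base
  show ?case unfolding truncated_connected_def by blast
next
  case (step u v)
  let ?T = "\<lambda>\<gamma> h. (\<gamma>, \<phi> h y) \<in> A"
  have edge: "\<exists>m. (p, q) \<in> truncated_connected G (F m) ?T \<and> (q, p) \<in> truncated_connected G (F m) ?T"
    if pq: "(p, q) \<in> arrow_graph G \<phi> A y" for p q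
  proof -
    obtain \<gamma> where g: "p \<in> carrier G" "\<gamma> \<in> carrier G" "q = \<gamma> \<otimes>\<^bsub>G\<^esub> p" "?T \<gamma> p"
      using pq unfolding arrow_graph_def by blast
    obtain k l where "p \<in> F k" "\<gamma> \<in> F l" using g assms(3) by blast
    moreover have "F k \<subseteq> F (max k l)" "F l \<subseteq> F (max k l)" using assms(2) by (auto simp: incseq_def)
    ultimately have "(p, q) \<in> {(h, \<gamma> \<otimes>\<^bsub>G\<^esub> h) |h \<gamma>. h \<in> F (max k l) \<and> \<gamma> \<in> F (max k l) \<and> ?T \<gamma> h}"
      using g(3,4) by blast
    then show ?thesis unfolding truncated_connected_def by blast
  qed
  obtain m where m: "(u, v) \<in> truncated_connected G (F m) ?T"
    using step.hyps(2) edge by (metis Un_iff converse_iff)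
  obtain k where k: "(a, u) \<in> truncated_connected G (F k) ?T" using step.IH by blast
  have "F k \<subseteq> F (max k m)" "F m \<subseteq> F (max k m)" using assms(2) by (auto simp: incseq_def)
  then have "(a, u) \<in> truncated_connected G (F (max k m)) ?T" "(u, v) \<in> truncated_connected G (F (max k m)) ?T"
    using k m truncated_connected_mono by blast+
  then have "(a, v) \<in> truncated_connected G (F (max k m)) ?T"
    unfolding truncated_connected_def by (rule rtrancl_trans)
  then show ?case by blast
qed

section \<open>Splitting a graphing along group elements\<close>

lemma pmp_action_AE:
  assumes "pmp_action G M \<phi>" "countable (carrier G)" "AE x in M. P x"
  shows "AE x in M. \<forall>g\<in>carrier G. P (\<phi> g x)"
proof (rule AE_ball_countable[THEN iffD2, OF assms(2)], rule ballI)
  fix g assume g: "g \<in> carrier G"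
  have m: "\<phi> g \<in> measurable M M" "distr M M (\<phi> g) = M" using assms(1) g unfolding pmp_action_def by blast+
  have "AE x in distr M M (\<phi> g). P x" unfolding m(2) by (rule assms(3))
  then show "AE x in M. P (\<phi> g x)" by (rule AE_distrD[OF m(1)])
qed

text \<open>The part of the space on which the graphing acts like \<open>\<gamma>\<close>. Unlike
  the maps \<open>f i\<close>, such sets can be approximated by cylinder sets and so be copied to
  \<open>Y n\<close>.\<close>

definition graphing_piece ::
    "('a \<Rightarrow> 'x \<Rightarrow> 'x) \<Rightarrow> (nat \<Rightarrow> 'x set) \<Rightarrow> (nat \<Rightarrow> 'x \<Rightarrow> 'x) \<Rightarrow> 'a \<Rightarrow> 'x set" where
  "graphing_piece \<phi> A f \<gamma> = (\<Union>i. {x \<in> A i. f i x = \<phi> \<gamma> x})"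

text \<open>A path of the graphing from \<open>x\<close> to \<open>g x\<close> lifts to a path in
  the group from \<open>\<one>\<close> to some \<open>h\<close> with \<open>h x = g x\<close>, and
  freeness yields \<open>h = g\<close>.\<close>

lemma graphing_pieces_connected:
  fixes G :: "('a, 'b) monoid_scheme" (structure)
  assumes pmp: "pmp_action G M \<phi>" and cnt: "countable (carrier G)" and free: "essentially_free G M \<phi>"
    and gen: "generates_mod_null M (orbit_relation G M \<phi>) A f"
  shows "AE x in M. \<forall>g\<in>carrier G.
    (\<one>, g) \<in> arrow_connected G \<phi> {(\<gamma>, z). \<gamma> \<in> carrier G \<and> z \<in> graphing_piece \<phi> A f \<gamma>} x"
proof -
  interpret A: group_action G "space M" \<phi> using pmp unfolding pmp_action_def by blast
  interpret group G by (rule A.is_group_G)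
  let ?A = "{(\<gamma>, z). \<gamma> \<in> carrier G \<and> z \<in> graphing_piece \<phi> A f \<gamma>}"
  have "AE x in M. generated_relation A f `` {x} = orbit_relation G M \<phi> `` {x}"
    using gen unfolding generates_mod_null_def by blast
  then have "AE x in M. generated_relation A f `` {x} = orbit_relation G M \<phi> `` {x} \<and> x \<in> space M"
    using AE_space by eventually_elim blast
  then have "AE x in M. generated_relation A f `` {x} = orbit G \<phi> x"
    by eventually_elim (auto simp: orbit_relation_def)
  \<comment> \<open>The exceptional null set is made invariant, so that each step of a path may be
    taken at another point of the orbit.\<close>
  from pmp_action_AE[OF pmp cnt this]
  have good: "AE x in M. \<forall>g\<in>carrier G. generated_relation A f `` {\<phi> g x} = orbit G \<phi> (\<phi> g x)" .
  have "AE x in M. stabilizer G \<phi> x = {\<one>}" using free unfolding essentially_free_def .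
  with good show ?thesis
  proof (rule AE_mp[OF AE_conjI], intro AE_I2 impI ballI)
    fix x g assume x: "x \<in> space M" and
      H: "(\<forall>g\<in>carrier G. generated_relation A f `` {\<phi> g x} = orbit G \<phi> (\<phi> g x)) \<and> stabilizer G \<phi> x = {\<one>}"
      and g: "g \<in> carrier G"
    have cl: "generated_relation A f `` {\<phi> h x} = orbit G \<phi> (\<phi> h x)" if "h \<in> carrier G" for h
      using H that by blast
    define E where "E = {(x, f i x) |i x. x \<in> A i}"
    have gr: "generated_relation A f = (E \<union> E\<inverse>)\<^sup>*" unfolding generated_relation_def E_def Let_def ..
    have path: "\<exists>h\<in>carrier G. w = \<phi> h x \<and> (\<one>, h) \<in> arrow_connected G \<phi> ?A x"
      if "(x, w) \<in> (E \<union> E\<inverse>)\<^sup>*" for w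
      using that
    proof (induction rule: rtrancl_induct)
      case base
      show ?case by (rule bexI[of _ "\<one>"]) (simp_all add: arrow_connected_refl A.one_action[OF x])
    next
      case (step w w')
      then obtain h where h: "h \<in> carrier G" "w = \<phi> h x" "(\<one>, h) \<in> arrow_connected G \<phi> ?A x" by blast
      have wE: "w \<in> space M" using h x A.element_image by blast
      have "w' \<in> generated_relation A f `` {w}" unfolding gr using step.hyps(2) by blast
      then have "w' \<in> orbit G \<phi> w" unfolding h(2) cl[OF h(1)] .
      then obtain \<gamma> where \<gamma>: "\<gamma> \<in> carrier G" "w' = \<phi> \<gamma> w" unfolding orbit_def by blast
      have w': "w' = \<phi> (\<gamma> \<otimes> h) x" unfolding \<gamma>(2) h(2) using A.composition_rule[OF x \<gamma>(1) h(1)] by simp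
      have "(h, \<gamma> \<otimes> h) \<in> arrow_connected G \<phi> ?A x"
      proof (cases "(w, w') \<in> E")
        case True
        then obtain i where "w \<in> A i" "w' = f i w" unfolding E_def by blast
        then have "w \<in> graphing_piece \<phi> A f \<gamma>" unfolding graphing_piece_def using \<gamma>(2) by auto
        then show ?thesis using h \<gamma>(1) by (intro arrow_connected_edge) auto
      next
        case False
        then have "(w', w) \<in> E" using step.hyps(2) by blast
        then obtain i where i: "w' \<in> A i" "w = f i w'" unfolding E_def by blast
        have "w = \<phi> (inv \<gamma>) w'" unfolding \<gamma>(2) using A.inv_action(1)[OF \<gamma>(1) wE] by simp
        then have "w' \<in> graphing_piece \<phi> A f (inv \<gamma>)" unfolding graphing_piece_def using i by auto
        then have "(\<gamma> \<otimes> h, inv \<gamma> \<otimes> (\<gamma> \<otimes> h)) \<in> arrow_connected G \<phi> ?A x"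
          using h(1) \<gamma>(1) by (intro arrow_connected_edge) (auto simp: w')
        then have "(\<gamma> \<otimes> h, h) \<in> arrow_connected G \<phi> ?A x"
          using inv_cancel(2)[OF \<gamma>(1) h(1)] by simp
        then show ?thesis by (rule arrow_connected_sym)
      qed
      from arrow_connected_trans[OF h(3) this] w' h(1) \<gamma>(1) show ?case
        by (intro bexI[of _ "\<gamma> \<otimes> h"]) auto
    qed
    have x1: "\<phi> \<one> x = x" by (rule A.one_action[OF x])
    have "\<phi> g x \<in> generated_relation A f `` {x}"
      using cl[OF one_closed] g unfolding x1 orbit_def by blast
    then have "(x, \<phi> g x) \<in> (E \<union> E\<inverse>)\<^sup>*" unfolding gr by blast
    from path[OF this] obtain h where h: "h \<in> carrier G" "\<phi> g x = \<phi> h x"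
      "(\<one>, h) \<in> arrow_connected G \<phi> ?A x" by blast
    have "\<phi> (inv h \<otimes> g) x = \<phi> (inv h) (\<phi> h x)"
      using A.composition_rule[OF x inv_closed[OF h(1)] g] h(2) by simp
    then have "inv h \<otimes> g \<in> stabilizer G \<phi> x"
      using A.inv_action(1)[OF h(1) x] h(1) g by (simp add: stabilizer_def)
    then have "inv h \<otimes> g = \<one>" using H by blast
    then have "g = h" using h(1) g inv_cancel(1)[OF h(1) g] by simp
    then show "(\<one>, g) \<in> arrow_connected G \<phi> ?A x" using h(3) by simp
  qed
qed

text \<open>By freeness \<open>f i x\<close> determines the \<open>\<gamma>\<close> with
  \<open>f i x = \<phi> \<gamma> x\<close>, so for fixed \<open>i\<close> the pieces are almost
  disjoint subsets of \<open>A i\<close>.\<close>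

lemma sum_graphing_pieces:
  fixes G :: "('a, 'b) monoid_scheme" (structure)
  assumes pmp: "pmp_action G M \<phi>" and free: "essentially_free G M \<phi>"
    and A: "\<And>i. A i \<in> sets M" and AM: "\<And>i \<gamma>. \<gamma> \<in> carrier G \<Longrightarrow> {x \<in> A i. f i x = \<phi> \<gamma> x} \<in> sets M"
    and F: "finite F" "F \<subseteq> carrier G"
  shows "(\<Sum>\<gamma>\<in>F. emeasure M (graphing_piece \<phi> A f \<gamma>)) \<le> (\<Sum>i. emeasure M (A i))"
proof -
  interpret A: group_action G "space M" \<phi> using pmp unfolding pmp_action_def by blast
  interpret group G by (rule A.is_group_G)
  let ?P = "\<lambda>i \<gamma>. {x \<in> A i. f i x = \<phi> \<gamma> x}"
  have "(\<Sum>\<gamma>\<in>F. emeasure M (graphing_piece \<phi> A f \<gamma>)) \<le> (\<Sum>\<gamma>\<in>F. \<Sum>i. emeasure M (?P i \<gamma>))"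
    unfolding graphing_piece_def
    by (intro sum_mono emeasure_subadditive_countably) (use AM F(2) in auto)
  also have "\<dots> = (\<Sum>i. \<Sum>\<gamma>\<in>F. emeasure M (?P i \<gamma>))"
    by (rule suminf_sum[symmetric]) auto
  also have "\<dots> \<le> (\<Sum>i. emeasure M (A i))"
  proof (intro suminf_le allI)
    fix i
    have "(\<Sum>\<gamma>\<in>F. emeasure M (?P i \<gamma>)) = (\<Sum>\<gamma>\<in>F. \<integral>\<^sup>+x. indicator (?P i \<gamma>) x \<partial>M)"
      using AM F(2) by (intro sum.cong refl) (simp add: subset_iff)
    also have "\<dots> = (\<integral>\<^sup>+x. (\<Sum>\<gamma>\<in>F. indicator (?P i \<gamma>) x) \<partial>M)"
      using AM F(2) by (intro nn_integral_sum[symmetric] borel_measurable_indicator) auto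
    also have "\<dots> \<le> (\<integral>\<^sup>+x. indicator (A i) x \<partial>M)"
    proof (rule nn_integral_mono_AE)
      have "AE x in M. stabilizer G \<phi> x = {\<one>}" using free unfolding essentially_free_def .
      then show "AE x in M. (\<Sum>\<gamma>\<in>F. indicator (?P i \<gamma>) x) \<le> (indicator (A i) x :: ennreal)"
      proof (rule AE_mp, intro AE_I2 impI)
        fix x assume x: "x \<in> space M" "stabilizer G \<phi> x = {\<one>}"
        show "(\<Sum>\<gamma>\<in>F. indicator (?P i \<gamma>) x) \<le> (indicator (A i) x :: ennreal)"
        proof (cases "\<exists>\<gamma>\<in>F. x \<in> ?P i \<gamma>")
          case False
          then have "(\<Sum>\<gamma>\<in>F. indicator (?P i \<gamma>) x) = (0 :: ennreal)"
            by (intro sum.neutral ballI) (auto simp: indicator_def)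
          then show ?thesis by simp
        next
          case True
          then obtain \<gamma> where \<gamma>: "\<gamma> \<in> F" "x \<in> A i" "f i x = \<phi> \<gamma> x" by blast
          have "x \<notin> ?P i \<gamma>'" if "\<gamma>' \<in> F" "\<gamma>' \<noteq> \<gamma>" for \<gamma>'
          proof
            assume "x \<in> ?P i \<gamma>'"
            then have eq: "\<phi> \<gamma>' x = \<phi> \<gamma> x" using \<gamma>(3) by simp
            have c: "\<gamma> \<in> carrier G" "\<gamma>' \<in> carrier G" using \<gamma>(1) that(1) F(2) by blast+
            have "\<phi> (inv \<gamma> \<otimes> \<gamma>') x = \<phi> (inv \<gamma>) (\<phi> \<gamma> x)"
              using A.composition_rule[OF x(1) inv_closed[OF c(1)] c(2)] eq by simp
            then have "inv \<gamma> \<otimes> \<gamma>' \<in> stabilizer G \<phi> x"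
              using A.inv_action(1)[OF c(1) x(1)] c by (simp add: stabilizer_def)
            then have "inv \<gamma> \<otimes> \<gamma>' = \<one>" using x(2) by blast
            then show False using inv_cancel(1)[OF c] c that(2) by simp
          qed
          then have "(\<Sum>\<gamma>'\<in>F. indicator (?P i \<gamma>') x) = (\<Sum>\<gamma>'\<in>F. if \<gamma>' = \<gamma> then 1 else 0 :: ennreal)"
            using \<gamma> by (intro sum.cong refl) (auto simp: indicator_def)
          also have "\<dots> = 1" using F(1) \<gamma>(1) by simp
          finally show ?thesis using \<gamma>(2) by simp
        qed
      qed
    qed
    also have "\<dots> = emeasure M (A i)" using A by simp
    finally show "(\<Sum>\<gamma>\<in>F. emeasure M (?P i \<gamma>)) \<le> emeasure M (A i)" .
  qed auto
  finally show ?thesis .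
qed

context separated_actions
begin

text \<open>Equality of two points is tested bit by bit, which gives countably many measurable
  conditions.\<close>

lemma graphing_piece_measurable:
  assumes f: "mp_partial_iso limit_measure D f" and \<gamma>: "\<gamma> \<in> carrier G"
  shows "{x \<in> D. f x = limit_action \<gamma> x} \<in> sets limit_measure"
proof -
  have D: "D \<in> sets limit_measure"
    and m: "f \<in> measurable (restrict_space limit_measure D) (restrict_space limit_measure (f ` D))"
    using f unfolding mp_partial_iso_def by blast+
  have 1: "{x \<in> D. bits (f x) h j} \<in> sets limit_measure" for h j
  proof -
    have "f ` D \<inter> {x. bits x h j} \<in> sets (restrict_space limit_measure (f ` D))"
      unfolding sets_restrict_space using bits_measurable by blast
    then have "f -` (f ` D \<inter> {x. bits x h j}) \<inter> space (restrict_space limit_measure D)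
        \<in> sets (restrict_space limit_measure D)"
      by (rule measurable_sets[OF m])
    moreover have "f -` (f ` D \<inter> {x. bits x h j}) \<inter> space (restrict_space limit_measure D)
        = {x \<in> D. bits (f x) h j}"
      by (auto simp: space_restrict_space)
    ultimately have "{x \<in> D. bits (f x) h j} \<in> sets (restrict_space limit_measure D)" by simp
    then show ?thesis using D by (simp add: sets_restrict_space_iff)
  qed
  have 2: "D \<inter> {x. bits x (h \<otimes> \<gamma>) j} \<in> sets limit_measure" for h j
    using D bits_measurable by (rule sets.Int)
  have 3: "{x \<in> D. bits (f x) h j = bits x (h \<otimes> \<gamma>) j} \<in> sets limit_measure" for h j
  proof -
    have "{x \<in> D. bits (f x) h j = bits x (h \<otimes> \<gamma>) j}
        = D - sym_diff {x \<in> D. bits (f x) h j} (D \<inter> {x. bits x (h \<otimes> \<gamma>) j})" by blast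
    also have "\<dots> \<in> sets limit_measure" using 1 2 D by (intro sets.Diff sets.Un)
    finally show ?thesis .
  qed
  have "{x \<in> D. f x = limit_action \<gamma> x}
      = D \<inter> (\<Inter>h\<in>carrier G. \<Inter>j. {x \<in> D. bits (f x) h j = bits x (h \<otimes> \<gamma>) j})"
  proof (intro equalityI subsetI)
    fix x assume "x \<in> {x \<in> D. f x = limit_action \<gamma> x}"
    then show "x \<in> D \<inter> (\<Inter>h\<in>carrier G. \<Inter>j. {x \<in> D. bits (f x) h j = bits x (h \<otimes> \<gamma>) j})"
      by (auto simp: bits_limit_action)
  next
    fix x assume x: "x \<in> D \<inter> (\<Inter>h\<in>carrier G. \<Inter>j. {x \<in> D. bits (f x) h j = bits x (h \<otimes> \<gamma>) j})"
    have "f x = limit_action \<gamma> x"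
      by (rule bits_eqI) (use x in \<open>auto simp: bits_limit_action\<close>)
    with x show "x \<in> {x \<in> D. f x = limit_action \<gamma> x}" by blast
  qed
  also have "\<dots> \<in> sets limit_measure"
    using one_closed 3 by (intro sets.Int D sets.countable_INT'' sets.countable_INT'[OF countable_carrier]) auto
  finally show ?thesis .
qed

text \<open>The arrows on the finite sets are the cylinder approximations of the graphing pieces of finitely
  many group elements, together with the generators \<open>s \<in> S\<close> at the few points \<open>y\<close> where these
  arrows fail to connect \<open>y\<close> to \<open>s y\<close>.\<close>

theorem arrows_of_cost:
  assumes S: "finite S" "S \<subseteq> carrier G" "generate G S = carrier G"
    and free: "essentially_free G limit_measure limit_action"
    and cost: "cost limit_measure (orbit_relation G limit_measure limit_action) < ennreal \<kappa>"
  shows "eventually (\<lambda>n. \<exists>E. finite E \<and> E \<subseteq> carrier G \<times> Y n \<and> generates_groupoid G (Y n) (\<psi> n) E \<and>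
      real (card E) \<le> \<kappa> * real (card (Y n))) \<UU>"
proof -
  let ?M = limit_measure and ?\<phi> = limit_action
  obtain A f where gen: "generates_mod_null ?M (orbit_relation G ?M ?\<phi>) A f"
    and less: "(\<Sum>i. emeasure ?M (A i)) < ennreal \<kappa>"
    using cost unfolding cost_def by (auto simp: Inf_less_iff)
  have iso: "mp_partial_iso ?M (A i) (f i)" for i using gen unfolding generates_mod_null_def by blast
  have AM: "A i \<in> sets ?M" for i using iso[of i] unfolding mp_partial_iso_def by blast
  have PM: "{x \<in> A i. f i x = ?\<phi> \<gamma> x} \<in> sets ?M" if "\<gamma> \<in> carrier G" for i \<gamma>
    by (rule graphing_piece_measurable[OF iso that])
  define B where "B \<gamma> = graphing_piece ?\<phi> A f \<gamma>" for \<gamma>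
  have BM: "B \<gamma> \<in> sets ?M" if "\<gamma> \<in> carrier G" for \<gamma>
    unfolding B_def graphing_piece_def using PM[OF that] by (intro sets.countable_UN) auto
  define \<sigma> where "\<sigma> = enn2real (\<Sum>i. emeasure ?M (A i))"
  have \<sigma>: "(\<Sum>i. emeasure ?M (A i)) = ennreal \<sigma>" "\<sigma> \<ge> 0"
    unfolding \<sigma>_def using less by (auto simp: less_top[symmetric] intro!: ennreal_enn2real[symmetric])
  then have \<sigma>\<kappa>: "\<sigma> < \<kappa>" using less by (simp add: ennreal_less_iff)
  have sumB: "(\<Sum>\<gamma>\<in>F. measure ?M (B \<gamma>)) \<le> \<sigma>" if "finite F" "F \<subseteq> carrier G" for F
  proof -
    have "(\<Sum>\<gamma>\<in>F. emeasure ?M (B \<gamma>)) \<le> ennreal \<sigma>"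
      unfolding B_def \<sigma>(1)[symmetric] by (rule sum_graphing_pieces[OF pmp_limit free AM PM that])
    then have "ennreal (\<Sum>\<gamma>\<in>F. measure ?M (B \<gamma>)) \<le> ennreal \<sigma>"
      by (simp add: limit.emeasure_eq_measure sum_ennreal)
    then show ?thesis using \<sigma>(2) by (simp add: ennreal_le_iff)
  qed
  define F where "F m = from_nat_into (carrier G) ` {..m}" for m
  have F: "finite (F m)" "F m \<subseteq> carrier G" for m
    unfolding F_def using one_closed by (auto intro!: from_nat_into)
  have incF: "incseq F" unfolding F_def incseq_def by (intro allI impI image_mono) auto
  have exF: "carrier G \<subseteq> (\<Union>m. F m)"
  proof
    fix g assume "g \<in> carrier G"
    then obtain m where "from_nat_into (carrier G) m = g"
      using from_nat_into_surj[OF countable_carrier] by blast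
    then have "g \<in> F m" unfolding F_def by blast
    then show "g \<in> (\<Union>m. F m)" by blast
  qed
  let ?T = "\<lambda>x \<gamma> h. ?\<phi> h x \<in> B \<gamma>"
  \<comment> \<open>The points at which the pieces of elements of \<open>F m\<close>, used at places
    in \<open>F m\<close>, do not yet reach all generators. These sets decrease to a null
    set.\<close>
  define bad where "bad m = {x. \<exists>s\<in>S. (\<one>, s) \<notin> truncated_connected G (F m) (?T x)}" for m
  have TM: "{x \<in> space ?M. ?T x \<gamma> h} \<in> sets ?M" if "\<gamma> \<in> carrier G" for \<gamma> h
    using measurable_sets[OF limit_action_measurable BM[OF that], of h] by (simp add: vimage_def)
  have badM: "bad m \<in> sets ?M" for m
  proof -
    have "{x \<in> space ?M. (\<lambda>v. \<exists>s\<in>S. (\<one>, s) \<notin> truncated_connected G (F m) (\<lambda>\<gamma> h. v (\<gamma>, h)))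
        (\<lambda>i. ?T x (fst i) (snd i))} \<in> sets ?M"
    proof (rule finite_pattern_measurable[where I = "F m \<times> F m" and P = "\<lambda>i x. ?T x (fst i) (snd i)"
          and Q = "\<lambda>v. \<exists>s\<in>S. (\<one>, s) \<notin> truncated_connected G (F m) (\<lambda>\<gamma> h. v (\<gamma>, h))"])
      show "{x \<in> space ?M. ?T x (fst i) (snd i)} \<in> sets ?M" if "i \<in> F m \<times> F m" for i
        using that F(2)[of m] by (intro TM) auto
      fix v w :: "'a \<times> 'a \<Rightarrow> bool" assume "\<And>i. i \<in> F m \<times> F m \<Longrightarrow> v i = w i"
      then have "truncated_connected G (F m) (\<lambda>\<gamma> h. v (\<gamma>, h)) = truncated_connected G (F m) (\<lambda>\<gamma> h. w (\<gamma>, h))"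
        by (intro truncated_connected_cong) blast
      then show "(\<exists>s\<in>S. (\<one>, s) \<notin> truncated_connected G (F m) (\<lambda>\<gamma> h. v (\<gamma>, h))) =
          (\<exists>s\<in>S. (\<one>, s) \<notin> truncated_connected G (F m) (\<lambda>\<gamma> h. w (\<gamma>, h)))" by simp
    qed (use F(1) in simp)
    then show ?thesis unfolding bad_def by simp
  qed
  have "decseq bad"
    unfolding decseq_def
  proof (intro allI impI)
    fix m n :: nat assume "m \<le> n"
    then have "truncated_connected G (F m) (?T x) \<subseteq> truncated_connected G (F n) (?T x)" for x
      using incF by (intro truncated_connected_mono) (simp add: incseq_def)
    then show "bad n \<subseteq> bad m" unfolding bad_def by blast
  qed
  then have "(\<lambda>m. measure ?M (bad m)) \<longlonglongrightarrow> measure ?M (\<Inter>m. bad m)"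
    using badM by (intro limit.finite_Lim_measure_decseq) auto
  moreover have "measure ?M (\<Inter>m. bad m) = 0"
  proof -
    have "AE x in ?M. x \<notin> (\<Inter>m. bad m)"
      using graphing_pieces_connected[OF pmp_limit countable_carrier free gen]
    proof eventually_elim
      case (elim x)
      let ?A = "{(\<gamma>, z). \<gamma> \<in> carrier G \<and> z \<in> graphing_piece ?\<phi> A f \<gamma>}"
      have ex: "\<exists>m. (\<one>, s) \<in> truncated_connected G (F m) (?T x)" if "s \<in> S" for s
      proof -
        have "(\<one>, s) \<in> arrow_connected G ?\<phi> ?A x" using elim that S(2) by blast
        from arrow_connected_truncate[OF this incF exF] obtain m where
          m: "(\<one>, s) \<in> truncated_connected G (F m) (\<lambda>\<gamma> h. (\<gamma>, ?\<phi> h x) \<in> ?A)" by blast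
        moreover have "truncated_connected G (F m) (\<lambda>\<gamma> h. (\<gamma>, ?\<phi> h x) \<in> ?A)
            = truncated_connected G (F m) (?T x)"
          by (rule truncated_connected_cong) (use F(2)[of m] in \<open>auto simp: B_def\<close>)
        ultimately show ?thesis by blast
      qed
      \<comment> \<open>Finitely many generators have a common stage, because the stages
        increase.\<close>
      have "\<exists>m. \<forall>s\<in>S'. (\<one>, s) \<in> truncated_connected G (F m) (?T x)" if "finite S'" "S' \<subseteq> S" for S'
        using that
      proof (induction S' rule: finite_induct)
        case (insert s S')
        then obtain k l where kl: "\<forall>s\<in>S'. (\<one>, s) \<in> truncated_connected G (F k) (?T x)"
          "(\<one>, s) \<in> truncated_connected G (F l) (?T x)" using ex by blast
        have "F k \<subseteq> F (max k l)" "F l \<subseteq> F (max k l)" using incF by (auto simp: incseq_def)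
        then have "truncated_connected G (F k) (?T x) \<subseteq> truncated_connected G (F (max k l)) (?T x)"
          "truncated_connected G (F l) (?T x) \<subseteq> truncated_connected G (F (max k l)) (?T x)"
          by (simp_all add: truncated_connected_mono)
        with kl show ?case by (intro exI[of _ "max k l"]) blast
      qed simp
      from this[OF S(1) order_refl] obtain m where
        "\<forall>s\<in>S. (\<one>, s) \<in> truncated_connected G (F m) (?T x)" by (rule exE)
      then have "x \<notin> bad m" unfolding bad_def by simp
      then show ?case by (rule contrapos_nn) (rule INT_D[OF _ UNIV_I])
    qed
    moreover have "(\<Inter>m. bad m) \<in> sets ?M" using badM by (intro sets.countable_INT) auto
    ultimately show ?thesis by (simp add: limit.prob_eq_0)
  qed
  ultimately have bad0: "(\<lambda>m. measure ?M (bad m)) \<longlonglongrightarrow> 0" by simp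
  \<comment> \<open>The slack to be spent: a quarter goes into the approximation of the pieces, a
    half into generators at bad points.\<close>
  define \<eta> where "\<eta> = \<kappa> - \<sigma>"
  have \<eta>: "\<eta> > 0" using \<sigma>\<kappa> by (simp add: \<eta>_def)
  define s where "s = real (card S) + 1"
  have s: "s \<ge> 1" by (simp add: s_def)
  have "eventually (\<lambda>m. measure ?M (bad m) < \<eta> / (4 * s)) sequentially"
    using bad0 \<eta> s by (intro order_tendstoD(2)) auto
  then obtain m where m: "measure ?M (bad m) < \<eta> / (4 * s)"
    unfolding eventually_sequentially by blast
  define N where "N = real (card (F m)) + 1"
  have N: "N \<ge> 1" by (simp add: N_def)
  \<comment> \<open>Each of up to \<open>N\<close> pieces is used at up to \<open>N\<close> places,
    so \<open>N\<^sup>2\<close> errors enlarge the bad set, and every bad point costs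
    \<open>card S\<close> arrows. The summand 1 in \<open>N\<close> and \<open>s\<close> avoids
    division by zero.\<close>
  define \<delta> where "\<delta> = \<eta> / (4 * N\<^sup>2 * s)"
  have \<delta>: "\<delta> > 0" using \<eta> s N by (simp add: \<delta>_def)
  have "\<forall>\<gamma>\<in>F m. \<exists>P. finitary (carrier G) P \<and> measure ?M (sym_diff (B \<gamma>) {x. P (bits x)}) < \<delta>"
  proof
    fix \<gamma> assume "\<gamma> \<in> F m"
    then have "B \<gamma> \<in> sets ?M" using F(2) BM by blast
    then show "\<exists>P. finitary (carrier G) P \<and> measure ?M (sym_diff (B \<gamma>) {x. P (bits x)}) < \<delta>"
      using \<delta> by (rule limit_approximation) blast
  qed
  from bchoice[OF this] obtain P where
    P: "\<And>\<gamma>. \<gamma> \<in> F m \<Longrightarrow> finitary (carrier G) (P \<gamma>)"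
       "\<And>\<gamma>. \<gamma> \<in> F m \<Longrightarrow> measure ?M (sym_diff (B \<gamma>) {x. P \<gamma> (bits x)}) < \<delta>" by blast
  \<comment> \<open>Membership of the translate by \<open>h\<close> in the approximated piece of
    \<open>\<gamma>\<close>, read off the pattern of the original point; thus it makes sense both in
    the limit and on \<open>Y n\<close>.\<close>
  define T' where "T' v \<gamma> h = P \<gamma> (\<lambda>k j. v (k \<otimes> h) j)" for v \<gamma> h
  define Bad' where "Bad' v \<longleftrightarrow> (\<exists>s\<in>S. (\<one>, s) \<notin> truncated_connected G (F m) (T' v))" for v
  have PM': "{x. P \<gamma> (bits x)} \<in> sets ?M" if "\<gamma> \<in> F m" for \<gamma>
    by (rule finitary_measurable[OF P(1)[OF that]])
  have T'_limit: "T' (bits x) \<gamma> h = P \<gamma> (bits (?\<phi> h x))" if "\<gamma> \<in> F m" for x \<gamma> h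
    unfolding T'_def by (rule finitary_limit_action[OF P(1)[OF that], symmetric])
  have T'_pattern: "T' (pattern n y) \<gamma> h = P \<gamma> (pattern n (\<psi> n h y))"
    if "\<gamma> \<in> F m" "h \<in> F m" "y \<in> Y n" for n y \<gamma> h
    unfolding T'_def
    by (rule finitary_pattern_action[OF P(1)[OF that(1)] that(3), symmetric]) (use F(2) that in blast)
  have T'_fin: "finitary (carrier G) (\<lambda>v. T' v (fst i) (snd i))" if "i \<in> F m \<times> F m" for i
    unfolding T'_def by (rule finitary_translate[OF P(1)]) (use that F(2)[of m] in auto)
  have fin: "finitary (carrier G) Bad'"
  proof (rule finitary_combine[of "F m \<times> F m" _ "\<lambda>i v. T' v (fst i) (snd i)"])
    show "finite (F m \<times> F m)" using F(1) by simp
    show "finitary (carrier G) (\<lambda>v. T' v (fst i) (snd i))" if "i \<in> F m \<times> F m" for i by (rule T'_fin[OF that])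
    fix v w assume eq: "\<And>i. i \<in> F m \<times> F m \<Longrightarrow> T' v (fst i) (snd i) = T' w (fst i) (snd i)"
    have "truncated_connected G (F m) (T' v) = truncated_connected G (F m) (T' w)"
    proof (rule truncated_connected_cong)
      show "T' v \<gamma> h = T' w \<gamma> h" if "\<gamma> \<in> F m" "h \<in> F m" for \<gamma> h
        using eq[of "(\<gamma>, h)"] that by simp
    qed
    then show "Bad' v = Bad' w" unfolding Bad'_def by simp
  qed
  have Bad'M: "{x. Bad' (bits x)} \<in> sets ?M" by (rule finitary_measurable[OF fin])
  \<comment> \<open>Points whose translate falls into the error set of a piece; by invariance of the
    measure, translating does not enlarge the error.\<close>
  let ?D = "\<lambda>i. {x. ?\<phi> (snd i) x \<in> sym_diff (B (fst i)) {x. P (fst i) (bits x)}}"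
  have DM: "sym_diff (B \<gamma>) {x. P \<gamma> (bits x)} \<in> sets ?M" if "\<gamma> \<in> F m" for \<gamma>
    using PM'[OF that] BM F(2) that by (intro sets.Un sets.Diff) blast+
  have D: "?D i \<in> sets ?M" "measure ?M (?D i) < \<delta>" if "i \<in> F m \<times> F m" for i
  proof -
    have g: "fst i \<in> F m" "snd i \<in> carrier G" using that F(2)[of m] by auto
    have eq: "?D i = ?\<phi> (snd i) -` (sym_diff (B (fst i)) {x. P (fst i) (bits x)}) \<inter> space ?M" by auto
    show "?D i \<in> sets ?M"
      unfolding eq by (rule measurable_sets[OF limit_action_measurable DM[OF g(1)]])
    have "distr ?M ?M (?\<phi> (snd i)) = ?M" using pmp_limit g(2) unfolding pmp_action_def by blast
    then have "measure ?M (?D i) = measure ?M (sym_diff (B (fst i)) {x. P (fst i) (bits x)})"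
      unfolding eq using measure_distr[OF limit_action_measurable DM[OF g(1)], of "snd i"] by simp
    then show "measure ?M (?D i) < \<delta>" using P(2)[OF g(1)] by simp
  qed
  have "{x. Bad' (bits x)} \<subseteq> bad m \<union> (\<Union>i\<in>F m \<times> F m. ?D i)"
  proof
    fix x assume x: "x \<in> {x. Bad' (bits x)}"
    show "x \<in> bad m \<union> (\<Union>i\<in>F m \<times> F m. ?D i)"
    proof (cases "x \<in> (\<Union>i\<in>F m \<times> F m. ?D i)")
      case False
      have "truncated_connected G (F m) (T' (bits x)) = truncated_connected G (F m) (?T x)"
      proof (rule truncated_connected_cong)
        fix \<gamma> h assume gh: "\<gamma> \<in> F m" "h \<in> F m"
        then have "x \<notin> ?D (\<gamma>, h)" using False by blast
        then show "T' (bits x) \<gamma> h = ?T x \<gamma> h" using T'_limit[OF gh(1)] by auto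
      qed
      then show ?thesis using x unfolding Bad'_def bad_def by auto
    qed blast
  qed
  then have "measure ?M {x. Bad' (bits x)} \<le> measure ?M (bad m \<union> (\<Union>i\<in>F m \<times> F m. ?D i))"
    by (intro limit.finite_measure_mono sets.Un sets.finite_UN finite_cartesian_product badM D(1) F(1))
  also have "\<dots> \<le> measure ?M (bad m) + measure ?M (\<Union>i\<in>F m \<times> F m. ?D i)"
    by (intro measure_Un_le sets.finite_UN finite_cartesian_product badM D(1) F(1))
  also have "measure ?M (\<Union>i\<in>F m \<times> F m. ?D i) \<le> (\<Sum>i\<in>F m \<times> F m. measure ?M (?D i))"
    by (rule measure_UNION_le) (use D F(1) in auto)
  also have "\<dots> \<le> (\<Sum>i\<in>F m \<times> F m. \<delta>)" using D(2) by (intro sum_mono less_imp_le)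
  also have "\<dots> \<le> N\<^sup>2 * \<delta>"
    using \<delta> by (simp add: N_def power2_eq_square card_cartesian_product mult_right_mono mult_mono)
  finally have "measure ?M {x. Bad' (bits x)} \<le> \<eta> / (4 * s) + N\<^sup>2 * \<delta>" using m by simp
  also have "N\<^sup>2 * \<delta> = \<eta> / (4 * s)" using N by (simp add: \<delta>_def)
  finally have bad': "measure ?M {x. Bad' (bits x)} \<le> \<eta> / (2 * s)" by simp
  have "card S * measure ?M {x. Bad' (bits x)} \<le> s * (\<eta> / (2 * s))"
    using bad' s by (intro mult_mono) (auto simp: s_def)
  then have bad'': "card S * measure ?M {x. Bad' (bits x)} \<le> \<eta> / 2" using s by simp
  have "measure ?M {x. P \<gamma> (bits x)} \<le> measure ?M (B \<gamma>) + \<delta>" if "\<gamma> \<in> F m" for \<gamma>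
  proof -
    have Bg: "B \<gamma> \<in> sets ?M" using BM F(2) that by blast
    have "{x. P \<gamma> (bits x)} \<subseteq> B \<gamma> \<union> sym_diff (B \<gamma>) {x. P \<gamma> (bits x)}" by blast
    then have "measure ?M {x. P \<gamma> (bits x)} \<le> measure ?M (B \<gamma> \<union> sym_diff (B \<gamma>) {x. P \<gamma> (bits x)})"
      using sets.Un[OF Bg DM[OF that]] by (rule limit.finite_measure_mono)
    also have "\<dots> \<le> measure ?M (B \<gamma>) + measure ?M (sym_diff (B \<gamma>) {x. P \<gamma> (bits x)})"
      by (rule measure_Un_le[OF Bg DM[OF that]])
    finally show ?thesis using P(2)[OF that] by simp
  qed
  then have "(\<Sum>\<gamma>\<in>F m. measure ?M {x. P \<gamma> (bits x)}) \<le> (\<Sum>\<gamma>\<in>F m. measure ?M (B \<gamma>) + \<delta>)"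
    by (rule sum_mono)
  also have "\<dots> \<le> \<sigma> + card (F m) * \<delta>" using sumB[OF F] by (simp add: sum.distrib)
  also have "card (F m) * \<delta> \<le> N\<^sup>2 * s * \<delta>"
  proof -
    have "real (card (F m)) \<le> N * 1 * 1" by (simp add: N_def)
    also have "\<dots> \<le> N * N * s" using N s by (intro mult_mono) auto
    finally show ?thesis using \<delta> by (intro mult_right_mono) (auto simp: power2_eq_square)
  qed
  also have "N\<^sup>2 * s * \<delta> = \<eta> / 4" using N s by (simp add: \<delta>_def)
  finally have sumP: "(\<Sum>\<gamma>\<in>F m. measure ?M {x. P \<gamma> (bits x)}) + card S * measure ?M {x. Bad' (bits x)} < \<kappa>"
    using bad'' \<eta> \<eta>_def by linarith
  let ?r = "\<lambda>Q n. real (card {y \<in> Y n. Q (pattern n y)}) / real (card (Y n))"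
  \<comment> \<open>The number of arrows per point of \<open>Y n\<close>, estimated from above. Its
    limit lies below \<kappa>, hence so do almost all terms.\<close>
  have "((\<lambda>n. (\<Sum>\<gamma>\<in>F m. ?r (P \<gamma>) n) + card S * ?r Bad' n)
      \<longlongrightarrow> (\<Sum>\<gamma>\<in>F m. measure ?M {x. P \<gamma> (bits x)}) + card S * measure ?M {x. Bad' (bits x)}) \<UU>"
    using limit_measure_tendsto[OF P(1)] limit_measure_tendsto[OF fin]
    by (intro tendsto_add tendsto_sum tendsto_mult tendsto_const)
  from order_tendstoD(2)[OF this sumP] show ?thesis
  proof eventually_elim
    case (elim n)
    interpret A: group_action G "Y n" "\<psi> n" by (rule action)
    define E where "E = (\<Union>\<gamma>\<in>F m. Pair \<gamma> ` {y \<in> Y n. P \<gamma> (pattern n y)}) \<union>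
        (\<Union>s\<in>S. Pair s ` {y \<in> Y n. Bad' (pattern n y)})"
    have "finite E" unfolding E_def using F(1) S(1) finite_Y by simp
    moreover have "E \<subseteq> carrier G \<times> Y n" unfolding E_def using F(2)[of m] S(2) by auto
    moreover have "generates_groupoid G (Y n) (\<psi> n) E"
    proof (rule A.generates_groupoidI[OF S(2,3)])
      fix y s assume y: "y \<in> Y n" and s: "s \<in> S"
      show "(\<one>, s) \<in> arrow_connected G (\<psi> n) E y"
      proof (cases "Bad' (pattern n y)")
        case True
        have "(s, \<psi> n \<one> y) \<in> E" using True y s unfolding E_def A.one_action[OF y] by blast
        then have "(\<one>, s \<otimes> \<one>) \<in> arrow_connected G (\<psi> n) E y"
          using s S(2) by (intro arrow_connected_edge) auto
        then show ?thesis using s S(2) by auto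
      next
        case False
        then have "(\<one>, s) \<in> truncated_connected G (F m) (T' (pattern n y))"
          unfolding Bad'_def using s by blast
        moreover have "truncated_connected G (F m) (T' (pattern n y)) \<subseteq> arrow_connected G (\<psi> n) E y"
        proof (rule truncated_connected_subset[OF F(2)])
          fix h \<gamma> assume gh: "h \<in> F m" "\<gamma> \<in> F m" "T' (pattern n y) \<gamma> h"
          then have "P \<gamma> (pattern n (\<psi> n h y))" using T'_pattern y by blast
          moreover have "\<psi> n h y \<in> Y n" using A.element_image F(2) gh(1) y by blast
          ultimately show "(\<gamma>, \<psi> n h y) \<in> E" using gh(2) unfolding E_def by blast
        qed
        ultimately show ?thesis by blast
      qed
    qed
    moreover have "real (card E) \<le> \<kappa> * real (card (Y n))"
    proof -
      have cY: "real (card (Y n)) > 0" using finite_Y[of n] nonempty_Y[of n] by (simp add: card_gt_0_iff)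
      have "card E \<le> card (\<Union>\<gamma>\<in>F m. Pair \<gamma> ` {y \<in> Y n. P \<gamma> (pattern n y)}) +
          card (\<Union>s\<in>S. Pair s ` {y \<in> Y n. Bad' (pattern n y)})"
        unfolding E_def by (rule card_Un_le)
      also have "\<dots> \<le> (\<Sum>\<gamma>\<in>F m. card (Pair \<gamma> ` {y \<in> Y n. P \<gamma> (pattern n y)})) +
          (\<Sum>s\<in>S. card (Pair s ` {y \<in> Y n. Bad' (pattern n y)}))"
        using F(1) S(1) by (intro add_mono card_UN_le)
      also have "\<dots> \<le> (\<Sum>\<gamma>\<in>F m. card {y \<in> Y n. P \<gamma> (pattern n y)}) +
          (\<Sum>s\<in>S. card {y \<in> Y n. Bad' (pattern n y)})"
        using finite_Y by (intro add_mono sum_mono card_image_le) auto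
      finally have "real (card E) \<le> real ((\<Sum>\<gamma>\<in>F m. card {y \<in> Y n. P \<gamma> (pattern n y)}) +
          (\<Sum>s\<in>S. card {y \<in> Y n. Bad' (pattern n y)}))" by (rule of_nat_mono)
      also have "\<dots> = ((\<Sum>\<gamma>\<in>F m. ?r (P \<gamma>) n) + card S * ?r Bad' n) * real (card (Y n))"
        using cY by (simp add: distrib_right sum_distrib_right)
      also have "\<dots> \<le> \<kappa> * real (card (Y n))" using elim cY by (intro mult_right_mono) auto
      finally show ?thesis .
    qed
    ultimately show ?case by blast
  qed
qed

end

section \<open>From generating sets of finite groupoids to graphings\<close>

lemma mp_partial_iso_action:
  fixes G :: "('a, 'b) monoid_scheme" (structure)
  assumes pmp: "pmp_action G M \<phi>" and g: "g \<in> carrier G" and A: "A \<in> sets M"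
  shows "mp_partial_iso M A (\<phi> g)"
proof -
  interpret A: group_action G "space M" \<phi> using pmp unfolding pmp_action_def by blast
  interpret group G by (rule A.is_group_G)
  have m: "\<phi> h \<in> measurable M M" "distr M M (\<phi> h) = M" if "h \<in> carrier G" for h
    using pmp that unfolding pmp_action_def by blast+
  have Asp: "A \<subseteq> space M" using A by (rule sets.sets_into_space)
  have img: "\<phi> g ` A = \<phi> (inv g) -` A \<inter> space M"
  proof (intro equalityI subsetI)
    fix x assume "x \<in> \<phi> g ` A"
    then obtain a where a: "a \<in> A" "x = \<phi> g a" by blast
    then have "a \<in> space M" using Asp by blast
    then show "x \<in> \<phi> (inv g) -` A \<inter> space M"
      using a A.inv_action(1)[OF g] A.element_image[OF g] by simp
  next
    fix x assume x: "x \<in> \<phi> (inv g) -` A \<inter> space M"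
    then have "\<phi> g (\<phi> (inv g) x) = x" using A.inv_action(2)[OF g] by blast
    then show "x \<in> \<phi> g ` A" using x by (metis IntD1 imageI vimageD)
  qed
  have imgM: "\<phi> g ` A \<in> sets M"
    unfolding img by (rule measurable_sets[OF m(1) A]) (use g in simp)
  have inj: "inj_on (\<phi> g) A" using A.inj_prop[OF g] Asp by (rule inj_on_subset)
  have m1: "\<phi> g \<in> measurable (restrict_space M A) (restrict_space M (\<phi> g ` A))"
    by (rule measurable_restrict_space3[OF m(1)[OF g]]) blast
  have "inv_into A (\<phi> g) x = \<phi> (inv g) x" if x: "x \<in> \<phi> g ` A" for x
  proof -
    obtain a where a: "a \<in> A" "x = \<phi> g a" using x by blast
    then have "inv_into A (\<phi> g) x = a" using inj by simp
    then show ?thesis using A.inv_action(1)[OF g, of a] a Asp by auto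
  qed
  then have "inv_into A (\<phi> g) \<in> measurable (restrict_space M (\<phi> g ` A)) (restrict_space M A) \<longleftrightarrow>
      \<phi> (inv g) \<in> measurable (restrict_space M (\<phi> g ` A)) (restrict_space M A)"
    by (intro measurable_cong) (simp add: space_restrict_space)
  moreover have "\<phi> (inv g) \<in> measurable (restrict_space M (\<phi> g ` A)) (restrict_space M A)"
    by (rule measurable_restrict_space3[OF m(1)]) (use g in \<open>auto simp: img\<close>)
  ultimately have m2: "inv_into A (\<phi> g) \<in> measurable (restrict_space M (\<phi> g ` A)) (restrict_space M A)"
    by blast
  have "distr (restrict_space M A) (restrict_space M (\<phi> g ` A)) (\<phi> g) = restrict_space M (\<phi> g ` A)"
  proof (rule measure_eqI)
    fix X assume "X \<in> sets (distr (restrict_space M A) (restrict_space M (\<phi> g ` A)) (\<phi> g))"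
    then have Xr: "X \<in> sets (restrict_space M (\<phi> g ` A))" by simp
    then have X: "X \<subseteq> \<phi> g ` A" "X \<in> sets M" using imgM by (simp_all add: sets_restrict_space_iff)
    have eq: "\<phi> g -` X \<inter> space (restrict_space M A) = \<phi> g -` X \<inter> space M"
    proof (intro equalityI subsetI)
      fix x assume x: "x \<in> \<phi> g -` X \<inter> space M"
      then obtain a where a: "a \<in> A" "\<phi> g x = \<phi> g a" using X(1) by blast
      then have "x = a" using inj_onD[OF A.inj_prop[OF g] a(2)] x Asp by blast
      then show "x \<in> \<phi> g -` X \<inter> space (restrict_space M A)"
        using x a(1) by (simp add: space_restrict_space)
    qed (simp add: space_restrict_space)
    have "emeasure (distr (restrict_space M A) (restrict_space M (\<phi> g ` A)) (\<phi> g)) X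
        = emeasure (restrict_space M A) (\<phi> g -` X \<inter> space M)"
      unfolding eq[symmetric] by (rule emeasure_distr[OF m1 Xr])
    also have "\<dots> = emeasure M (\<phi> g -` X \<inter> space M)"
      by (rule emeasure_restrict_space) (use A Asp eq in \<open>auto simp: space_restrict_space Int_absorb2\<close>)
    also have "\<dots> = emeasure (distr M M (\<phi> g)) X"
      by (rule emeasure_distr[OF m(1)[OF g] X(2), symmetric])
    also have "\<dots> = emeasure (restrict_space M (\<phi> g ` A)) X"
      unfolding m(2)[OF g]
      by (rule emeasure_restrict_space[symmetric]) (use imgM X in \<open>auto simp: Int_absorb2 sets.sets_into_space\<close>)
    finally show "emeasure (distr (restrict_space M A) (restrict_space M (\<phi> g ` A)) (\<phi> g)) X
        = emeasure (restrict_space M (\<phi> g ` A)) X" .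
  qed simp
  then show ?thesis unfolding mp_partial_iso_def using A imgM inj m1 m2 by blast
qed

text \<open>The sets \<open>P z\<close> act as fibres of an equivariant map to \<open>Z\<close>, and
  an arrow \<open>(\<gamma>, z)\<close> lifts to the restriction of \<open>\<gamma>\<close> to
  \<open>P z\<close>. Over a point in the fibre of \<open>z\<close>, the lifted maps realize the
  arrow graph of \<open>z\<close>.\<close>

lemma cost_le_arrows:
  fixes G :: "('a, 'b) monoid_scheme" (structure)
  assumes pmp: "pmp_action G M \<phi>" and E: "finite E" "E \<subseteq> carrier G \<times> Z"
    and gen: "generates_groupoid G Z \<theta> E"
    and P: "\<And>z. z \<in> Z \<Longrightarrow> P z \<in> sets M" "\<And>z. z \<in> Z \<Longrightarrow> emeasure M (P z) = p"
    and factor: "AE x in M. \<exists>z\<in>Z. \<forall>a\<in>carrier G. \<phi> a x \<in> P (\<theta> a z)"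
  shows "cost M (orbit_relation G M \<phi>) \<le> of_nat (card E) * p"
proof -
  interpret A: group_action G "space M" \<phi> using pmp unfolding pmp_action_def by blast
  interpret group G by (rule A.is_group_G)
  obtain e where e: "bij_betw e {..<card E} E"
    using ex_bij_betw_nat_finite[OF E(1)] by (auto simp: atLeast0LessThan)
  \<comment> \<open>Indices from \<open>card E\<close> on get an empty domain; as their maps must
    still be partial isomorphisms, \<open>f\<close> takes the value \<open>\<phi> \<one>\<close>
    there.\<close>
  define A where "A i = (if i < card E then P (snd (e i)) else {})" for i
  define f where "f i = (if i < card E then \<phi> (fst (e i)) else \<phi> \<one>)" for i
  have ei: "fst (e i) \<in> carrier G" "snd (e i) \<in> Z" if "i < card E" for i
    using bij_betwE[OF e] that E(2) by (auto simp: mem_Times_iff)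
  have fc: "\<exists>g\<in>carrier G. f i = \<phi> g" for i unfolding f_def using ei by auto
  have AM: "A i \<in> sets M" for i unfolding A_def using P(1) ei by simp
  have iso: "mp_partial_iso M (A i) (f i)" for i
    using fc[of i] mp_partial_iso_action[OF pmp _ AM] by auto
  define Ed where "Ed = {(x, f i x) |i x. x \<in> A i}"
  have gr: "generated_relation A f = (Ed \<union> Ed\<inverse>)\<^sup>*" unfolding generated_relation_def Ed_def Let_def ..
  have Asp: "A i \<subseteq> space M" for i using AM by (rule sets.sets_into_space)
  have sub: "generated_relation A f `` {x} \<subseteq> orbit G \<phi> x" if x: "x \<in> space M" for x
  proof -
    have "w \<in> orbit G \<phi> x" if "(x, w) \<in> (Ed \<union> Ed\<inverse>)\<^sup>*" for w
      using that
    proof (induction rule: rtrancl_induct)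
      case base
      show ?case by (rule A.orbit_refl[OF x])
    next
      case (step w w')
      have w: "w \<in> space M" using step.IH A.orbit_subset[OF x] by blast
      have "\<exists>g\<in>carrier G. w' = \<phi> g w"
      proof (cases "(w, w') \<in> Ed")
        case True
        then obtain i where "w' = f i w" unfolding Ed_def by blast
        then show ?thesis using fc[of i] by auto
      next
        case False
        then have "(w', w) \<in> Ed" using step.hyps(2) by blast
        then obtain i where i: "w = f i w'" "w' \<in> A i" unfolding Ed_def by blast
        then obtain g where g: "g \<in> carrier G" "w = \<phi> g w'" using fc[of i] by auto
        then have "\<phi> (inv g) w = w'" using A.inv_action(1)[OF g(1)] i(2) Asp by blast
        then show ?thesis using g(1) by (intro bexI[of _ "inv g"]) auto
      qed
      then obtain g where g: "g \<in> carrier G" "w' = \<phi> g w" by blast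
      obtain h where h: "h \<in> carrier G" "w = \<phi> h x" using step.IH unfolding orbit_def by blast
      have "w' = \<phi> (g \<otimes> h) x" unfolding g(2) h(2) using A.composition_rule[OF x g(1) h(1)] by simp
      then show ?case unfolding orbit_def using g(1) h(1) by blast
    qed
    then show ?thesis unfolding gr by blast
  qed
  have "AE x in M. generated_relation A f `` {x} = orbit_relation G M \<phi> `` {x}"
    using factor
  proof (rule AE_mp, intro AE_I2 impI)
    fix x assume x: "x \<in> space M" "\<exists>z\<in>Z. \<forall>a\<in>carrier G. \<phi> a x \<in> P (\<theta> a z)"
    then obtain z where z: "z \<in> Z" "\<And>a. a \<in> carrier G \<Longrightarrow> \<phi> a x \<in> P (\<theta> a z)" by blast
    have edge: "(\<phi> a x, \<phi> b x) \<in> Ed" if ab: "(a, b) \<in> arrow_graph G \<theta> E z" for a b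
    proof -
      obtain \<gamma> where \<gamma>: "a \<in> carrier G" "\<gamma> \<in> carrier G" "b = \<gamma> \<otimes> a" "(\<gamma>, \<theta> a z) \<in> E"
        using ab unfolding arrow_graph_def by blast
      obtain i where i: "i < card E" "e i = (\<gamma>, \<theta> a z)"
        using bij_betw_imp_surj_on[OF e] \<gamma>(4) by (metis imageE lessThan_iff)
      have "\<phi> a x \<in> A i" unfolding A_def using i z(2)[OF \<gamma>(1)] by simp
      moreover have "\<phi> b x = f i (\<phi> a x)"
        unfolding f_def using i \<gamma> A.composition_rule[OF x(1) \<gamma>(2,1)] by simp
      ultimately show ?thesis unfolding Ed_def by blast
    qed
    have path: "(\<phi> a x, \<phi> b x) \<in> (Ed \<union> Ed\<inverse>)\<^sup>*" if "(a, b) \<in> arrow_connected G \<theta> E z" for a b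
      using that unfolding arrow_connected_def
    proof (induction rule: rtrancl_induct)
      case (step u v)
      have "(\<phi> u x, \<phi> v x) \<in> Ed \<union> Ed\<inverse>" using step.hyps(2) edge by blast
      with step.IH show ?case by (rule rtrancl_into_rtrancl)
    qed simp
    have "orbit G \<phi> x \<subseteq> generated_relation A f `` {x}"
    proof
      fix w assume "w \<in> orbit G \<phi> x"
      then obtain g where g: "g \<in> carrier G" "w = \<phi> g x" unfolding orbit_def by blast
      have "(\<one>, g) \<in> arrow_connected G \<theta> E z"
        using gen z(1) g(1) unfolding generates_groupoid_def by blast
      from path[OF this] show "w \<in> generated_relation A f `` {x}"
        unfolding gr g(2) A.one_action[OF x(1)] by blast
    qed
    then have "generated_relation A f `` {x} = orbit G \<phi> x" using sub[OF x(1)] by blast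
    then show "generated_relation A f `` {x} = orbit_relation G M \<phi> `` {x}"
      unfolding orbit_relation_def using x(1) by auto
  qed
  then have "generates_mod_null M (orbit_relation G M \<phi>) A f"
    unfolding generates_mod_null_def using iso by blast
  then have "cost M (orbit_relation G M \<phi>) \<le> (\<Sum>i. emeasure M (A i))"
    unfolding cost_def by (intro Inf_lower) blast
  also have "\<dots> = (\<Sum>i<card E. emeasure M (A i))"
    by (rule suminf_finite) (auto simp: A_def)
  also have "\<dots> = (\<Sum>i<card E. p)"
    by (rule sum.cong) (use ei P(2) in \<open>auto simp: A_def\<close>)
  also have "\<dots> = of_nat (card E) * p" by simp
  finally show ?thesis .
qed

section \<open>Products with a finite action\<close>

definition product_action :: "'y set \<Rightarrow> ('a \<Rightarrow> 'y \<Rightarrow> 'y) \<Rightarrow> 'z set \<Rightarrow> ('a \<Rightarrow> 'z \<Rightarrow> 'z) \<Rightarrow> 'a \<Rightarrow> 'y \<times> 'z \<Rightarrow> 'y \<times> 'z" where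
  "product_action Y \<phi> Z \<theta> g = (\<lambda>p\<in>Y \<times> Z. (\<phi> g (fst p), \<theta> g (snd p)))"

lemma product_action_apply [simp]:
  "y \<in> Y \<Longrightarrow> z \<in> Z \<Longrightarrow> product_action Y \<phi> Z \<theta> g (y, z) = (\<phi> g y, \<theta> g z)"
  by (simp add: product_action_def)

lemma group_action_product:
  assumes "group_action G Y \<phi>" "group_action G Z \<theta>"
  shows "group_action G (Y \<times> Z) (product_action Y \<phi> Z \<theta>)"
proof -
  interpret Y: group_action G Y \<phi> by fact
  interpret Z: group_action G Z \<theta> by fact
  show ?thesis
  proof (rule group_actionI)
    show "group G" by (rule Y.is_group_G)
    show "product_action Y \<phi> Z \<theta> g \<in> extensional (Y \<times> Z)" for g by (simp add: product_action_def)
    show "product_action Y \<phi> Z \<theta> g p \<in> Y \<times> Z" if gp: "g \<in> carrier G" "p \<in> Y \<times> Z" for g p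
    proof -
      obtain y z where p: "p = (y, z)" "y \<in> Y" "z \<in> Z" using gp(2) by blast
      have "\<phi> g y \<in> Y" "\<theta> g z \<in> Z" using p gp(1) Y.element_image Z.element_image by blast+
      then show ?thesis using p by simp
    qed
    show "product_action Y \<phi> Z \<theta> \<one>\<^bsub>G\<^esub> p = p" if "p \<in> Y \<times> Z" for p
      using that by (auto simp: Y.one_action Z.one_action)
    show "product_action Y \<phi> Z \<theta> (g \<otimes>\<^bsub>G\<^esub> h) p = product_action Y \<phi> Z \<theta> g (product_action Y \<phi> Z \<theta> h p)"
      if gh: "g \<in> carrier G" "h \<in> carrier G" and p': "p \<in> Y \<times> Z" for g h p
    proof -
      obtain y z where p: "p = (y, z)" "y \<in> Y" "z \<in> Z" using p' by blast
      have "\<phi> h y \<in> Y" "\<theta> h z \<in> Z" using p gh(2) Y.element_image Z.element_image by blast+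
      then show ?thesis using p gh by (simp add: Y.composition_rule Z.composition_rule)
    qed
  qed
qed

text \<open>A fixed point of the product has a fixed first coordinate. Hence asymptotic freeness is
  inherited by products.\<close>

lemma product_action_fixed_ratio:
  assumes "finite Y" "finite Z" "Z \<noteq> {}"
  shows "real (card {p \<in> Y \<times> Z. product_action Y \<phi> Z \<theta> g p = p}) / real (card (Y \<times> Z))
           \<le> real (card {y \<in> Y. \<phi> g y = y}) / real (card Y)"
proof -
  have "{p \<in> Y \<times> Z. product_action Y \<phi> Z \<theta> g p = p} \<subseteq> {y \<in> Y. \<phi> g y = y} \<times> Z" by auto
  then have "card {p \<in> Y \<times> Z. product_action Y \<phi> Z \<theta> g p = p} \<le> card ({y \<in> Y. \<phi> g y = y} \<times> Z)"
    using assms by (intro card_mono) auto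
  then have "real (card {p \<in> Y \<times> Z. product_action Y \<phi> Z \<theta> g p = p})
      \<le> real (card {y \<in> Y. \<phi> g y = y}) * real (card Z)"
    by (simp add: card_cartesian_product flip: of_nat_mult)
  then have "real (card {p \<in> Y \<times> Z. product_action Y \<phi> Z \<theta> g p = p}) / real (card (Y \<times> Z))
      \<le> real (card {y \<in> Y. \<phi> g y = y}) * real (card Z) / (real (card Y) * real (card Z))"
    unfolding card_cartesian_product of_nat_mult by (rule divide_right_mono) simp
  also have "\<dots> = real (card {y \<in> Y. \<phi> g y = y}) / real (card Y)"
    using assms by (simp add: card_gt_0_iff)
  finally show ?thesis .
qed

context group
begin

text \<open>The limit of the \<open>\<psi> n\<close> is some free action, whose cost is controlled
  only by the supremum over all of them.\<close>

theorem sofic_arrows: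
  assumes cnt: "countable (carrier G)" and fg: "finitely_generated G" and U: "nonprincipal_ultrafilter \<UU>"
    and Y: "\<And>n. finite (Y n)" "\<And>n. Y n \<noteq> {}" and act: "\<And>n. group_action G (Y n) (\<psi> n)"
    and sofic: "\<And>\<gamma>. \<gamma> \<in> carrier G \<Longrightarrow> \<gamma> \<noteq> \<one> \<Longrightarrow>
      ((\<lambda>n. real (card {y \<in> Y n. \<psi> n \<gamma> y = y}) / real (card (Y n))) \<longlongrightarrow> 0) \<UU>"
    and cost: "sup_cost G < ennreal \<kappa>"
  shows "eventually (\<lambda>n. \<exists>E. finite E \<and> E \<subseteq> carrier G \<times> Y n \<and> generates_groupoid G (Y n) (\<psi> n) E \<and>
      real (card E) \<le> \<kappa> * real (card (Y n))) \<UU>"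
proof -
  have "coloured_actions G \<UU> Y \<psi>"
    by (intro coloured_actions.intro coloured_actions_axioms.intro is_group cnt U Y act)
  then obtain c J where "separated_actions G \<UU> Y \<psi> c J"
    by (rule coloured_actions.separating_colouring)
  then interpret separated_actions G \<UU> Y \<psi> c J .
  have free: "essentially_free G limit_measure limit_action" by (rule essentially_free_limit[OF sofic])
  let ?c = "cost limit_measure (orbit_relation G limit_measure limit_action)"
  have "?c \<in> free_action_costs G"
    unfolding free_action_costs_def using free standard_limit pmp_limit by blast
  then have "?c \<le> sup_cost G" unfolding sup_cost_def by (rule Sup_upper)
  also note cost
  finally have "?c < ennreal \<kappa>" .
  moreover obtain S where "finite S" "S \<subseteq> carrier G" "generate G S = carrier G"
    using fg unfolding finitely_generated_def by blast
  ultimately show ?thesis using free by (intro arrows_of_cost)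
qed

text \<open>The action on \<open>Z\<close> is not free, but its product with an asymptotically free
  sequence has a free limit. Colouring by the second coordinate makes \<open>Z\<close> a factor of
  that limit, so that \<open>cost_le_arrows\<close> applies.\<close>

theorem inf_cost_le_arrows:
  assumes cnt: "countable (carrier G)" and U: "nonprincipal_ultrafilter \<UU>"
    and Y: "\<And>n. finite (Y n)" "\<And>n. Y n \<noteq> {}" and act: "\<And>n. group_action G (Y n) (\<psi> n)"
    and sofic: "\<And>\<gamma>. \<gamma> \<in> carrier G \<Longrightarrow> \<gamma> \<noteq> \<one> \<Longrightarrow>
      ((\<lambda>n. real (card {y \<in> Y n. \<psi> n \<gamma> y = y}) / real (card (Y n))) \<longlongrightarrow> 0) \<UU>"
    and Z: "finite Z" "Z \<noteq> {}" "group_action G Z \<theta>"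
    and E: "finite E" "E \<subseteq> carrier G \<times> Z" "generates_groupoid G Z \<theta> E"
  shows "inf_cost G \<le> ennreal (real (card E) / real (card Z))"
proof -
  interpret Z: group_action G Z \<theta> by fact
  let ?Y = "\<lambda>n. Y n \<times> Z" and ?\<psi> = "\<lambda>n. product_action (Y n) (\<psi> n) Z \<theta>"
  let ?i = "to_nat_on Z"
  let ?c = "\<lambda>(n :: nat) j p. ?i (snd p) = j"
  have inj: "?i z = ?i z' \<longleftrightarrow> z = z'" if "z \<in> Z" "z' \<in> Z" for z z'
    using that Z(1) by (simp add: countable_finite inj_on_eq_iff[OF inj_on_to_nat_on])
  have pY: "finite (?Y n)" "?Y n \<noteq> {}" for n using Y Z by auto
  have pact: "group_action G (?Y n) (?\<psi> n)" for n by (rule group_action_product[OF act Z(3)])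
  have "coloured_actions G \<UU> ?Y ?\<psi>"
    by (intro coloured_actions.intro coloured_actions_axioms.intro is_group cnt U pY pact)
  then obtain c J where "separated_actions G \<UU> ?Y ?\<psi> c J" and c: "\<And>n j p. c n (2 * j) p = ?c n j p"
    using coloured_actions.separating_colouring[where c = ?c, of G \<UU> ?Y ?\<psi>] by blast
  then interpret separated_actions G \<UU> ?Y ?\<psi> c J by blast
  have psofic: "((\<lambda>n. real (card {p \<in> ?Y n. ?\<psi> n \<gamma> p = p}) / real (card (?Y n))) \<longlongrightarrow> 0) \<UU>"
    if "\<gamma> \<in> carrier G" "\<gamma> \<noteq> \<one>" for \<gamma>
  proof (rule tendsto_sandwich[OF _ _ tendsto_const sofic[OF that]])
    show "eventually (\<lambda>n. real (card {p \<in> ?Y n. ?\<psi> n \<gamma> p = p}) / real (card (?Y n))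
        \<le> real (card {y \<in> Y n. \<psi> n \<gamma> y = y}) / real (card (Y n))) \<UU>"
      by (intro always_eventually allI product_action_fixed_ratio Y(1) Z(1,2))
  qed simp
  have free: "essentially_free G limit_measure limit_action" by (rule essentially_free_limit[OF psofic])
  \<comment> \<open>The fibre over \<open>z\<close>: the even bits at \<open>a\<close> record the
    \<open>Z\<close>-coordinate after applying \<open>a\<close>.\<close>
  define P where "P z = {x. bits x \<one> (2 * ?i z)}" for z
  have pat: "pattern n (y, z) a (2 * ?i z') \<longleftrightarrow> \<theta> a z = z'"
    if "y \<in> Y n" "z \<in> Z" "a \<in> carrier G" "z' \<in> Z" for n y z a z'
  proof -
    have "\<theta> a z \<in> Z" using that Z.element_image by blast
    then show ?thesis using that by (simp add: pattern_def c inj)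
  qed
  have PM: "P z \<in> sets limit_measure" for z unfolding P_def by (rule bits_measurable)
  have Pm: "emeasure limit_measure (P z) = ennreal (1 / real (card Z))" if z: "z \<in> Z" for z
  proof -
    have "card {p \<in> ?Y n. pattern n p \<one> (2 * ?i z)} = card (Y n)" for n
    proof -
      have "{p \<in> ?Y n. pattern n p \<one> (2 * ?i z)} = Y n \<times> {z}"
        using pat[OF _ _ one_closed z] z by (auto simp: Z.one_action)
      then show ?thesis by (simp add: card_cartesian_product)
    qed
    then have "real (card {p \<in> ?Y n. pattern n p \<one> (2 * ?i z)}) / real (card (?Y n)) = 1 / real (card Z)" for n
      using Y[of n] by (simp add: card_cartesian_product card_gt_0_iff)
    with limit_measure_tendsto[OF finitary_bit[OF one_closed, of "2 * ?i z"]]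
    have "((\<lambda>n. 1 / real (card Z)) \<longlongrightarrow> measure limit_measure (P z)) \<UU>" by (simp add: P_def)
    then have "measure limit_measure (P z) = 1 / real (card Z)"
      by (rule tendsto_unique[OF U_not_bot _ tendsto_const])
    then show ?thesis by (simp add: limit.emeasure_eq_measure)
  qed
  have "AE x in limit_measure. \<exists>z\<in>Z. bits x \<one> (2 * ?i z)"
  proof (rule limit_measure_AE)
    show "finitary (carrier G) (\<lambda>v. \<exists>z\<in>Z. v \<one> (2 * ?i z))"
      by (rule finitary_bex[OF Z(1)]) (rule finitary_bit[OF one_closed])
    show "eventually (\<lambda>n. \<forall>p\<in>?Y n. \<exists>z\<in>Z. pattern n p \<one> (2 * ?i z)) \<UU>"
    proof (intro always_eventually allI ballI)
      fix n p assume "p \<in> ?Y n"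
      then obtain y z where p: "p = (y, z)" "y \<in> Y n" "z \<in> Z" by blast
      then have "pattern n p \<one> (2 * ?i z)" using pat[OF p(2,3) one_closed p(3)] by (simp add: Z.one_action)
      with p(3) show "\<exists>z\<in>Z. pattern n p \<one> (2 * ?i z)" by blast
    qed
  qed
  moreover have "AE x in limit_measure. \<forall>z\<in>Z. \<forall>a\<in>carrier G. bits x \<one> (2 * ?i z) \<longrightarrow> bits x a (2 * ?i (\<theta> a z))"
  proof (intro AE_ball_countable[THEN iffD2, OF countable_finite[OF Z(1)]] ballI
      AE_ball_countable[THEN iffD2, OF cnt])
    fix z a assume z: "z \<in> Z" and a: "a \<in> carrier G"
    have az: "\<theta> a z \<in> Z" using z a Z.element_image by blast
    show "AE x in limit_measure. bits x \<one> (2 * ?i z) \<longrightarrow> bits x a (2 * ?i (\<theta> a z))"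
    proof (rule limit_measure_AE)
      have "finitary (carrier G) (\<lambda>v. \<not> (v \<one> (2 * ?i z) \<and> \<not> v a (2 * ?i (\<theta> a z))))"
        by (rule finitary_not[OF finitary_conj[OF finitary_bit[OF one_closed] finitary_not[OF finitary_bit[OF a]]]])
      then show "finitary (carrier G) (\<lambda>v. v \<one> (2 * ?i z) \<longrightarrow> v a (2 * ?i (\<theta> a z)))" by simp
      show "eventually (\<lambda>n. \<forall>p\<in>?Y n. pattern n p \<one> (2 * ?i z) \<longrightarrow> pattern n p a (2 * ?i (\<theta> a z))) \<UU>"
      proof (intro always_eventually allI ballI impI)
        fix n p assume "p \<in> ?Y n" and p1: "pattern n p \<one> (2 * ?i z)"
        then obtain y z' where p: "p = (y, z')" "y \<in> Y n" "z' \<in> Z" by blast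
        have "z' = z" using p1 pat[OF p(2,3) one_closed z] p by (simp add: Z.one_action)
        then show "pattern n p a (2 * ?i (\<theta> a z))" using pat[OF p(2,3) a az] p by simp
      qed
    qed
  qed
  ultimately have factor: "AE x in limit_measure. \<exists>z\<in>Z. \<forall>a\<in>carrier G. limit_action a x \<in> P (\<theta> a z)"
  proof eventually_elim
    case (elim x)
    then obtain z where z: "z \<in> Z" "bits x \<one> (2 * ?i z)" by blast
    have "limit_action a x \<in> P (\<theta> a z)" if a: "a \<in> carrier G" for a
    proof -
      have "bits x a (2 * ?i (\<theta> a z))" using elim(2) z a by blast
      then show ?thesis unfolding P_def using bits_limit_action[OF one_closed, of a x] a by simp
    qed
    with z(1) show ?case by blast
  qed
  let ?c = "cost limit_measure (orbit_relation G limit_measure limit_action)"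
  have "?c \<le> of_nat (card E) * ennreal (1 / real (card Z))"
    by (rule cost_le_arrows[OF pmp_limit E PM Pm factor])
  also have "\<dots> = ennreal (real (card E) / real (card Z))"
    by (simp add: ennreal_of_nat_eq_real_of_nat ennreal_mult[symmetric])
  finally have "?c \<le> ennreal (real (card E) / real (card Z))" .
  moreover have "?c \<in> free_action_costs G"
    unfolding free_action_costs_def using standard_limit pmp_limit free by blast
  then have "inf_cost G \<le> ?c"
    unfolding inf_cost_def by (rule Inf_lower)
  ultimately show ?thesis by simp
qed

end

section \<open>Ranks of finite index subgroups\<close>

lemma tendsto_sequentially_ultrafilterI:
  assumes "\<And>\<UU>. nonprincipal_ultrafilter \<UU> \<Longrightarrow> (f \<longlongrightarrow> l) \<UU>"
  shows "f \<longlonglongrightarrow> l"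
proof (rule topological_tendstoI)
  fix S assume "open S" "l \<in> S"
  then show "eventually (\<lambda>n. f n \<in> S) sequentially"
    using assms by (intro eventually_sequentially_ultrafilterI topological_tendstoD)
qed

context group
begin

lemma lcosets_facts:
  assumes "finite_index_subgroup H G"
  shows "subgroup H G" "finite (lcosets H)" "lcosets H \<noteq> {}" "group_action G (lcosets H) (coset_action G H)"
    "card (lcosets H) = group_index G H" "group_index G H > 0"
proof -
  show *: "subgroup H G" "finite (lcosets H)"
    using assms unfolding finite_index_subgroup_def by blast+
  show "lcosets H \<noteq> {}" using trivial_coset_mem[OF *(1)] by blast
  then show "group_index G H > 0" unfolding group_index_def using *(2) by (simp add: card_gt_0_iff)
  show "group_action G (lcosets H) (coset_action G H)" by (rule group_action_cosets[OF *(1)])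
  show "card (lcosets H) = group_index G H" unfolding group_index_def ..
qed

text \<open>Schreier's lemma: the arrows labelled by a finite generating set of \<open>G\<close> at
  all cosets generate the groupoid, and \<open>H\<close> is the stabilizer of the trivial
  coset.\<close>

lemma finite_index_generators:
  assumes fg: "finitely_generated G" and H: "finite_index_subgroup H G"
  obtains T where "finite T" "T \<subseteq> H" "generate G T = H"
proof -
  note L = lcosets_facts[OF H]
  interpret A: group_action G "lcosets H" "coset_action G H" by (rule L(4))
  obtain S where S: "finite S" "S \<subseteq> carrier G" "generate G S = carrier G"
    using fg unfolding finitely_generated_def by blast
  let ?E = "S \<times> lcosets H"
  have "generates_groupoid G (lcosets H) (coset_action G H) ?E"
  proof (rule A.generates_groupoidI[OF S(2,3)])
    fix y s assume y: "y \<in> lcosets H" and s: "s \<in> S"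
    have "(\<one>, s \<otimes> \<one>) \<in> arrow_connected G (coset_action G H) ?E y"
      using y s S(2) by (intro arrow_connected_edge) (auto simp: A.one_action)
    then show "(\<one>, s) \<in> arrow_connected G (coset_action G H) ?E y" using s S(2) by auto
  qed
  moreover have "finite ?E" "?E \<subseteq> carrier G \<times> lcosets H" using S L(2) by auto
  ultimately obtain T where "finite T" "T \<subseteq> stabilizer G (coset_action G H) H"
    "generate G T = stabilizer G (coset_action G H) H"
    using A.stabilizer_generators[OF L(2) _ _ _ trivial_coset_mem[OF L(1)]] by metis
  then show ?thesis unfolding stabilizer_coset[OF L(1)] by (rule that)
qed

lemma torsion_free_subgroupD:
  assumes "torsion_free (G\<lparr>carrier := \<Lambda>\<rparr>)" "g \<in> \<Lambda>" "g \<noteq> \<one>" "k > 0"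
  shows "g [^] (k :: nat) \<noteq> \<one>"
  using assms unfolding torsion_free_def by (auto simp flip: nat_pow_consistent)

text \<open>Adding to \<open>T\<close> a representative in \<open>H\<close> of each coset of
  \<open>\<Lambda>\<close> that meets \<open>H\<close> gives a generating set of
  \<open>H\<close>.\<close>

lemma group_rank_overgroup:
  assumes H: "subgroup H G" and \<Lambda>: "finite_index_subgroup \<Lambda> G"
    and T: "finite T" "T \<subseteq> H \<inter> \<Lambda>" "generate G T = H \<inter> \<Lambda>"
  shows "group_rank (G\<lparr>carrier := H\<rparr>) \<le> card T + group_index G \<Lambda>"
proof -
  note L = lcosets_facts[OF \<Lambda>]
  have Hc: "H \<subseteq> carrier G" using H by (rule subgroup.subset)
  define C where "C = {C \<in> lcosets \<Lambda>. C \<inter> H \<noteq> {}}"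
  have "\<forall>X\<in>C. \<exists>r. r \<in> X \<inter> H" unfolding C_def by blast
  from bchoice[OF this] obtain r where r: "\<And>X. X \<in> C \<Longrightarrow> r X \<in> X \<inter> H" by blast
  let ?S = "T \<union> r ` C"
  have finC: "finite C" unfolding C_def using L(2) by simp
  have sub: "?S \<subseteq> H" using T(2) r by blast
  have "generate G ?S = H"
  proof
    show "generate G ?S \<subseteq> H" by (rule generate_subgroup_incl[OF sub H])
    show "H \<subseteq> generate G ?S"
    proof
      fix h assume h: "h \<in> H"
      then have hc: "h \<in> carrier G" using Hc by blast
      have "h \<in> h <# \<Lambda>" using hc subgroup.one_closed[OF L(1)] unfolding l_coset_def by force
      then have X: "h <# \<Lambda> \<in> C" unfolding C_def using h hc unfolding LCOSETS_def by blast
      define k where "k = r (h <# \<Lambda>)"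
      have k: "k \<in> h <# \<Lambda>" "k \<in> H" using r[OF X] by (auto simp: k_def)
      have kc: "k \<in> carrier G" using k(2) Hc by blast
      have "h <# \<Lambda> = k <# \<Lambda>" by (rule l_repr_independence[OF k(1) hc L(1)])
      then have "inv k \<otimes> h \<in> \<Lambda>" using l_coset_eq_iff[OF L(1) kc hc] by simp
      moreover have "inv k \<otimes> h \<in> H"
        using h k(2) subgroup.m_closed[OF H] subgroup.m_inv_closed[OF H] by blast
      ultimately have "inv k \<otimes> h \<in> generate G T" using T(3) by blast
      then have "inv k \<otimes> h \<in> generate G ?S" using mono_generate[of T ?S] by blast
      moreover have "k \<in> generate G ?S" using X by (intro generate.incl) (auto simp: k_def)
      ultimately have "k \<otimes> (inv k \<otimes> h) \<in> generate G ?S" by (rule generate.eng[rotated])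
      then show "h \<in> generate G ?S" using inv_cancel(1)[OF kc hc] by simp
    qed
  qed
  then have "group_rank (G\<lparr>carrier := H\<rparr>) \<le> card ?S"
    using T(1) finC sub by (intro group_rank_le[OF H]) auto
  also have "\<dots> \<le> card T + card (r ` C)" by (rule card_Un_le)
  also have "card (r ` C) \<le> card C" using finC by (rule card_image_le)
  also have "card C \<le> group_index G \<Lambda>"
    unfolding C_def L(5)[symmetric] using L(2) by (intro card_mono) auto
  finally show ?thesis by simp
qed

text \<open>The orbits of \<open>G/H \<times> G/\<Lambda>\<close> are at most \<open>[G : \<Lambda>]\<close> in number, as \<open>G/H\<close> is transitive.\<close>

lemma group_rank_arrows:
  assumes H: "finite_index_subgroup H G" and \<Lambda>: "finite_index_subgroup \<Lambda> G"
    and E: "finite E" "E \<subseteq> carrier G \<times> ((lcosets H) \<times> (lcosets \<Lambda>))"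
      "generates_groupoid G ((lcosets H) \<times> (lcosets \<Lambda>))
         (product_action (lcosets H) (coset_action G H) (lcosets \<Lambda>) (coset_action G \<Lambda>)) E"
  shows "group_rank (G\<lparr>carrier := H\<rparr>) + group_index G H * group_index G \<Lambda> \<le> card E + 2 * group_index G \<Lambda>"
proof -
  note LH = lcosets_facts[OF H] and LL = lcosets_facts[OF \<Lambda>]
  let ?Y = "(lcosets H) \<times> (lcosets \<Lambda>)"
  let ?\<phi> = "product_action (lcosets H) (coset_action G H) (lcosets \<Lambda>) (coset_action G \<Lambda>)"
  interpret A: group_action G ?Y ?\<phi> by (rule group_action_product[OF LH(4) LL(4)])
  interpret AH: group_action G "lcosets H" "coset_action G H" by (rule LH(4))
  have HL: "H \<in> lcosets H" "\<Lambda> \<in> lcosets \<Lambda>" using trivial_coset_mem LH(1) LL(1) by blast+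
  have "stabilizer G ?\<phi> (H, \<Lambda>) = stabilizer G (coset_action G H) H \<inter> stabilizer G (coset_action G \<Lambda>) \<Lambda>"
    using HL by (auto simp: stabilizer_def)
  then have stab: "stabilizer G ?\<phi> (H, \<Lambda>) = H \<inter> \<Lambda>"
    by (simp add: stabilizer_coset LH(1) LL(1))
  have y0: "(H, \<Lambda>) \<in> ?Y" using HL by blast
  obtain T where T: "finite T" "T \<subseteq> H \<inter> \<Lambda>" "generate G T = H \<inter> \<Lambda>"
    "card T + card ?Y \<le> card E + card (orbits G ?Y ?\<phi>)"
    using A.stabilizer_generators[OF _ E y0] LH(2) LL(2) unfolding stab by (metis finite_cartesian_product)
  have "orbits G ?Y ?\<phi> \<subseteq> (\<lambda>z. orbit G ?\<phi> (H, z)) ` (lcosets \<Lambda>)"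
  proof
    fix X assume "X \<in> orbits G ?Y ?\<phi>"
    then obtain y z where yz: "y \<in> lcosets H" "z \<in> lcosets \<Lambda>" "X = orbit G ?\<phi> (y, z)"
      unfolding orbits_def by blast
    have "H \<in> orbit G (coset_action G H) y" using orbit_cosets[OF LH(1) yz(1)] HL by simp
    then obtain g where g: "g \<in> carrier G" "coset_action G H g y = H" unfolding orbit_def by blast
    have "X = orbit G ?\<phi> (?\<phi> g (y, z))" using A.orbit_eqI[of "(y, z)" g] yz g(1) by simp
    also have "?\<phi> g (y, z) = (H, coset_action G \<Lambda> g z)" using yz g by simp
    finally show "X \<in> (\<lambda>z. orbit G ?\<phi> (H, z)) ` (lcosets \<Lambda>)"
      using group_action.element_image[OF LL(4) g(1) yz(2)] by blast
  qed
  \<comment> \<open>One \<open>group_index G \<Lambda>\<close> comes from the number of orbits, the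
    other from the passage from \<open>H \<inter> \<Lambda>\<close> to \<open>H\<close>.\<close>
  then have "card (orbits G ?Y ?\<phi>) \<le> card (lcosets \<Lambda>)"
    using LL(2) by (meson card_image_le card_mono finite_imageI le_trans)
  moreover have "group_rank (G\<lparr>carrier := H\<rparr>) \<le> card T + group_index G \<Lambda>"
    by (rule group_rank_overgroup[OF LH(1) \<Lambda> T(1-3)])
  ultimately show ?thesis using T(4) by (simp add: card_cartesian_product LH(5) LL(5))
qed

text \<open>\<open>H\<close> is a single subgroup and the bound is not asymptotic:
  \<open>G/H\<close> is the finite factor, and the sequence \<open>Y\<close> supplies freeness. The
  summand -1 is that of \<open>groupoid_generators\<close>.\<close>

lemma inf_cost_le_rank:
  assumes cnt: "countable (carrier G)" and fg: "finitely_generated G" and U: "nonprincipal_ultrafilter \<UU>"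
    and Y: "\<And>n. finite (Y n)" "\<And>n. Y n \<noteq> {}" and act: "\<And>n. group_action G (Y n) (\<psi> n)"
    and sofic: "\<And>\<gamma>. \<gamma> \<in> carrier G \<Longrightarrow> \<gamma> \<noteq> \<one> \<Longrightarrow>
      ((\<lambda>n. real (card {y \<in> Y n. \<psi> n \<gamma> y = y}) / real (card (Y n))) \<longlongrightarrow> 0) \<UU>"
    and H: "finite_index_subgroup H G"
  shows "inf_cost G \<le> ennreal (1 + (real (group_rank (G\<lparr>carrier := H\<rparr>)) - 1) / real (group_index G H))"
proof -
  note L = lcosets_facts[OF H]
  interpret A: group_action G "lcosets H" "coset_action G H" by (rule L(4))
  have HL: "H \<in> lcosets H" by (rule trivial_coset_mem[OF L(1)])
  obtain T0 where "finite T0" "T0 \<subseteq> H" "generate G T0 = H" by (rule finite_index_generators[OF fg H])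
  then obtain T where T: "finite T" "T \<subseteq> H" "generate G T = H" "card T = group_rank (G\<lparr>carrier := H\<rparr>)"
    by (rule group_rank_generators[OF L(1)])
  obtain E where E: "finite E" "E \<subseteq> carrier G \<times> lcosets H"
    "generates_groupoid G (lcosets H) (coset_action G H) E" "card E + 1 \<le> card (lcosets H) + card T"
    using A.groupoid_generators[OF L(2) HL orbit_cosets[OF L(1) HL], of T] T
    unfolding stabilizer_coset[OF L(1)] by blast
  have "inf_cost G \<le> ennreal (real (card E) / real (card (lcosets H)))"
    by (rule inf_cost_le_arrows[OF cnt U Y act sofic L(2-4) E(1-3)])
  also have "\<dots> \<le> ennreal (1 + (real (group_rank (G\<lparr>carrier := H\<rparr>)) - 1) / real (group_index G H))"
  proof (rule ennreal_leI)
    have "real (card E) \<le> real (group_index G H) + (real (group_rank (G\<lparr>carrier := H\<rparr>)) - 1)"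
      using E(4) T(4) L(5) by linarith
    then have "real (card E) / real (group_index G H)
        \<le> (real (group_index G H) + (real (group_rank (G\<lparr>carrier := H\<rparr>)) - 1)) / real (group_index G H)"
      by (rule divide_right_mono) simp
    then show "real (card E) / real (card (lcosets H))
        \<le> 1 + (real (group_rank (G\<lparr>carrier := H\<rparr>)) - 1) / real (group_index G H)"
      using L(5,6) by (simp add: add_divide_distrib)
  qed
  finally show ?thesis .
qed

end

section \<open>Finite index subgroups of a Stuck-Zimmer group\<close>

locale Stuck_Zimmer_sequence = group G for G :: "('a, 'b) monoid_scheme" (structure) +
  fixes H :: "nat \<Rightarrow> 'a set"
  assumes SZ: "Stuck_Zimmer G" and fg: "finitely_generated G"
    and H: "\<And>n. finite_index_subgroup (H n) G"
    and index: "filterlim (\<lambda>n. group_index G (H n)) at_top sequentially"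
begin

abbreviation Y :: "nat \<Rightarrow> 'a set set" where "Y n \<equiv> lcosets (H n)"
abbreviation \<psi> :: "nat \<Rightarrow> 'a \<Rightarrow> 'a set \<Rightarrow> 'a set" where "\<psi> n \<equiv> coset_action G (H n)"
abbreviation idx :: "nat \<Rightarrow> nat" where "idx n \<equiv> group_index G (H n)"
abbreviation rank :: "nat \<Rightarrow> nat" where "rank n \<equiv> group_rank (G\<lparr>carrier := H n\<rparr>)"

lemma cnt: "countable (carrier G)"
  using SZ unfolding Stuck_Zimmer_def by blast

lemmas L = lcosets_facts[OF H]

lemma Y_trans: "y \<in> Y n \<Longrightarrow> orbit G (\<psi> n) y = Y n"
  by (rule orbit_cosets[OF L(1)])

lemma Y_lim:
  assumes "nonprincipal_ultrafilter \<UU>"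
  shows "filterlim (\<lambda>n. card (Y n)) at_top \<UU>"
  using filterlim_mono[OF index order_refl nonprincipal_ultrafilter_le_sequentially[OF assms]]
  by (simp only: L(5))

lemma fixed_ratio:
  assumes "nonprincipal_ultrafilter \<UU>" "\<gamma> \<in> carrier G" "\<And>k :: nat. k > 0 \<Longrightarrow> \<gamma> [^] k \<noteq> \<one>"
  shows "((\<lambda>n. real (card {y \<in> Y n. \<psi> n \<gamma> y = y}) / real (card (Y n))) \<longlongrightarrow> 0) \<UU>"
  by (rule Stuck_Zimmer_fixed_points[OF SZ fg assms(1) L(2-4) Y_trans Y_lim[OF assms(1)] assms(2,3)])

lemma sofic_torsion_free:
  assumes \<Lambda>: "subgroup \<Lambda> G" "torsion_free (G\<lparr>carrier := \<Lambda>\<rparr>)"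
  shows "sofic_approximation (G\<lparr>carrier := \<Lambda>\<rparr>) Y \<psi>"
proof (rule sofic_approximationI)
  have c: "\<Lambda> \<subseteq> carrier G" using \<Lambda>(1) by (rule subgroup.subset)
  show "group (G\<lparr>carrier := \<Lambda>\<rparr>)" using \<Lambda>(1) by (rule subgroup_imp_group)
  show "countable (carrier (G\<lparr>carrier := \<Lambda>\<rparr>))" using countable_subset[OF c cnt] by simp
  show "finite (Y n)" "Y n \<noteq> {}" for n by (rule L(2), rule L(3))
  show "group_action (G\<lparr>carrier := \<Lambda>\<rparr>) (Y n) (\<psi> n)" for n by (rule group_action_restrict[OF \<Lambda>(1) L(4)])
  fix \<UU> \<gamma> assume U: "nonprincipal_ultrafilter \<UU>"
    and \<gamma>: "\<gamma> \<in> carrier (G\<lparr>carrier := \<Lambda>\<rparr>)" "\<gamma> \<noteq> \<one>\<^bsub>G\<lparr>carrier := \<Lambda>\<rparr>\<^esub>"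
  then have g: "\<gamma> \<in> \<Lambda>" "\<gamma> \<noteq> \<one>" by simp_all
  show "((\<lambda>n. real (card {y \<in> Y n. \<psi> n \<gamma> y = y}) / real (card (Y n))) \<longlongrightarrow> 0) \<UU>"
    by (rule fixed_ratio[OF U _ torsion_free_subgroupD[OF \<Lambda>(2) g]]) (use g(1) c in blast)
qed

lemma Farber:
  assumes "torsion_free G \<or> strong_Stuck_Zimmer G"
  shows "Farber_sequence G H"
  unfolding Farber_sequence_def
proof (intro conjI allI ballI H)
  fix \<gamma> assume \<gamma>: "\<gamma> \<in> carrier G - {\<one>}"
  have "\<gamma> \<in> a <# H n #> inv a \<longleftrightarrow> \<psi> n \<gamma> (a <# H n) = a <# H n" if "a \<in> carrier G" for a n
    using \<gamma> that by (simp add: coset_action_fixed_iff[OF L(1)] conjugate_mem_iff[OF L(1)])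
  then have "{g <# H n |g. g \<in> carrier G \<and> \<gamma> \<in> g <# H n #> inv g} = {y \<in> Y n. \<psi> n \<gamma> y = y}" for n
    unfolding LCOSETS_def by blast
  moreover have "(\<lambda>n. real (card {y \<in> Y n. \<psi> n \<gamma> y = y}) / real (card (Y n))) \<longlonglongrightarrow> 0"
  proof (rule tendsto_sequentially_ultrafilterI)
    fix \<UU> assume U: "nonprincipal_ultrafilter \<UU>"
    from assms show "((\<lambda>n. real (card {y \<in> Y n. \<psi> n \<gamma> y = y}) / real (card (Y n))) \<longlongrightarrow> 0) \<UU>"
    proof
      assume "torsion_free G"
      then show ?thesis using \<gamma> unfolding torsion_free_def by (intro fixed_ratio[OF U]) auto
    next
      assume "strong_Stuck_Zimmer G"
      from strong_Stuck_Zimmer_fixed_points[OF this fg U L(2-4) Y_trans Y_lim[OF U]]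
      show ?thesis using \<gamma> by blast
    qed
  qed
  ultimately show "(\<lambda>n. real (card {g <# H n |g. g \<in> carrier G \<and> \<gamma> \<in> g <# H n #> inv g})
      / real (idx n)) \<longlonglongrightarrow> 0"
    by (simp add: L(5))
qed

text \<open>The action of \<open>G\<close> on \<open>G/H\<^sub>n\<close> need not be asymptotically free when \<open>G\<close> has torsion. The
  product with \<open>G/\<Lambda>\<close> is: elements of finite order have no fixed points in the second factor.\<close>

lemma rank_upper:
  assumes \<Lambda>: "finite_index_subgroup \<Lambda> G" "torsion_free (G\<lparr>carrier := \<Lambda>\<rparr>)"
    and cost: "sup_cost G < ennreal \<kappa>"
  shows "eventually (\<lambda>n. real (rank n) + real (idx n) * real (group_index G \<Lambda>)
    \<le> \<kappa> * (real (idx n) * real (group_index G \<Lambda>)) + 2 * real (group_index G \<Lambda>)) sequentially"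
proof (rule eventually_sequentially_ultrafilterI)
  fix \<UU> assume U: "nonprincipal_ultrafilter \<UU>"
  note LL = lcosets_facts[OF \<Lambda>(1)]
  let ?Z = "lcosets \<Lambda>" and ?\<theta> = "coset_action G \<Lambda>"
  have sofic: "((\<lambda>n. real (card {p \<in> Y n \<times> ?Z. product_action (Y n) (\<psi> n) ?Z ?\<theta> \<gamma> p = p})
      / real (card (Y n \<times> ?Z))) \<longlongrightarrow> 0) \<UU>" if \<gamma>: "\<gamma> \<in> carrier G" "\<gamma> \<noteq> \<one>" for \<gamma>
  proof (cases "\<forall>k :: nat. k > 0 \<longrightarrow> \<gamma> [^] k \<noteq> \<one>")
    case True
    then have inf: "\<And>k :: nat. k > 0 \<Longrightarrow> \<gamma> [^] k \<noteq> \<one>" by blast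
    show ?thesis
    proof (rule tendsto_sandwich[OF _ _ tendsto_const fixed_ratio[OF U \<gamma>(1) inf]])
      show "eventually (\<lambda>n. real (card {p \<in> Y n \<times> ?Z. product_action (Y n) (\<psi> n) ?Z ?\<theta> \<gamma> p = p})
          / real (card (Y n \<times> ?Z)) \<le> real (card {y \<in> Y n. \<psi> n \<gamma> y = y}) / real (card (Y n))) \<UU>"
        by (intro always_eventually allI product_action_fixed_ratio L(2) LL(2,3))
    qed simp
  next
    case False
    then obtain k :: nat where k: "k > 0" "\<gamma> [^] k = \<one>" by blast
    \<comment> \<open>A fixed coset would put a conjugate of \<open>\<gamma>\<close> into
      \<open>\<Lambda>\<close>, and its \<open>k\<close>-th power is trivial as well.\<close>
    have "?\<theta> \<gamma> z \<noteq> z" if z: "z \<in> ?Z" for z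
    proof
      assume fixed: "?\<theta> \<gamma> z = z"
      obtain a where a: "a \<in> carrier G" "z = a <# \<Lambda>" using z unfolding LCOSETS_def by blast
      let ?g = "inv a \<otimes> \<gamma> \<otimes> a"
      have "?g \<in> \<Lambda>" using fixed coset_action_fixed_iff[OF LL(1) \<gamma>(1) a(1)] a(2) by blast
      moreover have "?g [^] j = inv a \<otimes> \<gamma> [^] j \<otimes> a" for j :: nat
      proof (induction j)
        case (Suc j)
        then show ?case using a(1) \<gamma>(1) by (simp add: m_assoc inv_cancel)
      qed (use a(1) in simp)
      then have "?g [^] k = \<one>" using k(2) a(1) by simp
      ultimately have "?g = \<one>" using torsion_free_subgroupD[OF \<Lambda>(2) _ _ k(1)] by blast
      then have "a \<otimes> (inv a \<otimes> (\<gamma> \<otimes> a)) = a \<otimes> \<one>" using a(1) \<gamma>(1) by (simp add: m_assoc)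
      then have "\<gamma> \<otimes> a = a" using a(1) \<gamma>(1) by (simp add: inv_cancel)
      then show False using a(1) \<gamma> by simp
    qed
    then have empty: "{p \<in> Y n \<times> ?Z. product_action (Y n) (\<psi> n) ?Z ?\<theta> \<gamma> p = p} = {}" for n by auto
    show ?thesis unfolding empty by simp
  qed
  have YZ: "finite (Y n \<times> ?Z)" "Y n \<times> ?Z \<noteq> {}" for n using L(2,3) LL(2,3) by simp_all
  have "eventually (\<lambda>n. \<exists>E. finite E \<and> E \<subseteq> carrier G \<times> (Y n \<times> ?Z) \<and>
      generates_groupoid G (Y n \<times> ?Z) (product_action (Y n) (\<psi> n) ?Z ?\<theta>) E \<and>
      real (card E) \<le> \<kappa> * real (card (Y n \<times> ?Z))) \<UU>"
    by (rule sofic_arrows[OF cnt fg U YZ group_action_product[OF L(4) LL(4)] _ cost]) (rule sofic)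
  then show "eventually (\<lambda>n. real (rank n) + real (idx n) * real (group_index G \<Lambda>)
    \<le> \<kappa> * (real (idx n) * real (group_index G \<Lambda>)) + 2 * real (group_index G \<Lambda>)) \<UU>"
  proof eventually_elim
    case (elim n)
    then obtain E where E: "finite E" "E \<subseteq> carrier G \<times> (Y n \<times> ?Z)"
      "generates_groupoid G (Y n \<times> ?Z) (product_action (Y n) (\<psi> n) ?Z ?\<theta>) E"
      "real (card E) \<le> \<kappa> * real (card (Y n \<times> ?Z))" by blast
    have "real (rank n + idx n * group_index G \<Lambda>) \<le> real (card E + 2 * group_index G \<Lambda>)"
      using group_rank_arrows[OF H \<Lambda>(1) E(1-3)] by (rule of_nat_mono)
    also have "real (card E + 2 * group_index G \<Lambda>) = real (card E) + 2 * real (group_index G \<Lambda>)" by simp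
    also have "\<dots> \<le> \<kappa> * (real (idx n) * real (group_index G \<Lambda>)) + 2 * real (group_index G \<Lambda>)"
      using E(4) by (simp add: card_cartesian_product L(5) LL(5))
    finally show ?case by simp
  qed
qed

lemma inverse_index: "(\<lambda>n. a / real (idx n)) \<longlonglongrightarrow> 0"
  by (rule tendsto_divide_0[OF tendsto_const filterlim_at_top_imp_at_infinity])
    (rule filterlim_compose[OF filterlim_real_sequentially index])

text \<open>The factor \<open>group_index G \<Lambda>\<close> is lost because the points of the
  product are counted while only \<open>H n\<close> is wanted. It is harmless for
  \<open>\<Lambda> = carrier G\<close> and for \<open>r = 1\<close>, the two cases in which the
  bound is applied.\<close>

lemma rank_gradient_upper:
  assumes \<Lambda>: "finite_index_subgroup \<Lambda> G" "torsion_free (G\<lparr>carrier := \<Lambda>\<rparr>)"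
    and cost: "sup_cost G \<le> ennreal r" "r \<ge> 0" and \<epsilon>: "\<epsilon> > 0"
  shows "eventually (\<lambda>n. (real (rank n) - 1) / real (idx n) < (r - 1) * real (group_index G \<Lambda>) + \<epsilon>) sequentially"
proof -
  define d where "d = real (group_index G \<Lambda>)"
  have d: "d > 0" using lcosets_facts(6)[OF \<Lambda>(1)] by (simp add: d_def)
  \<comment> \<open>After multiplication by \<open>d\<close> this spends half of \<epsilon>; the
    other half absorbs the constant term divided by the index.\<close>
  define \<kappa> where "\<kappa> = r + \<epsilon> / (2 * d)"
  have "sup_cost G < ennreal \<kappa>"
    using cost \<epsilon> d by (intro le_less_trans[OF cost(1)] ennreal_lessI) (auto simp: \<kappa>_def add_pos_pos add_nonneg_pos)
  note rank_upper[OF \<Lambda> this]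
  moreover have "eventually (\<lambda>n. (2 * d - 1) / real (idx n) < \<epsilon> / 2) sequentially"
    using inverse_index \<epsilon> by (intro order_tendstoD(2)) auto
  ultimately show ?thesis
  proof eventually_elim
    case (elim n)
    have i: "real (idx n) > 0" using L(6) by simp
    have "real (rank n) - 1 \<le> (\<kappa> - 1) * d * real (idx n) + (2 * d - 1)"
      using elim(1) unfolding d_def[symmetric] by (simp add: algebra_simps)
    then have "(real (rank n) - 1) / real (idx n) \<le> ((\<kappa> - 1) * d * real (idx n) + (2 * d - 1)) / real (idx n)"
      using i by (intro divide_right_mono) auto
    also have "\<dots> = (\<kappa> - 1) * d + (2 * d - 1) / real (idx n)"
      using i by (simp add: add_divide_distrib)
    also have "\<dots> < (\<kappa> - 1) * d + \<epsilon> / 2" using elim(2) by simp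
    also have "\<dots> = (r - 1) * d + \<epsilon>" using d by (simp add: \<kappa>_def field_simps)
    finally show ?case by (simp add: d_def)
  qed
qed

lemma rank_gradient_torsion_free:
  assumes tf: "torsion_free G" and fp: "fixed_price G"
  shows "(\<lambda>n. ereal ((real (rank n) - 1) / real (idx n))) \<longlonglongrightarrow> enn2ereal (inf_cost G) - 1"
proof -
  obtain \<UU> where U: "nonprincipal_ultrafilter \<UU>"
    by (rule nonprincipal_ultrafilter_containing[OF infinite_UNIV_nat])
  have sofic: "((\<lambda>n. real (card {y \<in> Y n. \<psi> n \<gamma> y = y}) / real (card (Y n))) \<longlongrightarrow> 0) \<UU>"
    if "\<gamma> \<in> carrier G" "\<gamma> \<noteq> \<one>" for \<gamma>
    using tf that unfolding torsion_free_def by (intro fixed_ratio[OF U]) auto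
  have lower: "inf_cost G \<le> ennreal (1 + (real (rank n) - 1) / real (idx n))" for n
    by (rule inf_cost_le_rank[OF cnt fg U L(2-4) sofic H])
  define r where "r = enn2real (inf_cost G)"
  have "inf_cost G < \<infinity>" using le_less_trans[OF lower[of 0] ennreal_less_top] by simp
  then have r: "inf_cost G = ennreal r" "r \<ge> 0" by (simp_all add: r_def)
  have sup: "sup_cost G \<le> ennreal r" using fp r(1) unfolding fixed_price_def by simp
  \<comment> \<open>The whole group serves as \<open>\<Lambda>\<close>, so the index factor is 1 and
    the upper bound matches the lower one.\<close>
  have G: "finite_index_subgroup (carrier G) G" "torsion_free (G\<lparr>carrier := carrier G\<rparr>)"
    "group_index G (carrier G) = 1"
  proof -
    have "lcosets (carrier G) = {carrier G}"
      unfolding LCOSETS_def using coset_join3[OF _ subgroup_self] one_closed by auto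
    then show "finite_index_subgroup (carrier G) G" "group_index G (carrier G) = 1"
      unfolding finite_index_subgroup_def group_index_def using subgroup_self by simp_all
    show "torsion_free (G\<lparr>carrier := carrier G\<rparr>)" using tf by simp
  qed
  have "(\<lambda>n. (real (rank n) - 1) / real (idx n)) \<longlonglongrightarrow> r - 1"
  proof (rule order_tendstoI)
    fix a assume "a < r - 1"
    moreover have "r - 1 \<le> (real (rank n) - 1) / real (idx n)" for n
    proof -
      \<comment> \<open>As \<open>ennreal\<close> truncates at 0, \<open>lower\<close> says
        something about real numbers only if its right-hand side is nonnegative. The rank may be 0,
        but the index is at least 1.\<close>
      have "- 1 \<le> - 1 / real (idx n)" using L(6)[of n] by (simp add: divide_le_eq_1)
      also have "\<dots> \<le> (real (rank n) - 1) / real (idx n)" by (rule divide_right_mono) auto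
      finally show ?thesis using lower[of n] unfolding r(1) by (simp add: ennreal_le_iff)
    qed
    ultimately show "eventually (\<lambda>n. a < (real (rank n) - 1) / real (idx n)) sequentially"
      by (intro always_eventually allI) (rule less_le_trans)
  next
    fix a assume "r - 1 < a"
    then show "eventually (\<lambda>n. (real (rank n) - 1) / real (idx n) < a) sequentially"
      using rank_gradient_upper[OF G(1,2) sup r(2), of "a - (r - 1)"] by (simp add: G(3))
  qed
  then have "(\<lambda>n. ereal ((real (rank n) - 1) / real (idx n))) \<longlonglongrightarrow> ereal (r - 1)" by simp
  also have "ereal (r - 1) = enn2ereal (inf_cost G) - 1"
    unfolding r(1) using r(2) by (simp add: enn2ereal_ennreal one_ereal_def)
  finally show ?thesis .
qed

lemma rank_gradient_price_one:
  assumes "fixed_price G" "inf_cost G = 1"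
    and \<Lambda>: "finite_index_subgroup \<Lambda> G" "torsion_free (G\<lparr>carrier := \<Lambda>\<rparr>)"
  shows "(\<lambda>n. (real (rank n) - 1) / real (idx n)) \<longlonglongrightarrow> 0"
proof (rule order_tendstoI)
  have sup: "sup_cost G \<le> ennreal 1" using assms(1,2) unfolding fixed_price_def by simp
  fix a :: real
  show "eventually (\<lambda>n. (real (rank n) - 1) / real (idx n) < a) sequentially" if "0 < a"
    using rank_gradient_upper[OF \<Lambda> sup _ that] by simp
  assume a: "a < 0"
  \<comment> \<open>For price 1 the lower bound follows from the rank being nonnegative and the
    index tending to infinity.\<close>
  have "eventually (\<lambda>n. a < - 1 / real (idx n)) sequentially"
    using order_tendstoD(1)[OF inverse_index a] .
  then show "eventually (\<lambda>n. a < (real (rank n) - 1) / real (idx n)) sequentially"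
  proof eventually_elim
    case (elim n)
    also have "- 1 / real (idx n) \<le> (real (rank n) - 1) / real (idx n)"
      by (rule divide_right_mono) auto
    finally show ?case .
  qed
qed

end

theorem theorem4p14:
  fixes \<Gamma> :: "('a, 'b) monoid_scheme" and H :: "nat \<Rightarrow> 'a set"
  assumes "Stuck_Zimmer \<Gamma>"
    and "finitely_generated \<Gamma>"
    and "\<And>n. finite_index_subgroup (H n) \<Gamma>"
    and "filterlim (\<lambda>n. group_index \<Gamma> (H n)) at_top sequentially"
  shows
    "(\<forall>\<Lambda>. subgroup \<Lambda> \<Gamma> \<and> torsion_free (\<Gamma>\<lparr>carrier := \<Lambda>\<rparr>) \<longrightarrow>
        sofic_approximation (\<Gamma>\<lparr>carrier := \<Lambda>\<rparr>) (\<lambda>n. lcosets\<^bsub>\<Gamma>\<^esub> (H n)) (\<lambda>n. coset_action \<Gamma> (H n)))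
     \<and> (torsion_free \<Gamma> \<or> strong_Stuck_Zimmer \<Gamma> \<longrightarrow> Farber_sequence \<Gamma> H)
     \<and> (torsion_free \<Gamma> \<and> fixed_price \<Gamma> \<longrightarrow>
          (\<lambda>n. ereal ((real (group_rank (\<Gamma>\<lparr>carrier := H n\<rparr>)) - 1) / real (group_index \<Gamma> (H n))))
            \<longlonglongrightarrow> enn2ereal (inf_cost \<Gamma>) - 1)
     \<and> (fixed_price \<Gamma> \<and> inf_cost \<Gamma> = 1 \<and>
          (\<exists>\<Lambda>. finite_index_subgroup \<Lambda> \<Gamma> \<and> torsion_free (\<Gamma>\<lparr>carrier := \<Lambda>\<rparr>)) \<longrightarrow>
          (\<lambda>n. (real (group_rank (\<Gamma>\<lparr>carrier := H n\<rparr>)) - 1) / real (group_index \<Gamma> (H n)))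
            \<longlonglongrightarrow> 0)"
proof -
  have "group \<Gamma>" using assms(1) unfolding Stuck_Zimmer_def by blast
  then interpret Stuck_Zimmer_sequence \<Gamma> H
    by (intro Stuck_Zimmer_sequence.intro Stuck_Zimmer_sequence_axioms.intro assms)
  show ?thesis
    using sofic_torsion_free Farber rank_gradient_torsion_free rank_gradient_price_one by blast
qed

end
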